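(* Let $\Omega\subset\mathbb{R}^n$ be a bounded Lipschitz domain, let $0<s<1$ and $m\in\mathbb{N}$. Let $F_s\colon \mathcal{A}_s(\Omega)^m\to[0,\infty]$ be a decreasing and weak $\gamma_s$-lower semicontinuous functional. Then there exists a solution to $$ \min\left\{F_s(A_1,\dots,A_m)\colon A_i\in\mathcal{A}_s(\Omega),\ \operatorname{cap}_s(A_i\cap A_j,\Omega)=0 \text{ for } i\neq j\right\}, $$ that is, the infimum of $F_s$ over this admissible class is attained.
   Context: Gagliardo seminorm: $[u]_s^2=\iint_{\mathbb{R}^n\times\mathbb{R}^n}\frac{|u(x)-u(y)|^2}{|x-y|^{n+2s}}\,dx\,dy$. $H^s(\mathbb{R}^n)$ is the set of $u\in L^2(\mathbb{R}^n)$ with $[u]_s<\infty$, with norm $\|u\|_s^2=\|u\|_2^2+[u]_s^2$, and $H^s_0(\Omega)$ is the closure of $C_c^\infty(\Omega)$ in $\|\cdot\|_s$ (functions extended by $0$ outside $\Omega$). The $s$-capacity of $A\subset\Omega$ is $\operatorname{cap}_s(A,\Omega)=\inf\{[u]_s^2\colon u\in C_c^\infty(\Omega),\ u\ge1\text{ in a neighborhood of }A\}$. A property holds $s$-q.e. on a set if it holds there outside a set of zero $s$-capacity. A set $A\subset\Omega$ is $s$-quasi open if there is a decreasing sequence of open sets $G_k$ with $\operatorname{cap}_s(G_k,\Omega)\to0$ and $A\cup G_k$ open for each $k$; $\mathcal{A}_s(\Omega)$ is the class of all $s$-quasi open subsets of $\Omega$. A function $u\colon\mathbb{R}^n\to\mathbb{R}$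 is $s$-quasi-continuous if there is a decreasing sequence of open sets $G_k$ with $\operatorname{cap}_s(G_k,\Omega)\to0$ and $u|_{\mathbb{R}^n\setminus G_k}$ continuous. Each $u\in H_0^s(\Omega)$ has a (unique up to $s$-q.e. equality) $s$-quasi-continuous representative, with which it is identified. For $A\in\mathcal{A}_s(\Omega)$, $H_0^s(A)=\{u\in H_0^s(\Omega)\colon u=0\ s\text{-q.e. in }\mathbb{R}^n\setminus A\}$. For $A\in\mathcal{A}_s(\Omega)$, $u_A^s\in H_0^s(A)$ is the unique weak solution of $(-\Delta)^su_A^s=1$ in $A$, $u_A^s=0$ in $\mathbb{R}^n\setminus A$, i.e. $\frac{c(n,s)}{2}\iint\frac{(u_A^s(x)-u_A^s(y))(\varphi(x)-\varphi(y))}{|x-y|^{n+2s}}\,dx\,dy=\int_\Omega\varphi\,dx$ for all $\varphi\in H_0^s(A)$, where $c(n,s)=\left(\int_{\mathbb{R}^n}\frac{1-\cos\zeta_1}{|\zeta|^{n+2s}}\,d\zeta\right)^{-1}$. Weak $\gamma_s$-convergence: for $A_k\in\mathcal{A}_s(\Omega)$, $A_k\rightharpoonup A$ weakly in $\gamma_s$ if $u_{A_k}^s\to u$ strongly in $L^2(\Omega)$ for some $u$ (necessarily in $H^s_0(\Omega)$) with $\{u>0\}=A$ (equality up to sets of zero $s$-capacity); for $m$-tuples the convergence is required in each coordinate. $F_s$ is weak $\gamma_s$-lower semicontinuous if $F_s(A_1,\dots,A_m)\le\liminf_{k\to\infty}F_s(A_1^k,\dots,A_m^k)$ whenever $(A_1^k,\dots,A_m^k)\rightharpoonup(A_1,\dots,A_m)$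 weakly in $\gamma_s$. $F_s$ is decreasing if $F_s(A_1,\dots,A_m)\ge F_s(B_1,\dots,B_m)$ whenever $A_i,B_i\in\mathcal{A}_s(\Omega)$ and $A_i\subset B_i$ for all $i$.
   Formalization: The s-capacity is taken over u in H_0^s(Ω) with u ≥ 1 a.e. in a neighborhood of A, not over C_c^∞(Ω): the literal formula is infinite unless the closure of A is compact in Ω, so quasi-continuous representatives and u_A can fail to exist. Both agree on compact A. *)

theory Defs
  imports "HOL-Analysis.Analysis"
begin

text \<open>
  The space R^n is a type of class \<open>euclidean_space\<close> with n = \<open>DIM('a)\<close>. Functions are
  Lebesgue (not just Borel) measurable, since a quasi-continuous representative may be
  changed arbitrarily on a set of zero capacity.
\<close>

section \<open>Bounded Lipschitz domains and test functions\<close>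

text \<open>Near every boundary point, and after a rotation sending \<open>e\<close> to the last coordinate
  vector, the set lies strictly below the graph of a Lipschitz function of the other n - 1
  coordinates.\<close>

definition lipschitz_domain :: "'a::euclidean_space set \<Rightarrow> bool" where
  "lipschitz_domain \<Omega> \<longleftrightarrow> open \<Omega> \<and> connected \<Omega> \<and> \<Omega> \<noteq> {} \<and>
     (\<forall>p\<in>frontier \<Omega>. \<exists>r>0. \<exists>e g L. norm e = 1 \<and> L-lipschitz_on {y. y \<bullet> e = 0} g \<and>
        \<Omega> \<inter> ball p r = {x \<in> ball p r. x \<bullet> e < g (x - (x \<bullet> e) *\<^sub>R e)})"

fun times_cont_diff :: "nat \<Rightarrow> ('a::euclidean_space \<Rightarrow> real) \<Rightarrow> bool" where
  "times_cont_diff 0 f \<longleftrightarrow> continuous_on UNIV f"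
| "times_cont_diff (Suc k) f \<longleftrightarrow> (\<forall>x. f differentiable (at x)) \<and>
     (\<forall>b\<in>Basis. times_cont_diff k (\<lambda>x. frechet_derivative f (at x) b))"

definition test_functions :: "'a::euclidean_space set \<Rightarrow> ('a \<Rightarrow> real) set" where
  "test_functions \<Omega> = {\<phi>. (\<forall>k. times_cont_diff k \<phi>) \<and>
     compact (closure {x. \<phi> x \<noteq> 0}) \<and> closure {x. \<phi> x \<noteq> 0} \<subseteq> \<Omega>}"


section \<open>Fractional Sobolev spaces\<close>

definition gagliardo_sq :: "real \<Rightarrow> ('a::euclidean_space \<Rightarrow> real) \<Rightarrow> ennreal" where
  "gagliardo_sq s u = (\<integral>\<^sup>+ z. ennreal ((u (fst z) - u (snd z))\<^sup>2 /
     norm (fst z - snd z) powr (real DIM('a) + 2 * s)) \<partial>(lebesgue :: ('a \<times> 'a) measure))"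

definition Hs_norm_sq :: "real \<Rightarrow> ('a::euclidean_space \<Rightarrow> real) \<Rightarrow> ennreal" where
  "Hs_norm_sq s u = (\<integral>\<^sup>+ x. ennreal ((u x)\<^sup>2) \<partial>lebesgue) + gagliardo_sq s u"

definition Hs :: "real \<Rightarrow> ('a::euclidean_space \<Rightarrow> real) set" where
  "Hs s = {u. u \<in> borel_measurable lebesgue \<and>
     (\<integral>\<^sup>+ x. ennreal ((u x)\<^sup>2) \<partial>lebesgue) < \<infinity> \<and> gagliardo_sq s u < \<infinity>}"

definition H0s :: "real \<Rightarrow> 'a::euclidean_space set \<Rightarrow> ('a \<Rightarrow> real) set" where
  "H0s s \<Omega> = {u \<in> Hs s. (\<forall>x. x \<notin> \<Omega> \<longrightarrow> u x = 0) \<and>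
     (\<exists>\<phi>. (\<forall>k. \<phi> k \<in> test_functions \<Omega>) \<and>
          (\<lambda>k. Hs_norm_sq s (\<lambda>x. \<phi> k x - u x)) \<longlonglongrightarrow> 0)}"


section \<open>Capacity and quasi-topological notions\<close>

text \<open>
  The competitors range over \<open>H0s s \<Omega>\<close>, the closure of the test functions, and the
  obstacle condition holds a.e. in an open neighbourhood of \<open>A\<close>. For compact \<open>A \<subseteq> \<Omega>\<close> this
  equals the infimum over test functions \<open>u\<close> with \<open>u \<ge> 1\<close> in a neighbourhood of \<open>A\<close>: if
  \<open>\<phi>\<^sub>k \<rightarrow> min u 1\<close> in norm and \<open>\<eta>\<close> is a cut-off equal to 1 near \<open>A\<close> and supported where
  \<open>u \<ge> 1\<close>, then \<open>\<eta> + (1 - \<eta>) \<phi>\<^sub>k\<close> are test functions with the same limit. For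
  arbitrary sets the formula with test functions does not give a countably subadditive
  capacity: it charges \<open>A\<close> like its closure, and is infinite unless the closure is contained
  in \<open>\<Omega>\<close>. With it, elements of \<open>H0s s \<Omega>\<close> need not have quasi-continuous representatives.
\<close>

definition cap :: "real \<Rightarrow> 'a::euclidean_space set \<Rightarrow> 'a set \<Rightarrow> ennreal" where
  "cap s A \<Omega> = (INF u \<in> {u \<in> H0s s \<Omega>.
     \<exists>V. open V \<and> A \<subseteq> V \<and> (AE x in lebesgue. x \<in> V \<longrightarrow> 1 \<le> u x)}. gagliardo_sq s u)"

definition holds_qe :: "real \<Rightarrow> 'a::euclidean_space set \<Rightarrow> 'a set \<Rightarrow> ('a \<Rightarrow> bool) \<Rightarrow> bool" where
  "holds_qe s \<Omega> S P \<longleftrightarrow> (\<exists>N\<subseteq>\<Omega>. cap s N \<Omega> = 0 \<and> (\<forall>x\<in>S - N. P x))"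

definition small_open_seq :: "real \<Rightarrow> 'a::euclidean_space set \<Rightarrow> (nat \<Rightarrow> 'a set) \<Rightarrow> bool" where
  "small_open_seq s \<Omega> G \<longleftrightarrow> decseq G \<and> (\<forall>k. open (G k) \<and> G k \<subseteq> \<Omega>) \<and>
     (\<lambda>k. cap s (G k) \<Omega>) \<longlonglongrightarrow> 0"

definition quasi_open_sets :: "real \<Rightarrow> 'a::euclidean_space set \<Rightarrow> 'a set set" where
  "quasi_open_sets s \<Omega> = {A. A \<subseteq> \<Omega> \<and> (\<exists>G. small_open_seq s \<Omega> G \<and> (\<forall>k. open (A \<union> G k)))}"

definition quasi_continuous :: "real \<Rightarrow> 'a::euclidean_space set \<Rightarrow> ('a \<Rightarrow> real) \<Rightarrow> bool" where
  "quasi_continuous s \<Omega> u \<longleftrightarrow> (\<exists>G. small_open_seq s \<Omega> G \<and> (\<forall>k. continuous_on (- G k) u))"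

text \<open>Elements are quasi-continuous representatives, unique up to q.e. equality.\<close>

definition H0s_on :: "real \<Rightarrow> 'a::euclidean_space set \<Rightarrow> 'a set \<Rightarrow> ('a \<Rightarrow> real) set" where
  "H0s_on s \<Omega> A = {u \<in> H0s s \<Omega>. quasi_continuous s \<Omega> u \<and>
     holds_qe s \<Omega> (- A) (\<lambda>x. u x = 0)}"


section \<open>The torsion problem and weak \<open>\<gamma>\<^sub>s\<close>-convergence\<close>

text \<open>By rotation invariance the value does not depend on the choice of the coordinate.\<close>

definition frac_const :: "'a::euclidean_space itself \<Rightarrow> real \<Rightarrow> real" where
  "frac_const _ s = inverse (LINT \<zeta>|(lebesgue :: 'a measure).
     (1 - cos (\<zeta> \<bullet> (SOME b. b \<in> Basis))) / norm \<zeta> powr (real DIM('a) + 2 * s))"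

definition torsion_solution ::
    "real \<Rightarrow> 'a::euclidean_space set \<Rightarrow> 'a set \<Rightarrow> ('a \<Rightarrow> real) \<Rightarrow> bool" where
  "torsion_solution s \<Omega> A u \<longleftrightarrow> u \<in> H0s_on s \<Omega> A \<and> (\<forall>\<phi>\<in>H0s_on s \<Omega> A.
     frac_const TYPE('a) s / 2 *
       (LINT z|(lebesgue :: ('a \<times> 'a) measure).
          (u (fst z) - u (snd z)) * (\<phi> (fst z) - \<phi> (snd z)) /
          norm (fst z - snd z) powr (real DIM('a) + 2 * s)) =
     (LINT x:\<Omega>|lebesgue. \<phi> x))"

text \<open>Torsion functions are determined up to q.e. equality, so their choice is irrelevant
  here.\<close>

definition weak_gamma_conv ::
    "real \<Rightarrow> 'a::euclidean_space set \<Rightarrow> (nat \<Rightarrow> 'a set) \<Rightarrow> 'a set \<Rightarrow> bool" where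
  "weak_gamma_conv s \<Omega> A B \<longleftrightarrow> (\<exists>v u. (\<forall>k. torsion_solution s \<Omega> (A k) (v k)) \<and>
     u \<in> H0s s \<Omega> \<and> quasi_continuous s \<Omega> u \<and>
     (\<lambda>k. \<integral>\<^sup>+ x \<in> \<Omega>. ennreal ((v k x - u x)\<^sup>2) \<partial>lebesgue) \<longlonglongrightarrow> 0 \<and>
     cap s (({x. u x > 0} - B) \<union> (B - {x. u x > 0})) \<Omega> = 0)"


section \<open>Functionals of m-tuples of quasi-open sets\<close>

definition quasi_open_tuples ::
    "real \<Rightarrow> 'a::euclidean_space set \<Rightarrow> nat \<Rightarrow> (nat \<Rightarrow> 'a set) set" where
  "quasi_open_tuples s \<Omega> m = {1..m} \<rightarrow>\<^sub>E quasi_open_sets s \<Omega>"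

definition decreasing_functional ::
    "real \<Rightarrow> 'a::euclidean_space set \<Rightarrow> nat \<Rightarrow> ((nat \<Rightarrow> 'a set) \<Rightarrow> ennreal) \<Rightarrow> bool" where
  "decreasing_functional s \<Omega> m F \<longleftrightarrow>
     (\<forall>A\<in>quasi_open_tuples s \<Omega> m. \<forall>B\<in>quasi_open_tuples s \<Omega> m.
        (\<forall>i\<in>{1..m}. A i \<subseteq> B i) \<longrightarrow> F A \<ge> F B)"

definition weak_gamma_lsc ::
    "real \<Rightarrow> 'a::euclidean_space set \<Rightarrow> nat \<Rightarrow> ((nat \<Rightarrow> 'a set) \<Rightarrow> ennreal) \<Rightarrow> bool" where
  "weak_gamma_lsc s \<Omega> m F \<longleftrightarrow>
     (\<forall>S A. (\<forall>k. S k \<in> quasi_open_tuples s \<Omega> m) \<and> A \<in> quasi_open_tuples s \<Omega> m \<and>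
        (\<forall>i\<in>{1..m}. weak_gamma_conv s \<Omega> (\<lambda>k. S k i) (A i)) \<longrightarrow>
        F A \<le> liminf (\<lambda>k. F (S k)))"

definition admissible_partitions ::
    "real \<Rightarrow> 'a::euclidean_space set \<Rightarrow> nat \<Rightarrow> (nat \<Rightarrow> 'a set) set" where
  "admissible_partitions s \<Omega> m = {A \<in> quasi_open_tuples s \<Omega> m.
     \<forall>i\<in>{1..m}. \<forall>j\<in>{1..m}. i \<noteq> j \<longrightarrow> cap s (A i \<inter> A j) \<Omega> = 0}"

end

theory Submission
  imports Defs "HOL-Library.Diagonal_Subsequence"
begin

text \<open>
  Take a minimizing sequence of partitions. Testing the torsion equations with the torsion
  functions themselves bounds their energies, so by compactness, along a subsequence, they
  converge in \<open>L\<^sup>2\<close> to quasi-continuous functions \<open>u\<^sub>i\<close>, and the sets \<open>{u\<^sub>i > 0}\<close> are the weak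
  \<open>\<gamma>\<^sub>s\<close>-limits. In the limit \<open>u\<^sub>i u\<^sub>j = 0\<close> a.e.; since a quasi-open Lebesgue null set has zero
  capacity, these sets form an admissible partition, and lower semicontinuity makes it a minimizer.

  The \<open>L\<^sup>2\<close> limits stay in the closure of the test functions, since this closure is weakly closed:
  by the parallelogram identity, almost minimizers of the energy over decreasing midpoint-convex
  sets form a Cauchy sequence.
\<close>

section \<open>Squared \<open>L\<^sup>2\<close> norms\<close>

text \<open>The gap to bridge: compactness gives limits known almost everywhere, while admissibility
  and limit sets are matters of capacity. Two facts close it. The obstacle in \<open>cap\<close> is
  imposed only a.e. on an open set, so a Lebesgue null set that becomes open after adding a set of
  small capacity has small capacity itself. And energy limits of quasi-continuous functions have
  quasi-continuous versions, reached pointwise q.e. along a subsequence, so vanishing q.e. outside a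
  set survives the limit. All estimates use squared norms in \<open>ennreal\<close>. The seminorm is
  the squared L2 norm of a difference quotient on the product space, so the same facts about
  \<open>l2sq\<close> serve both. The price is a factor 2 in each triangle inequality; countable
  sums carry weights 2^(j+1), which geometric rates such as (1/4)^j absorb. Where a factor would be
  fatal, as for minimality in the limit, Young's inequality with a free parameter removes
  it.\<close>

lemma tendsto_0_ennrealI:
  fixes f :: "'b \<Rightarrow> ennreal"
  assumes "\<And>e::real. 0 < e \<Longrightarrow> eventually (\<lambda>x. f x \<le> ennreal e) F"
  shows "(f \<longlongrightarrow> 0) F"
proof (rule order_tendstoI)
  fix a :: ennreal assume "0 < a"
  then obtain b where b: "0 < b" "b < a" using dense by blast
  then have "b < top" by (metis top.not_eq_extremum not_less_iff_gr_or_eq order_less_trans)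
  then have "0 < enn2real b" "b = ennreal (enn2real b)"
    using b(1) by (auto simp: enn2real_positive_iff)
  with assms[of "enn2real b"] b(2) show "eventually (\<lambda>x. f x < a) F"
    by (auto elim: eventually_mono)
qed simp

lemma tendsto_0_ennrealD:
  fixes f :: "'b \<Rightarrow> ennreal"
  assumes "(f \<longlongrightarrow> 0) F" "0 < e"
  shows "eventually (\<lambda>x. f x \<le> ennreal e) F"
  using order_tendstoD(2)[OF assms(1), of "ennreal e"] assms(2)
  by (auto elim!: eventually_mono simp: less_imp_le)

lemma tendsto_0_ennreal_le:
  fixes f :: "'b \<Rightarrow> ennreal"
  assumes "(g \<longlongrightarrow> 0) F" "eventually (\<lambda>x. f x \<le> ennreal c * g x) F"
  shows "(f \<longlongrightarrow> 0) F"
proof (rule tendsto_sandwich[where f = "\<lambda>_. 0"])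
  show "((\<lambda>x. ennreal c * g x) \<longlongrightarrow> 0) F"
    using ennreal_tendsto_cmult[OF _ assms(1), of "ennreal c"] by simp
qed (use assms in auto)

lemma ennreal_inverse_Suc_tendsto: "(\<lambda>k. ennreal (1 / real (Suc k))) \<longlonglongrightarrow> 0"
  unfolding ennreal_0[symmetric] by (rule tendsto_ennrealI[OF LIMSEQ_Suc[OF lim_1_over_n]])

lemma numeral_mult_ennreal: "0 \<le> x \<Longrightarrow> numeral n * ennreal x = ennreal (numeral n * x)"
  by (simp add: ennreal_mult)

lemma ennreal_two_power: "(2::ennreal) ^ n = ennreal (2 ^ n)"
  using ennreal_power[of 2 n] by simp

lemma ennreal_le_suminf: "f j \<le> suminf f" for f :: "nat \<Rightarrow> ennreal"
  using sum_le_suminf[of f "{j}"] by simp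

text \<open>The weights 2^(i+1) are those of \<open>cap_UN_le\<close>; against sets of capacity of
  order (1/4)^(k+i) they leave a series of ratio 1/2, so tails still decay like (1/4)^k.\<close>

lemma suminf_geometric_half: "(\<Sum>i. 2 ^ (i + 1) * ennreal (c * (1/4) ^ (k + i))) = ennreal (4 * c * (1/4) ^ k)"
  if "c \<ge> 0" for c :: real
proof -
  have "2 ^ (i + 1) * ennreal (c * (1/4) ^ (k + i)) = ennreal (2 * c * (1/4) ^ k * (1/2) ^ i)" for i
  proof -
    have "2 ^ (i + 1) * ennreal (c * (1/4) ^ (k + i)) = ennreal (2 ^ (i + 1) * (c * (1/4) ^ (k + i)))"
      unfolding ennreal_two_power using that by (intro ennreal_mult[symmetric]) auto
    also have "(2::real) ^ (i + 1) * (c * (1/4) ^ (k + i)) = 2 * c * (1/4) ^ k * (2 * (1/4)) ^ i"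
      unfolding power_mult_distrib power_add by simp
    finally show ?thesis by simp
  qed
  moreover have "(\<Sum>i. ennreal (2 * c * (1/4) ^ k * (1/2) ^ i)) = ennreal (2 * c * (1/4) ^ k * 2)"
    using that geometric_sums[of "1/2::real"] by (intro suminf_ennreal_eq sums_mult) auto
  moreover have "2 * c * (1/4) ^ k * 2 = 4 * c * (1/4) ^ k" by simp
  ultimately show ?thesis by (simp only:)
qed

text \<open>Squared and with values in \<open>ennreal\<close>, so that the inequalities below need
  measurability but no integrability. Used on R^n and, through \<open>diffq\<close>, on the
  product.\<close>

definition l2sq :: "'b measure \<Rightarrow> ('b \<Rightarrow> real) \<Rightarrow> ennreal" where
  "l2sq M f = (\<integral>\<^sup>+ x. ennreal ((f x)\<^sup>2) \<partial>M)"

lemma l2sq_cong_AE: "AE x in M. f x = g x \<Longrightarrow> l2sq M f = l2sq M g"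
  unfolding l2sq_def by (rule nn_integral_cong_AE) auto

lemma l2sq_mono_AE: "AE x in M. \<bar>f x\<bar> \<le> \<bar>g x\<bar> \<Longrightarrow> l2sq M f \<le> l2sq M g"
  unfolding l2sq_def
  by (rule nn_integral_mono_AE) (auto elim!: eventually_mono intro!: ennreal_leI simp: abs_le_square_iff)

lemma l2sq_0 [simp]: "l2sq M (\<lambda>x. 0) = 0"
  by (simp add: l2sq_def)

lemma l2sq_commute: "l2sq M (\<lambda>x. f x - g x) = l2sq M (\<lambda>x. g x - f x)"
  by (simp add: l2sq_def power2_commute)

lemma l2sq_scale:
  assumes "f \<in> borel_measurable M"
  shows "l2sq M (\<lambda>x. c * f x) = ennreal (c\<^sup>2) * l2sq M f"
  unfolding l2sq_def using assms
  by (subst nn_integral_cmult[symmetric]) (auto simp: power_mult_distrib ennreal_mult)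

lemma l2sq_parallelogram:
  assumes [measurable]: "f \<in> borel_measurable M" "g \<in> borel_measurable M"
  shows "l2sq M (\<lambda>x. f x + g x) + l2sq M (\<lambda>x. f x - g x) = 2 * l2sq M f + 2 * l2sq M g"
proof -
  have "ennreal ((f x + g x)\<^sup>2) + ennreal ((f x - g x)\<^sup>2) = 2 * ennreal ((f x)\<^sup>2) + 2 * ennreal ((g x)\<^sup>2)" for x
  proof -
    have "(f x + g x)\<^sup>2 + (f x - g x)\<^sup>2 = 2 * (f x)\<^sup>2 + 2 * (g x)\<^sup>2"
      by (simp add: power2_eq_square algebra_simps)
    then have "ennreal ((f x + g x)\<^sup>2) + ennreal ((f x - g x)\<^sup>2) = ennreal (2 * (f x)\<^sup>2 + 2 * (g x)\<^sup>2)"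
      by (simp flip: ennreal_plus)
    then show ?thesis by (simp add: ennreal_mult)
  qed
  then show ?thesis unfolding l2sq_def
    by (subst nn_integral_add[symmetric], simp, simp, simp,
        subst nn_integral_cmult[symmetric], simp, subst nn_integral_cmult[symmetric], simp,
        subst nn_integral_add[symmetric], simp, simp, simp)
qed

lemma l2sq_add_le:
  assumes "f \<in> borel_measurable M" "g \<in> borel_measurable M"
  shows "l2sq M (\<lambda>x. f x + g x) \<le> 2 * l2sq M f + 2 * l2sq M g"
  using l2sq_parallelogram[OF assms] by (metis le_iff_add)

lemma l2sq_diff_le:
  assumes "f \<in> borel_measurable M" "g \<in> borel_measurable M"
  shows "l2sq M (\<lambda>x. f x - g x) \<le> 2 * l2sq M f + 2 * l2sq M g"
  using l2sq_parallelogram[OF assms] by (metis le_iff_add add.commute)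

lemma l2sq_triangle_le:
  assumes [measurable]: "f \<in> borel_measurable M" "g \<in> borel_measurable M" "h \<in> borel_measurable M"
  shows "l2sq M (\<lambda>x. f x - h x) \<le> 2 * l2sq M (\<lambda>x. f x - g x) + 2 * l2sq M (\<lambda>x. g x - h x)"
  using l2sq_add_le[of "\<lambda>x. f x - g x" M "\<lambda>x. g x - h x"] by simp

text \<open>Splitting off the first summand costs a factor 2 each time. The weight thus depends on
  the index and not on \<open>n\<close>, so the bound survives \<open>n\<close> tending to
  infinity.\<close>

lemma l2sq_sum_le:
  assumes "\<And>j::nat. f j \<in> borel_measurable M"
  shows "l2sq M (\<lambda>x. \<Sum>j<n. f j x) \<le> (\<Sum>j<n. 2 ^ (j + 1) * l2sq M (f j))"
  using assms
proof (induction n arbitrary: f)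
  case (Suc n)
  note [measurable] = Suc.prems
  have "l2sq M (\<lambda>x. \<Sum>j<Suc n. f j x) = l2sq M (\<lambda>x. f 0 x + (\<Sum>j<n. f (Suc j) x))"
    by (simp only: sum.lessThan_Suc_shift)
  also have "\<dots> \<le> 2 * l2sq M (f 0) + 2 * l2sq M (\<lambda>x. \<Sum>j<n. f (Suc j) x)"
    by (rule l2sq_add_le) auto
  also have "\<dots> \<le> 2 * l2sq M (f 0) + 2 * (\<Sum>j<n. 2 ^ (j + 1) * l2sq M (f (Suc j)))"
    using Suc.IH[of "\<lambda>j. f (Suc j)"] Suc.prems by (intro add_left_mono mult_left_mono) auto
  also have "\<dots> = (\<Sum>j<Suc n. 2 ^ (j + 1) * l2sq M (f j))"
    by (simp only: sum.lessThan_Suc_shift sum_distrib_left) (simp add: mult.assoc)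
  finally show ?case .
qed simp

text \<open>Drop the second term of ((a+b)/2)^2 + ((a-b)/2)^2 = a^2/2 + b^2/2. This makes sublevel
  sets midpoint convex, as \<open>minimizing_sequence\<close> asks.\<close>

lemma l2sq_midpoint_le:
  assumes [measurable]: "f \<in> borel_measurable M" "g \<in> borel_measurable M"
    and "l2sq M f \<le> e" "l2sq M g \<le> e"
  shows "l2sq M (\<lambda>x. (f x + g x) / 2) \<le> e"
proof -
  have le: "ennreal (((f x + g x) / 2)\<^sup>2) \<le> ennreal (1/2) * ennreal ((f x)\<^sup>2) + ennreal (1/2) * ennreal ((g x)\<^sup>2)" for x
  proof -
    have "((f x + g x) / 2)\<^sup>2 + ((f x - g x) / 2)\<^sup>2 = 1/2 * (f x)\<^sup>2 + 1/2 * (g x)\<^sup>2"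
      by (simp add: power2_eq_square field_simps)
    then have "((f x + g x) / 2)\<^sup>2 \<le> 1/2 * (f x)\<^sup>2 + 1/2 * (g x)\<^sup>2"
      by (metis zero_le_power2 le_add_same_cancel1)
    then have "ennreal (((f x + g x) / 2)\<^sup>2) \<le> ennreal (1/2 * (f x)\<^sup>2 + 1/2 * (g x)\<^sup>2)"
      by (rule ennreal_leI)
    also have "\<dots> = ennreal (1/2) * ennreal ((f x)\<^sup>2) + ennreal (1/2) * ennreal ((g x)\<^sup>2)"
      by (subst ennreal_plus, simp, simp, subst ennreal_mult, simp, simp, subst ennreal_mult, simp_all)
    finally show ?thesis .
  qed
  have "l2sq M (\<lambda>x. (f x + g x) / 2) \<le> (\<integral>\<^sup>+x. ennreal (1/2) * ennreal ((f x)\<^sup>2) + ennreal (1/2) * ennreal ((g x)\<^sup>2) \<partial>M)"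
    unfolding l2sq_def by (rule nn_integral_mono) (rule le)
  also have "\<dots> = ennreal (1/2) * l2sq M f + ennreal (1/2) * l2sq M g"
    unfolding l2sq_def by (simp add: nn_integral_add nn_integral_cmult)
  also have "\<dots> \<le> ennreal (1/2) * e + ennreal (1/2) * e"
    using assms by (intro add_mono mult_left_mono) auto
  also have "\<dots> = e"
  proof -
    have "ennreal (1/2) + ennreal (1/2) = 1"
      by (subst ennreal_plus[symmetric]) (simp_all del: ennreal_plus)
    then show ?thesis by (simp flip: distrib_right del: ennreal_plus)
  qed
  finally show ?thesis .
qed

lemma l2sq_0_imp_AE:
  assumes [measurable]: "f \<in> borel_measurable M" and "l2sq M f = 0"
  shows "AE x in M. f x = 0"
  using assms(2) unfolding l2sq_def by (subst (asm) nn_integral_0_iff_AE) auto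

lemma l2sq_Fatou:
  assumes [measurable]: "\<And>j. f j \<in> borel_measurable M"
    and "AE x in M. (\<lambda>j. f j x) \<longlonglongrightarrow> g x" and "eventually (\<lambda>j. l2sq M (f j) \<le> e) sequentially"
  shows "l2sq M g \<le> e"
proof -
  have "l2sq M g = (\<integral>\<^sup>+ x. liminf (\<lambda>j. ennreal ((f j x)\<^sup>2)) \<partial>M)"
    unfolding l2sq_def
  proof (rule nn_integral_cong_AE, use assms(2) in eventually_elim)
    fix x assume "(\<lambda>j. f j x) \<longlonglongrightarrow> g x"
    then have "(\<lambda>j. ennreal ((f j x)\<^sup>2)) \<longlonglongrightarrow> ennreal ((g x)\<^sup>2)"
      by (intro tendsto_ennrealI tendsto_intros)
    then show "ennreal ((g x)\<^sup>2) = liminf (\<lambda>j. ennreal ((f j x)\<^sup>2))"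
      by (intro lim_imp_Liminf[symmetric]) simp_all
  qed
  also have "\<dots> \<le> liminf (\<lambda>j. l2sq M (f j))"
    unfolding l2sq_def by (rule nn_integral_liminf) auto
  also have "\<dots> \<le> e"
    using assms(3) by (intro Liminf_le) (auto simp: eventually_sequentially)
  finally show ?thesis .
qed

text \<open>The bound is kept without the factor 2 of \<open>l2sq_triangle_le\<close>, which
  minimality of a limit requires. In Young's inequality with parameter \<open>t\<close>, first
  \<open>j\<close> tends to infinity, which removes the term with 1/t, then \<open>t\<close> tends
  to 0.\<close>

lemma l2sq_limit_le:
  assumes [measurable]: "\<And>j. f j \<in> borel_measurable M" "g \<in> borel_measurable M"
    and lim: "(\<lambda>j. l2sq M (\<lambda>x. f j x - g x)) \<longlonglongrightarrow> 0" and bd: "eventually (\<lambda>j. l2sq M (f j) \<le> ennreal e) sequentially"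
    and "e \<ge> 0"
  shows "l2sq M g \<le> ennreal e"
proof -
  have young: "l2sq M g \<le> ennreal (1 + t) * l2sq M (f j) + ennreal (1 + 1 / t) * l2sq M (\<lambda>x. f j x - g x)"
    if t: "t > 0" for t j
  proof -
    have "ennreal ((g x)\<^sup>2) \<le> ennreal (1 + t) * ennreal ((f j x)\<^sup>2) + ennreal (1 + 1 / t) * ennreal ((f j x - g x)\<^sup>2)" for x
    proof -
      define a b where "a = f j x" and "b = f j x - g x"
      have "(1 + t) * a\<^sup>2 + (1 + 1 / t) * b\<^sup>2 - (a - b)\<^sup>2 = (t * a + b)\<^sup>2 / t"
        using t by (simp add: power2_eq_square field_simps)
      also have "\<dots> \<ge> 0" using t by simp
      finally have "(g x)\<^sup>2 \<le> (1 + t) * a\<^sup>2 + (1 + 1 / t) * b\<^sup>2"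
        by (simp add: a_def b_def)
      then show ?thesis using t unfolding a_def b_def
        by (simp add: ennreal_mult[symmetric] ennreal_plus[symmetric] ennreal_leI del: ennreal_plus)
    qed
    then have "l2sq M g \<le> (\<integral>\<^sup>+x. ennreal (1 + t) * ennreal ((f j x)\<^sup>2) + ennreal (1 + 1 / t) * ennreal ((f j x - g x)\<^sup>2) \<partial>M)"
      unfolding l2sq_def by (rule nn_integral_mono)
    also have "\<dots> = ennreal (1 + t) * l2sq M (f j) + ennreal (1 + 1 / t) * l2sq M (\<lambda>x. f j x - g x)"
      unfolding l2sq_def by (simp add: nn_integral_add nn_integral_cmult)
    finally show ?thesis .
  qed
  have step: "l2sq M g \<le> ennreal ((1 + t) * e)" if t: "t > 0" for t
  proof -
    have "(\<lambda>j. ennreal (1 + t) * ennreal e + ennreal (1 + 1 / t) * l2sq M (\<lambda>x. f j x - g x)) \<longlonglongrightarrow>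
       ennreal (1 + t) * ennreal e + ennreal (1 + 1 / t) * 0"
      by (intro tendsto_intros ennreal_tendsto_cmult lim) auto
    moreover have "eventually (\<lambda>j. l2sq M g \<le> ennreal (1 + t) * ennreal e + ennreal (1 + 1 / t) * l2sq M (\<lambda>x. f j x - g x)) sequentially"
      using bd
    proof eventually_elim
      case (elim j)
      show ?case by (rule order_trans[OF young[OF t, of j]]) (intro add_right_mono mult_left_mono elim, simp)
    qed
    ultimately have "l2sq M g \<le> ennreal (1 + t) * ennreal e + ennreal (1 + 1 / t) * 0"
      by (rule tendsto_lowerbound) simp
    then show ?thesis using t assms(5) by (simp add: ennreal_mult)
  qed
  have "(\<lambda>n. ennreal ((1 + 1 / real (Suc n)) * e)) \<longlonglongrightarrow> ennreal ((1 + 0) * e)"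
    by (intro tendsto_ennrealI tendsto_intros LIMSEQ_Suc[OF lim_1_over_n])
  then show ?thesis
    using tendsto_lowerbound[of _ "ennreal e" sequentially "l2sq M g"] step by simp
qed

lemma l2_mult_integrable:
  assumes [measurable]: "f \<in> borel_measurable M" "g \<in> borel_measurable M"
    and "l2sq M f < \<infinity>" "l2sq M g < \<infinity>"
  shows "integrable M (\<lambda>x. f x * g x)"
proof (rule Bochner_Integration.integrable_bound)
  have "integrable M (\<lambda>x. (f x)\<^sup>2)" "integrable M (\<lambda>x. (g x)\<^sup>2)"
    using assms(3,4) unfolding l2sq_def by (auto intro!: integrableI_nonneg)
  then show "integrable M (\<lambda>x. (f x)\<^sup>2 + (g x)\<^sup>2)" by simp
  show "AE x in M. norm (f x * g x) \<le> norm ((f x)\<^sup>2 + (g x)\<^sup>2)"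
  proof (rule AE_I2)
    fix x
    have "0 \<le> (\<bar>f x\<bar> - \<bar>g x\<bar>)\<^sup>2" by simp
    also have "\<dots> = (f x)\<^sup>2 + (g x)\<^sup>2 - 2 * \<bar>f x * g x\<bar>"
      by (simp add: power2_diff abs_mult)
    finally show "norm (f x * g x) \<le> norm ((f x)\<^sup>2 + (g x)\<^sup>2)"
      by simp
  qed
qed measurable

lemma l2sq_eq_integral:
  assumes [measurable]: "f \<in> borel_measurable M" and "l2sq M f < \<infinity>"
  shows "enn2real (l2sq M f) = (LINT x|M. f x * f x)"
  using assms unfolding l2sq_def power2_eq_square
  by (subst integral_eq_nn_integral) auto

lemma l2sq_limit_unique:
  assumes [measurable]: "\<And>j. w j \<in> borel_measurable lebesgue" "u \<in> borel_measurable lebesgue" "v \<in> borel_measurable lebesgue"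
    and "(\<lambda>j. l2sq lebesgue (\<lambda>x. w j x - u x)) \<longlonglongrightarrow> 0" "(\<lambda>j. l2sq lebesgue (\<lambda>x. w j x - v x)) \<longlonglongrightarrow> 0"
  shows "AE x in lebesgue. u x = v x"
proof -
  have "(\<lambda>j. 2 * l2sq lebesgue (\<lambda>x. w j x - u x) + 2 * l2sq lebesgue (\<lambda>x. w j x - v x)) \<longlonglongrightarrow> 2 * 0 + 2 * 0"
    by (intro tendsto_add ennreal_tendsto_cmult assms) auto
  moreover have "l2sq lebesgue (\<lambda>x. u x - v x) \<le> 2 * l2sq lebesgue (\<lambda>x. w j x - u x) + 2 * l2sq lebesgue (\<lambda>x. w j x - v x)" for j
    using l2sq_triangle_le[of u lebesgue "w j" v] l2sq_commute[of lebesgue u "w j"] by simp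
  ultimately have "l2sq lebesgue (\<lambda>x. u x - v x) \<le> 2 * 0 + 2 * 0"
    by (intro tendsto_lowerbound[OF _ always_eventually]) auto
  then have "AE x in lebesgue. u x - v x = 0"
    by (intro l2sq_0_imp_AE) auto
  then show ?thesis by eventually_elim simp
qed

text \<open>Where \<open>u' k\<close> or \<open>v' k\<close> vanishes, min(|u|, |v|) is at most |u'
  k - u| + |v' k - v|, because the vanishing function misses its limit by the full value. The right
  side tends to 0 in L2.\<close>

lemma limits_disjoint:
  assumes [measurable]: "u \<in> borel_measurable lebesgue" "v \<in> borel_measurable lebesgue"
    "\<And>k. u' k \<in> borel_measurable lebesgue" "\<And>k. v' k \<in> borel_measurable lebesgue"
    and lim: "(\<lambda>k. l2sq lebesgue (\<lambda>x. u' k x - u x)) \<longlonglongrightarrow> 0" "(\<lambda>k. l2sq lebesgue (\<lambda>x. v' k x - v x)) \<longlonglongrightarrow> 0"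
    and ae: "\<And>k. AE x in lebesgue. u' k x = 0 \<or> v' k x = 0"
  shows "AE x in lebesgue. u x = 0 \<or> v x = (0::real)"
proof -
  define h where "h x = min \<bar>u x\<bar> \<bar>v x\<bar>" for x
  have [measurable]: "h \<in> borel_measurable lebesgue" unfolding h_def by measurable
  have "l2sq lebesgue h \<le> 2 * l2sq lebesgue (\<lambda>x. u' k x - u x) + 2 * l2sq lebesgue (\<lambda>x. v' k x - v x)" for k
  proof -
    have "l2sq lebesgue h \<le> l2sq lebesgue (\<lambda>x. \<bar>u' k x - u x\<bar> + \<bar>v' k x - v x\<bar>)"
      by (rule l2sq_mono_AE, use ae[of k] in eventually_elim) (auto simp: h_def)
    also have "\<dots> \<le> 2 * l2sq lebesgue (\<lambda>x. \<bar>u' k x - u x\<bar>) + 2 * l2sq lebesgue (\<lambda>x. \<bar>v' k x - v x\<bar>)"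
      by (rule l2sq_add_le) measurable
    finally show ?thesis by (simp add: l2sq_def)
  qed
  moreover have "(\<lambda>k. 2 * l2sq lebesgue (\<lambda>x. u' k x - u x) + 2 * l2sq lebesgue (\<lambda>x. v' k x - v x)) \<longlonglongrightarrow> 2 * 0 + 2 * 0"
    by (intro tendsto_add ennreal_tendsto_cmult lim) auto
  ultimately have "l2sq lebesgue h \<le> 2 * 0 + 2 * 0"
    by (intro tendsto_lowerbound[OF _ always_eventually]) auto
  then have "AE x in lebesgue. h x = 0" by (intro l2sq_0_imp_AE) auto
  then show ?thesis by eventually_elim (auto simp: h_def min_def split: if_splits)
qed

section \<open>Cauchy sequences in L2 and completeness\<close>

definition l2_Cauchy :: "'b measure \<Rightarrow> (nat \<Rightarrow> 'b \<Rightarrow> real) \<Rightarrow> bool" where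
  "l2_Cauchy M f \<longleftrightarrow> (\<forall>e>0. \<exists>N. \<forall>i\<ge>N. \<forall>j\<ge>N. l2sq M (\<lambda>x. f i x - f j x) \<le> ennreal e)"

lemma summable_diff_imp_convergent:
  fixes g :: "nat \<Rightarrow> real"
  assumes "\<And>j. \<bar>g (Suc j) - g j\<bar> \<le> K * (1/2) ^ j"
  shows "convergent g"
proof -
  have "summable (\<lambda>j. g (Suc j) - g j)"
  proof (rule summable_comparison_test)
    show "\<exists>N. \<forall>n\<ge>N. norm (g (Suc n) - g n) \<le> K * (1/2) ^ n"
      using assms by auto
    show "summable (\<lambda>j. K * (1/2::real) ^ j)"
      by (intro summable_mult summable_geometric) simp
  qed
  then have "convergent (\<lambda>n. \<Sum>j<n. g (Suc j) - g j)"
    by (simp add: summable_iff_convergent)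
  then have "convergent (\<lambda>n. g n - g 0)"
    by (simp add: sum_lessThan_telescope)
  then have "convergent (\<lambda>n. g n - g 0 + g 0)"
    by (intro convergent_add convergent_const)
  then show ?thesis by simp
qed

text \<open>The rate \<open>e\<close> is free: (1/8)^j gives a.e. convergence in
  \<open>l2_complete\<close>, (1/16)^j gives convergence outside sets of small capacity in
  \<open>quasi_limit\<close>.\<close>

lemma l2_Cauchy_fast_subseq:
  assumes C: "l2_Cauchy M f" and e: "\<And>j. e j > 0"
  obtains r where "strict_mono r" "\<And>j. l2sq M (\<lambda>x. f (r (Suc j)) x - f (r j) x) \<le> ennreal (e j)"
proof -
  have "\<forall>j. \<exists>N. \<forall>i\<ge>N. \<forall>k\<ge>N. l2sq M (\<lambda>x. f i x - f k x) \<le> ennreal (e j)"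
    using C e unfolding l2_Cauchy_def by blast
  then obtain N where N: "\<And>j i k. i \<ge> N j \<Longrightarrow> k \<ge> N j \<Longrightarrow> l2sq M (\<lambda>x. f i x - f k x) \<le> ennreal (e j)"
    by metis
  \<comment> \<open>Each index exceeds the previous one and the threshold \<open>N\<close> of its
    own tolerance.\<close>
  define r where "r = rec_nat (N 0) (\<lambda>j q. Suc (max q (N (Suc j))))"
  have rS: "r (Suc j) = Suc (max (r j) (N (Suc j)))" for j by (simp add: r_def)
  have "r (Suc j) > r j" for j using rS[of j] by simp
  then have sm: "strict_mono r" by (simp add: strict_mono_Suc_iff)
  have rN: "r j \<ge> N j" for j by (cases j) (auto simp: rS, simp add: r_def)
  have "l2sq M (\<lambda>x. f (r (Suc j)) x - f (r j) x) \<le> ennreal (e j)" for j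
    using N[of j "r (Suc j)" "r j"] rN[of j] rS[of j] by simp
  with sm that show ?thesis by blast
qed

text \<open>Riesz-Fischer. The last clause records common zeros of the sequence at every point, not
  just a.e., because membership in \<open>H0s\<close> asks for exact vanishing outside the
  domain.\<close>

lemma l2_complete:
  assumes meas [measurable]: "\<And>j. f j \<in> borel_measurable M" and C: "l2_Cauchy M f"
  obtains g r where "g \<in> borel_measurable M" "strict_mono r" "AE x in M. (\<lambda>j. f (r j) x) \<longlonglongrightarrow> g x"
    "(\<lambda>j. l2sq M (\<lambda>x. f j x - g x)) \<longlonglongrightarrow> 0" "\<And>x. (\<And>j. f j x = 0) \<Longrightarrow> g x = 0"
proof -
  \<comment> \<open>Weighting by 4^j turns the rate (1/8)^j into the summable (1/2)^j. Finiteness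
    a.e. of the weighted sum then bounds each increment by K (1/2)^j pointwise.\<close>
  obtain r where r: "strict_mono r" and fast: "\<And>j. l2sq M (\<lambda>x. f (r (Suc j)) x - f (r j) x) \<le> ennreal ((1/8) ^ j)"
    using l2_Cauchy_fast_subseq[OF C, of "\<lambda>j. (1/8) ^ j"] by auto
  define d where "d j x = f (r (Suc j)) x - f (r j) x" for j x
  have [measurable]: "d j \<in> borel_measurable M" for j unfolding d_def by measurable
  have "(\<integral>\<^sup>+x. (\<Sum>j. ennreal (4 ^ j) * ennreal ((d j x)\<^sup>2)) \<partial>M) = (\<Sum>j. ennreal (4 ^ j) * l2sq M (d j))"
    by (subst nn_integral_suminf) (auto simp: nn_integral_cmult l2sq_def)
  also have "\<dots> \<le> (\<Sum>j. ennreal ((1/2) ^ j))"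
  proof (intro suminf_le)
    fix j
    have "ennreal (4 ^ j) * l2sq M (d j) \<le> ennreal (4 ^ j) * ennreal ((1/8) ^ j)"
      using fast[of j] unfolding d_def by (intro mult_left_mono) auto
    also have "\<dots> = ennreal ((1/2) ^ j)"
      by (simp add: ennreal_mult[symmetric] power_mult_distrib[symmetric])
    finally show "ennreal (4 ^ j) * l2sq M (d j) \<le> ennreal ((1/2) ^ j)" .
  qed auto
  also have "\<dots> = ennreal 2"
    by (rule suminf_ennreal_eq) (auto intro: geometric_sums[of "1/2::real", simplified])
  also have "\<dots> < \<infinity>" by simp
  finally have "AE x in M. (\<Sum>j. ennreal (4 ^ j) * ennreal ((d j x)\<^sup>2)) \<noteq> \<infinity>"
    by (intro nn_integral_PInf_AE) auto
  then have conv: "AE x in M. convergent (\<lambda>j. f (r j) x)"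
  proof eventually_elim
    case (elim x)
    define S where "S = (\<Sum>j. ennreal (4 ^ j) * ennreal ((d j x)\<^sup>2))"
    define K where "K = sqrt (enn2real S)"
    have S: "S = ennreal (K\<^sup>2)" using elim unfolding K_def S_def by (simp add: less_top)
    have "\<bar>d j x\<bar> \<le> K * (1/2) ^ j" for j
    proof -
      have "ennreal (4 ^ j) * ennreal ((d j x)\<^sup>2) \<le> S"
        unfolding S_def using sum_le_suminf[of "\<lambda>j. ennreal (4 ^ j) * ennreal ((d j x)\<^sup>2)" "{j}"] by auto
      then have "4 ^ j * (d j x)\<^sup>2 \<le> K\<^sup>2"
        unfolding S by (subst (asm) ennreal_mult[symmetric]) (auto simp: ennreal_le_iff)
      then have "(2 ^ j * \<bar>d j x\<bar>)\<^sup>2 \<le> K\<^sup>2"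
        by (simp add: power_mult_distrib power_mult[symmetric] mult.commute[of _ 2]) (simp add: power_mult)
      then have "2 ^ j * \<bar>d j x\<bar> \<le> K" 
        by (rule power2_le_imp_le) (simp add: K_def)
      then show ?thesis by (simp add: field_simps power_one_over)
    qed
    then show ?case unfolding d_def by (rule summable_diff_imp_convergent)
  qed
  define g where "g x = (if convergent (\<lambda>j. f (r j) x) then lim (\<lambda>j. f (r j) x) else 0)" for x
  have g_meas [measurable]: "g \<in> borel_measurable M"
    unfolding g_def convergent_def[abs_def] Cauchy_convergent_iff[symmetric, unfolded convergent_def]
    by measurable
  have lim: "AE x in M. (\<lambda>j. f (r j) x) \<longlonglongrightarrow> g x"
    using conv by eventually_elim (simp add: g_def convergent_LIMSEQ_iff)
  have tend: "(\<lambda>j. l2sq M (\<lambda>x. f j x - g x)) \<longlonglongrightarrow> 0"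
  proof (rule tendsto_0_ennrealI)
    fix e :: real assume "0 < e"
    then obtain N where N: "\<And>i j. i \<ge> N \<Longrightarrow> j \<ge> N \<Longrightarrow> l2sq M (\<lambda>x. f i x - f j x) \<le> ennreal e"
      using C unfolding l2_Cauchy_def by metis
    have "l2sq M (\<lambda>x. f i x - g x) \<le> ennreal e" if "i \<ge> N" for i
    proof (rule l2sq_Fatou)
      show "AE x in M. (\<lambda>j. f i x - f (r j) x) \<longlonglongrightarrow> f i x - g x"
        using lim by eventually_elim (intro tendsto_intros)
      show "\<forall>\<^sub>F j in sequentially. l2sq M (\<lambda>x. f i x - f (r j) x) \<le> ennreal e"
        using eventually_ge_at_top[of N]
      proof eventually_elim
        case (elim j)
        then show ?case using N[OF that, of "r j"] seq_suble[OF r, of j] by simp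
      qed
    qed measurable
    then show "\<forall>\<^sub>F i in sequentially. l2sq M (\<lambda>x. f i x - g x) \<le> ennreal e"
      by (auto simp: eventually_sequentially)
  qed
  have "g x = 0" if "\<And>j. f j x = 0" for x
    using that by (simp add: g_def)
  with g_meas r lim tend that show ?thesis by blast
qed

section \<open>The Gagliardo seminorm\<close>

lemma fst_null_lebesgue:
  assumes "N \<in> null_sets (lborel :: 'a::euclidean_space measure)"
  shows "fst -` N \<in> null_sets (lborel :: ('a \<times> 'b::euclidean_space) measure)"
proof -
  have "N \<times> UNIV \<in> null_sets (lborel \<Otimes>\<^sub>M (lborel :: 'b measure))"
    by (rule lborel.times_in_null_sets1) (use assms in auto)
  then show ?thesis by (simp add: lborel_prod fst_vimage_eq_Times)
qed

lemma snd_null_lebesgue: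
  assumes "N \<in> null_sets (lborel :: 'b::euclidean_space measure)"
  shows "snd -` N \<in> null_sets (lborel :: ('a::euclidean_space \<times> 'b) measure)"
proof -
  have "UNIV \<times> N \<in> null_sets ((lborel :: 'a measure) \<Otimes>\<^sub>M lborel)"
    by (rule lborel.times_in_null_sets2) (use assms in auto)
  then show ?thesis by (simp add: lborel_prod snd_vimage_eq_Times)
qed

lemma AE_lebesgue_fst:
  assumes "AE x in (lebesgue :: 'a::euclidean_space measure). P x"
  shows "AE z in (lebesgue :: ('a \<times> 'b::euclidean_space) measure). P (fst z)"
proof -
  obtain N where N: "N \<in> null_sets lborel" "{x. \<not> P x} \<subseteq> N"
    using assms unfolding AE_completion_iff by (auto elim!: AE_E simp: null_sets_def)
  then have "AE z in (lborel :: ('a \<times> 'b) measure). P (fst z)"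
    by (intro AE_I'[OF fst_null_lebesgue[OF N(1)]]) auto
  then show ?thesis by (rule AE_completion)
qed

lemma AE_lebesgue_snd:
  assumes "AE x in (lebesgue :: 'b::euclidean_space measure). P x"
  shows "AE z in (lebesgue :: ('a::euclidean_space \<times> 'b) measure). P (snd z)"
proof -
  obtain N where N: "N \<in> null_sets lborel" "{x. \<not> P x} \<subseteq> N"
    using assms unfolding AE_completion_iff by (auto elim!: AE_E simp: null_sets_def)
  then have "AE z in (lborel :: ('a \<times> 'b) measure). P (snd z)"
    by (intro AE_I'[OF snd_null_lebesgue[OF N(1)]]) auto
  then show ?thesis by (rule AE_completion)
qed

lemma lebesgue_measurable_from_borel:
  "f \<in> borel_measurable borel \<Longrightarrow> f \<in> borel_measurable lebesgue"
  by (rule measurable_completion) simp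

text \<open>A Lebesgue set is a Borel set plus a part of a Borel null set. The Borel part is handled
  by continuity; the preimage of the rest lies in a strip over a null set, which is null and hence
  measurable by completeness.\<close>

lemma fst_measurable_lebesgue [measurable]:
  "fst \<in> (lebesgue :: ('a::euclidean_space \<times> 'b::euclidean_space) measure) \<rightarrow>\<^sub>M lebesgue"
proof (rule measurableI)
  fix A :: "'a set" assume A: "A \<in> sets lebesgue"
  then obtain S N N' where SN: "A = S \<union> N" "N \<subseteq> N'" "N' \<in> null_sets lborel" "S \<in> sets lborel"
    by (auto elim: sets_completionE)
  have "fst -` A = fst -` S \<union> fst -` N" using SN by auto
  moreover have "fst -` S \<inter> space borel \<in> sets (borel :: ('a \<times> 'b) measure)"
    by (rule measurable_sets[of _ _ borel])
      (use SN in \<open>auto intro!: borel_measurable_continuous_onI continuous_intros\<close>)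
  moreover have "fst -` N \<in> sets (lebesgue :: ('a \<times> 'b) measure)"
    using SN null_sets_completionI[OF fst_null_lebesgue[OF SN(3), where 'b = 'b]]
    by (intro null_setsD2[OF null_sets_completion_subset[of _ "fst -` N'"]]) auto
  ultimately show "fst -` A \<inter> space (lebesgue :: ('a \<times> 'b) measure) \<in> sets lebesgue"
    using sets_completionI_sets[of _ lborel]
    by (metis Int_UNIV_right sets.Un sets_lborel space_borel space_completion space_lborel)
qed simp

lemma snd_measurable_lebesgue [measurable]:
  "snd \<in> (lebesgue :: ('a::euclidean_space \<times> 'b::euclidean_space) measure) \<rightarrow>\<^sub>M lebesgue"
proof (rule measurableI)
  fix A :: "'b set" assume A: "A \<in> sets lebesgue"
  then obtain S N N' where SN: "A = S \<union> N" "N \<subseteq> N'" "N' \<in> null_sets lborel" "S \<in> sets lborel"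
    by (auto elim: sets_completionE)
  have "snd -` A = snd -` S \<union> snd -` N" using SN by auto
  moreover have "snd -` S \<inter> space borel \<in> sets (borel :: ('a \<times> 'b) measure)"
    by (rule measurable_sets[of _ _ borel])
      (use SN in \<open>auto intro!: borel_measurable_continuous_onI continuous_intros\<close>)
  moreover have "snd -` N \<in> sets (lebesgue :: ('a \<times> 'b) measure)"
    using SN null_sets_completionI[OF snd_null_lebesgue[OF SN(3), where 'a = 'a]]
    by (intro null_setsD2[OF null_sets_completion_subset[of _ "snd -` N'"]]) auto
  ultimately show "snd -` A \<inter> space (lebesgue :: ('a \<times> 'b) measure) \<in> sets lebesgue"
    using sets_completionI_sets[of _ lborel]
    by (metis Int_UNIV_right sets.Un sets_lborel space_borel space_completion space_lborel)
qed simp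

text \<open>\<open>lebesgue\<close> on the product is the completion of the Borel product measure
  and not a product of completions, so Tonelli is applied to Borel versions that agree a.e.\<close>

lemma nn_integral_lebesgue_product:
  fixes f :: "'a::euclidean_space \<Rightarrow> ennreal" and g :: "'b::euclidean_space \<Rightarrow> ennreal"
  assumes "f \<in> borel_measurable lebesgue" "g \<in> borel_measurable lebesgue"
  shows "(\<integral>\<^sup>+ z. f (fst z) * g (snd z) \<partial>lebesgue) = (\<integral>\<^sup>+ x. f x \<partial>lebesgue) * (\<integral>\<^sup>+ y. g y \<partial>lebesgue)"
proof -
  obtain f' where f' [measurable]: "f' \<in> borel_measurable lborel" and ff: "AE x in lborel. f x = f' x"
    using completion_ex_borel_measurable[OF assms(1)] by blast
  obtain g' where g' [measurable]: "g' \<in> borel_measurable lborel" and gg: "AE x in lborel. g x = g' x"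
    using completion_ex_borel_measurable[OF assms(2)] by blast
  have "(\<integral>\<^sup>+ z. f (fst z) * g (snd z) \<partial>lebesgue) = (\<integral>\<^sup>+ z. f' (fst z) * g' (snd z) \<partial>lebesgue)"
    using AE_lebesgue_fst[OF AE_completion[OF ff], where 'b = 'b] AE_lebesgue_snd[OF AE_completion[OF gg], where 'a = 'a]
    by (intro nn_integral_cong_AE) auto
  also have "\<dots> = (\<integral>\<^sup>+ z. f' (fst z) * g' (snd z) \<partial>(lborel \<Otimes>\<^sub>M lborel))"
    by (simp add: nn_integral_completion lborel_prod)
  also have "\<dots> = (\<integral>\<^sup>+ x. f' x \<partial>lborel) * (\<integral>\<^sup>+ y. g' y \<partial>lborel)"
    by (subst lborel.nn_integral_fst[symmetric]) (simp_all add: nn_integral_cmult nn_integral_multc)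
  also have "\<dots> = (\<integral>\<^sup>+ x. f x \<partial>lebesgue) * (\<integral>\<^sup>+ y. g y \<partial>lebesgue)"
    using ff gg by (simp add: nn_integral_completion cong: nn_integral_cong_AE)
  finally show ?thesis .
qed

lemma lebesgue_integral_product:
  fixes f :: "'a::euclidean_space \<Rightarrow> real" and g :: "'b::euclidean_space \<Rightarrow> real"
  assumes f: "integrable lebesgue f" and g: "integrable lebesgue g"
  shows "integrable lebesgue (\<lambda>z. f (fst z) * g (snd z))"
    and "(LINT z|lebesgue. f (fst z) * g (snd z)) = (LINT x|lebesgue. f x) * (LINT y|lebesgue. g y)"
proof -
  have fgm: "f \<in> borel_measurable lebesgue" "g \<in> borel_measurable lebesgue"
    using f g by auto
  obtain f' where f' [measurable]: "f' \<in> borel_measurable lborel" and ff: "AE x in lborel. f x = f' x"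
    using completion_ex_borel_measurable_real[OF fgm(1)] by blast
  obtain g' where g' [measurable]: "g' \<in> borel_measurable lborel" and gg: "AE x in lborel. g x = g' x"
    using completion_ex_borel_measurable_real[OF fgm(2)] by blast
  have "integrable lebesgue f'" "integrable lebesgue g'"
    using f g integrable_cong_AE[OF fgm(1) measurable_completion[OF f'] AE_completion[OF ff]]
      integrable_cong_AE[OF fgm(2) measurable_completion[OF g'] AE_completion[OF gg]] by auto
  then have fi: "integrable lborel f'" and gi: "integrable lborel g'"
    by (auto simp: integrable_completion)
  have ae: "AE z in lebesgue. f (fst z) * g (snd z) = f' (fst z) * g' (snd z)"
    using AE_lebesgue_fst[OF AE_completion[OF ff], where 'b = 'b] AE_lebesgue_snd[OF AE_completion[OF gg], where 'a = 'a]
    by eventually_elim simp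
  have m: "(\<lambda>z. f' (fst z) * g' (snd z)) \<in> borel_measurable (lborel \<Otimes>\<^sub>M lborel)" by measurable
  have int: "integrable (lborel \<Otimes>\<^sub>M lborel) (\<lambda>z. f' (fst z) * g' (snd z))"
    using fi gi by (intro lborel_pair.Fubini_integrable) (auto simp: abs_mult)
  have val: "(LINT z|(lborel \<Otimes>\<^sub>M lborel). f' (fst z) * g' (snd z)) = (LINT x|lborel. f' x) * (LINT y|lborel. g' y)"
    using lborel_pair.integral_fst'[OF int] by simp
  have m2: "(\<lambda>z. f (fst z) * g (snd z)) \<in> borel_measurable lebesgue"
    using fgm by measurable
  have m3: "(\<lambda>z. f' (fst z) * g' (snd z)) \<in> borel_measurable lebesgue"
    using measurable_completion[OF m[unfolded lborel_prod]] .
  show "integrable lebesgue (\<lambda>z. f (fst z) * g (snd z))"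
    unfolding integrable_cong_AE[OF m2 m3 ae] using int by (simp add: integrable_completion[OF m[unfolded lborel_prod]] lborel_prod)
  have "(LINT z|lebesgue. f (fst z) * g (snd z)) = (LINT x|lborel. f' x) * (LINT y|lborel. g' y)"
    unfolding integral_cong_AE[OF m2 m3 ae] using val by (simp add: integral_completion[OF m[unfolded lborel_prod]] lborel_prod)
  also have "(LINT x|lborel. f' x) = (LINT x|lebesgue. f x)"
    using integral_cong_AE[OF fgm(1) measurable_completion[OF f'] AE_completion[OF ff]] by (simp add: integral_completion)
  also have "(LINT x|lborel. g' x) = (LINT x|lebesgue. g x)"
    using integral_cong_AE[OF fgm(2) measurable_completion[OF g'] AE_completion[OF gg]] by (simp add: integral_completion)
  finally show "(LINT z|lebesgue. f (fst z) * g (snd z)) = (LINT x|lebesgue. f x) * (LINT y|lebesgue. g y)" .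
qed

text \<open>Half of the kernel's exponent goes to each factor, so that \<open>gagliardo_sq\<close>
  is \<open>l2sq\<close> of \<open>diffq\<close> and the bilinear form is the integral of a product.
  On the diagonal the value is 0.\<close>

definition diffq :: "real \<Rightarrow> ('a::euclidean_space \<Rightarrow> real) \<Rightarrow> 'a \<times> 'a \<Rightarrow> real" where
  "diffq s u z = (u (fst z) - u (snd z)) / norm (fst z - snd z) powr ((real DIM('a) + 2 * s) / 2)"

lemma kernel_measurable [measurable]:
  "(\<lambda>z :: 'a::euclidean_space \<times> 'a. norm (fst z - snd z) powr p) \<in> borel_measurable lebesgue"
proof (rule lebesgue_measurable_from_borel)
  have [measurable]: "(\<lambda>z :: 'a \<times> 'a. norm (fst z - snd z)) \<in> borel_measurable borel"
    by (intro borel_measurable_continuous_onI continuous_intros)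
  show "(\<lambda>z :: 'a \<times> 'a. norm (fst z - snd z) powr p) \<in> borel_measurable borel"
    by measurable
qed

lemma diffq_measurable [measurable]:
  assumes [measurable]: "u \<in> borel_measurable lebesgue"
  shows "diffq s u \<in> borel_measurable lebesgue"
  unfolding diffq_def[abs_def] by measurable

lemma diffq_mult:
  "diffq s u z * diffq s v z = (u (fst z) - u (snd z)) * (v (fst z) - v (snd z)) /
     norm (fst z - snd z) powr (real DIM('a) + 2 * s)" for u :: "'a::euclidean_space \<Rightarrow> real"
  by (simp add: diffq_def powr_add[symmetric])

lemma gagliardo_sq_eq: "gagliardo_sq s u = l2sq lebesgue (diffq s u)"
  unfolding gagliardo_sq_def l2sq_def using diffq_mult[of s u _ u] by (simp add: power2_eq_square)

lemma diffq_add: "diffq s (\<lambda>x. u x + v x) = (\<lambda>z. diffq s u z + diffq s v z)"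
  by (auto simp: diffq_def add_divide_distrib[symmetric] fun_eq_iff)

lemma diffq_diff: "diffq s (\<lambda>x. u x - v x) = (\<lambda>z. diffq s u z - diffq s v z)"
  by (auto simp: diffq_def diff_divide_distrib[symmetric] fun_eq_iff)

lemma diffq_cmult: "diffq s (\<lambda>x. c * u x) = (\<lambda>z. c * diffq s u z)"
  by (auto simp: diffq_def fun_eq_iff right_diff_distrib)

lemma diffq_zero: "diffq s (\<lambda>x. 0) = (\<lambda>z. 0)"
  by (auto simp: diffq_def fun_eq_iff)

lemma diffq_sum: "diffq s (\<lambda>x. \<Sum>j<n. u j x) = (\<lambda>z. \<Sum>j<(n::nat). diffq s (u j) z)"
  by (induction n) (simp_all add: diffq_zero diffq_add)

lemmas diffq_linear = diffq_add diffq_diff diffq_cmult diffq_zero diffq_sum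

lemma gagliardo_cong_AE:
  assumes "AE x in lebesgue. u x = v x"
  shows "gagliardo_sq s u = gagliardo_sq s v"
  unfolding gagliardo_sq_eq
proof (rule l2sq_cong_AE)
  show "AE z in lebesgue. diffq s u z = diffq s v z"
    using AE_lebesgue_fst[OF assms] AE_lebesgue_snd[OF assms]
    by eventually_elim (simp add: diffq_def)
qed

text \<open>The reverse triangle inequality for the difference quotients. It allows competitors for
  the capacity to be taken nonnegative.\<close>

lemma gagliardo_abs_le: "gagliardo_sq s (\<lambda>x. \<bar>u x\<bar>) \<le> gagliardo_sq s u"
  unfolding gagliardo_sq_eq
  by (intro l2sq_mono_AE AE_I2) (auto simp: diffq_def intro!: divide_right_mono)

context
  fixes u v :: "'a::euclidean_space \<Rightarrow> real"
  assumes uv [measurable]: "u \<in> borel_measurable lebesgue" "v \<in> borel_measurable lebesgue"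
begin

lemma gagliardo_parallelogram:
  "gagliardo_sq s (\<lambda>x. u x + v x) + gagliardo_sq s (\<lambda>x. u x - v x) = 2 * gagliardo_sq s u + 2 * gagliardo_sq s v"
  unfolding gagliardo_sq_eq diffq_linear by (rule l2sq_parallelogram) measurable

lemma gagliardo_add_le:
  "gagliardo_sq s (\<lambda>x. u x + v x) \<le> 2 * gagliardo_sq s u + 2 * gagliardo_sq s v"
  unfolding gagliardo_sq_eq diffq_linear by (rule l2sq_add_le) measurable

lemma gagliardo_diff_le:
  "gagliardo_sq s (\<lambda>x. u x - v x) \<le> 2 * gagliardo_sq s u + 2 * gagliardo_sq s v"
  unfolding gagliardo_sq_eq diffq_linear by (rule l2sq_diff_le) measurable

end

lemma gagliardo_cmult:
  assumes [measurable]: "u \<in> borel_measurable lebesgue"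
  shows "gagliardo_sq s (\<lambda>x. c * u x) = ennreal (c\<^sup>2) * gagliardo_sq s u"
  unfolding gagliardo_sq_eq diffq_linear by (rule l2sq_scale) measurable

lemma gagliardo_commute: "gagliardo_sq s (\<lambda>x. u x - v x) = gagliardo_sq s (\<lambda>x. v x - u x)"
  unfolding gagliardo_sq_eq diffq_linear by (rule l2sq_commute)

lemma gagliardo_zero [simp]: "gagliardo_sq s (\<lambda>x. 0) = 0"
  unfolding gagliardo_sq_eq diffq_linear by simp

lemma gagliardo_sum_le:
  assumes "\<And>j::nat. u j \<in> borel_measurable lebesgue"
  shows "gagliardo_sq s (\<lambda>x. \<Sum>j<n. u j x) \<le> (\<Sum>j<n. 2 ^ (j + 1) * gagliardo_sq s (u j))"
  unfolding gagliardo_sq_eq diffq_linear using assms by (intro l2sq_sum_le) measurable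

text \<open>If \<open>u\<close> vanishes outside a bounded set, the pairs whose second point lies in a ball away
  from that set already contribute a multiple of the squared \<open>L\<^sup>2\<close> norm to the seminorm.\<close>

lemma fractional_Poincare:
  fixes \<Omega> :: "'a::euclidean_space set"
  assumes "bounded \<Omega>"
  obtains C where "C > 0" "\<And>u. u \<in> borel_measurable lebesgue \<Longrightarrow> (\<And>x. x \<notin> \<Omega> \<Longrightarrow> u x = 0) \<Longrightarrow>
    l2sq lebesgue u \<le> ennreal C * gagliardo_sq s u"
proof -
  obtain R where R: "R > 0" "\<And>x. x \<in> \<Omega> \<Longrightarrow> norm x \<le> R"
    using assms bounded_pos by blast
  obtain b :: 'a where b: "b \<in> Basis" using nonempty_Basis by blast
  \<comment> \<open>Points of \<open>B\<close> have norm between R + 1 and R + 3, so their distance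
    to a point of norm at most R lies between 1 and 2 R + 3.\<close>
  define B where "B = ball ((R + 2) *\<^sub>R b) 1"
  define p where "p = real DIM('a) + 2 * s"
  \<comment> \<open>A lower bound for the kernel over the possible distances. The infimum over a
    compact interval is positive for either sign of \<open>p\<close>, \<open>s\<close> being an
    arbitrary real here.\<close>
  define k where "k = Inf ((\<lambda>r. inverse (r powr p)) ` {1..2 * R + 3})"
  have far: "y \<notin> \<Omega> \<and> 1 \<le> norm (x - y) \<and> norm (x - y) \<le> 2 * R + 3" if "x \<in> \<Omega>" "y \<in> B" for x y
  proof -
    have n1: "norm ((R + 2) *\<^sub>R b) = R + 2" using b R by simp
    have d: "norm ((R + 2) *\<^sub>R b - y) < 1" using that by (simp add: B_def dist_norm)
    have "norm y > R + 1" "norm y < R + 3"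
      using n1 d norm_triangle_ineq2[of "(R + 2) *\<^sub>R b" y] norm_triangle_ineq2[of y "(R + 2) *\<^sub>R b"]
      by (auto simp: norm_minus_commute)
    then show ?thesis using R(2)[of x] R(2)[of y] that norm_triangle_ineq2[of y x] norm_triangle_ineq4[of x y]
      by (auto simp: norm_minus_commute)
  qed
  have "compact ((\<lambda>r. inverse (r powr p)) ` {1..2 * R + 3})"
    by (intro compact_continuous_image continuous_intros) auto
  moreover have "(\<lambda>r. inverse (r powr p)) ` {1..2 * R + 3} \<noteq> {}" using R by auto
  ultimately have "k \<in> (\<lambda>r. inverse (r powr p)) ` {1..2 * R + 3}"
    unfolding k_def by (intro closed_contains_Inf bounded_imp_bdd_below compact_imp_bounded compact_imp_closed)
  then have k: "k > 0" by auto
  have k_le: "k \<le> inverse (r powr p)" if "1 \<le> r" "r \<le> 2 * R + 3" for r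
    unfolding k_def by (rule cInf_lower) (use that in \<open>auto intro!: bdd_belowI[of _ 0]\<close>)
  have mB: "emeasure lebesgue B = ennreal (measure lebesgue B)" 
    unfolding B_def by (subst emeasure_eq_ennreal_measure) (use emeasure_lborel_ball_finite in \<open>auto simp: less_top\<close>)
  have mB0: "measure lebesgue B > 0"
    unfolding B_def by (simp add: content_ball_pos)
  define C where "C = inverse (k * measure lebesgue B)"
  have "l2sq lebesgue u \<le> ennreal C * gagliardo_sq s u"
    if [measurable]: "u \<in> borel_measurable lebesgue" and u0: "\<And>x. x \<notin> \<Omega> \<Longrightarrow> u x = 0" for u :: "'a \<Rightarrow> real"
  proof -
    have [measurable]: "B \<in> sets lebesgue" by (simp add: B_def)
    have "ennreal (k * measure lebesgue B) * l2sq lebesgue u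
      = (\<integral>\<^sup>+ x. ennreal k * ennreal ((u x)\<^sup>2) \<partial>lebesgue) * (\<integral>\<^sup>+ y. indicator B y \<partial>lebesgue)"
      using k mB by (simp add: nn_integral_cmult l2sq_def ennreal_mult ac_simps)
    also have "\<dots> = (\<integral>\<^sup>+ z. (ennreal k * ennreal ((u (fst z))\<^sup>2)) * indicator B (snd z) \<partial>lebesgue)"
      by (rule nn_integral_lebesgue_product[symmetric]) measurable
    also have "\<dots> \<le> gagliardo_sq s u"
      unfolding gagliardo_sq_def
    proof (rule nn_integral_mono)
      fix z :: "'a \<times> 'a"
      show "ennreal k * ennreal ((u (fst z))\<^sup>2) * indicator B (snd z)
        \<le> ennreal ((u (fst z) - u (snd z))\<^sup>2 / norm (fst z - snd z) powr (real DIM('a) + 2 * s))"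
      proof (cases "fst z \<in> \<Omega> \<and> snd z \<in> B")
        case True
        then have f: "snd z \<notin> \<Omega>" "1 \<le> norm (fst z - snd z)" "norm (fst z - snd z) \<le> 2 * R + 3"
          using far by auto
        have "k * (u (fst z))\<^sup>2 \<le> inverse (norm (fst z - snd z) powr p) * (u (fst z))\<^sup>2"
          using k_le f by (intro mult_right_mono) auto
        then show ?thesis using True f u0 k
          by (simp add: p_def ennreal_mult[symmetric] divide_inverse mult.commute ennreal_leI)
      next
        case False
        then show ?thesis using u0 by (auto simp: indicator_def)
      qed
    qed
    finally have le: "ennreal (k * measure lebesgue B) * l2sq lebesgue u \<le> gagliardo_sq s u" .
    have "l2sq lebesgue u = ennreal C * (ennreal (k * measure lebesgue B) * l2sq lebesgue u)"
    proof -
      have "C * (k * measure lebesgue B) = 1" using k mB0 by (simp add: C_def field_simps)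
      then have "ennreal C * ennreal (k * measure lebesgue B) = 1"
        using k mB0 by (subst ennreal_mult[symmetric]) (simp_all add: C_def)
      then show ?thesis by (simp flip: mult.assoc)
    qed
    also have "\<dots> \<le> ennreal C * gagliardo_sq s u"
      by (rule mult_left_mono[OF le]) simp
    finally show ?thesis .
  qed
  moreover have "C > 0" using k mB0 by (simp add: C_def)
  ultimately show ?thesis using that by blast
qed

section \<open>Test functions and their closure\<close>

text \<open>Replaces \<open>frechet_derivative\<close> by any explicit formula for the derivative,
  so that sums, products and powers follow by induction on the order.\<close>

lemma times_cont_diff_Suc_iff:
  assumes "\<And>x. (f has_derivative F x) (at x)"
  shows "times_cont_diff (Suc k) f \<longleftrightarrow> (\<forall>b\<in>Basis. times_cont_diff k (\<lambda>x. F x b))"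
proof -
  have "F x = frechet_derivative f (at x)" for x
    using frechet_derivative_at[OF assms] .
  then show ?thesis using assms by (auto simp: differentiable_def)
qed

lemma times_cont_diff_has_derivative:
  "times_cont_diff (Suc k) f \<Longrightarrow> (f has_derivative frechet_derivative f (at x)) (at x)"
  by (auto simp: frechet_derivative_works)

lemma times_cont_diff_decr: "times_cont_diff (Suc k) f \<Longrightarrow> times_cont_diff k f"
proof (induction k arbitrary: f)
  case 0
  then show ?case
    by (auto intro!: continuous_at_imp_continuous_on differentiable_imp_continuous_within)
next
  case (Suc k)
  have "(\<forall>x. f differentiable (at x)) \<and> (\<forall>b\<in>Basis. times_cont_diff (Suc k) (\<lambda>x. frechet_derivative f (at x) b))"
    by (rule times_cont_diff.simps(2)[THEN iffD1, OF Suc.prems])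
  then show ?case unfolding times_cont_diff.simps(2)[of k f] using Suc.IH by blast
qed

lemma times_cont_diff_const: "times_cont_diff k (\<lambda>x. c)"
proof (induction k arbitrary: c)
  case (Suc k)
  then show ?case
    by (subst times_cont_diff_Suc_iff[where F = "\<lambda>x h. 0"]) auto
qed simp

lemma times_cont_diff_add:
  "times_cont_diff k f \<Longrightarrow> times_cont_diff k g \<Longrightarrow> times_cont_diff k (\<lambda>x. f x + g x)"
proof (induction k arbitrary: f g)
  case 0
  then show ?case by (auto intro: continuous_intros)
next
  case (Suc k)
  have d: "((\<lambda>x. f x + g x) has_derivative (\<lambda>h. frechet_derivative f (at x) h + frechet_derivative g (at x) h)) (at x)" for x
    using Suc.prems by (intro has_derivative_add times_cont_diff_has_derivative)
  show ?case unfolding times_cont_diff_Suc_iff[OF d] using Suc by simp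
qed

lemma times_cont_diff_mult:
  "times_cont_diff k f \<Longrightarrow> times_cont_diff k g \<Longrightarrow> times_cont_diff k (\<lambda>x. f x * g x)"
proof (induction k arbitrary: f g)
  case 0
  then show ?case by (auto intro: continuous_intros)
next
  case (Suc k)
  have d: "((\<lambda>x. f x * g x) has_derivative
      (\<lambda>h. f x * frechet_derivative g (at x) h + frechet_derivative f (at x) h * g x)) (at x)" for x
    using Suc.prems by (intro has_derivative_mult times_cont_diff_has_derivative)
  have fg: "times_cont_diff k f" "times_cont_diff k g"
    using Suc.prems times_cont_diff_decr by blast+
  show ?case unfolding times_cont_diff_Suc_iff[OF d]
  proof
    fix b :: 'a assume "b \<in> Basis"
    then have "times_cont_diff k (\<lambda>x. frechet_derivative f (at x) b)" "times_cont_diff k (\<lambda>x. frechet_derivative g (at x) b)"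
      using Suc.prems by auto
    then show "times_cont_diff k (\<lambda>x. f x * frechet_derivative g (at x) b + frechet_derivative f (at x) b * g x)"
      by (intro times_cont_diff_add Suc.IH fg)
  qed
qed

text \<open>The derivative contains the power p - 1 of the same function, hence the induction over
  all exponents at once.\<close>

lemma times_cont_diff_powr:
  "times_cont_diff k w \<Longrightarrow> (\<And>x. w x > 0) \<Longrightarrow> times_cont_diff k (\<lambda>x. w x powr p)"
proof (induction k arbitrary: p)
  case 0
  then show ?case by (auto intro!: continuous_on_powr continuous_on_const simp: order_less_imp_not_eq2)
next
  case (Suc k)
  have d: "((\<lambda>x. w x powr p) has_derivative
      (\<lambda>h. frechet_derivative w (at x) h * (p * w x powr (p - 1)))) (at x)" for x
    using Suc.prems
    by (intro DERIV_compose_FDERIV[where f = "\<lambda>t. t powr p"] has_real_derivative_powr times_cont_diff_has_derivative)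
  have w: "times_cont_diff k (\<lambda>x. w x powr (p - 1))"
    by (rule Suc.IH[OF times_cont_diff_decr[OF Suc.prems(1)] Suc.prems(2)])
  show ?case unfolding times_cont_diff_Suc_iff[OF d]
  proof
    fix b :: 'a assume "b \<in> Basis"
    then have "times_cont_diff k (\<lambda>x. frechet_derivative w (at x) b)"
      using Suc.prems by auto
    then show "times_cont_diff k (\<lambda>x. frechet_derivative w (at x) b * (p * w x powr (p - 1)))"
      by (intro times_cont_diff_mult times_cont_diff_const w)
  qed
qed

section \<open>Test functions, their linear structure and smoothed absolute values\<close>

lemma support_closure: "\<phi> x \<noteq> (0::real) \<Longrightarrow> x \<in> closure {x. \<phi> x \<noteq> 0}"
  using closure_subset[of "{x. \<phi> x \<noteq> 0}"] by auto

lemma test_function_supportI: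
  assumes "{x. \<phi> x \<noteq> 0} \<subseteq> K" "compact K" "K \<subseteq> \<Omega>" "\<And>k. times_cont_diff k \<phi>"
  shows "\<phi> \<in> test_functions \<Omega>"
proof -
  have "closure {x. \<phi> x \<noteq> 0} \<subseteq> K"
    using assms by (intro closure_minimal compact_imp_closed)
  moreover have "compact (closure {x. \<phi> x \<noteq> 0})"
    using calculation assms(2) by (metis closed_closure compact_Int_closed inf.absorb_iff2)
  ultimately show ?thesis using assms unfolding test_functions_def by auto
qed

lemma test_function_D:
  assumes "\<phi> \<in> test_functions \<Omega>"
  shows "times_cont_diff k \<phi>" "compact (closure {x. \<phi> x \<noteq> 0})" "closure {x. \<phi> x \<noteq> 0} \<subseteq> \<Omega>"
    "continuous_on UNIV \<phi>" "\<phi> \<in> borel_measurable lebesgue" "x \<notin> \<Omega> \<Longrightarrow> \<phi> x = 0"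
proof -
  show 1: "times_cont_diff k \<phi>" "compact (closure {x. \<phi> x \<noteq> 0})" "closure {x. \<phi> x \<noteq> 0} \<subseteq> \<Omega>"
    using assms by (auto simp: test_functions_def)
  have "times_cont_diff 0 \<phi>" using assms by (auto simp: test_functions_def simp del: times_cont_diff.simps)
  then show c: "continuous_on UNIV \<phi>" by simp
  show "\<phi> \<in> borel_measurable lebesgue"
    by (intro lebesgue_measurable_from_borel borel_measurable_continuous_onI c)
  show "x \<notin> \<Omega> \<Longrightarrow> \<phi> x = 0" using 1 closure_subset[of "{x. \<phi> x \<noteq> 0}"] by auto
qed

lemma test_function_zero: "(\<lambda>x. 0) \<in> test_functions \<Omega>"
  by (rule test_function_supportI[of _ "{}"]) (auto intro: times_cont_diff_const)

lemma test_function_add: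
  assumes "\<phi> \<in> test_functions \<Omega>" "\<psi> \<in> test_functions \<Omega>"
  shows "(\<lambda>x. \<phi> x + \<psi> x) \<in> test_functions \<Omega>"
proof (rule test_function_supportI)
  show "{x. \<phi> x + \<psi> x \<noteq> 0} \<subseteq> closure {x. \<phi> x \<noteq> 0} \<union> closure {x. \<psi> x \<noteq> 0}"
  proof
    fix x assume "x \<in> {x. \<phi> x + \<psi> x \<noteq> 0}"
    then have "\<phi> x \<noteq> 0 \<or> \<psi> x \<noteq> 0" by auto
    then show "x \<in> closure {x. \<phi> x \<noteq> 0} \<union> closure {x. \<psi> x \<noteq> 0}"
      using support_closure[of \<phi> x] support_closure[of \<psi> x] by blast
  qed
qed (use assms in \<open>auto intro!: compact_Un times_cont_diff_add simp: test_functions_def\<close>)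

lemma test_function_cmult:
  assumes "\<phi> \<in> test_functions \<Omega>"
  shows "(\<lambda>x. c * \<phi> x) \<in> test_functions \<Omega>"
proof (rule test_function_supportI)
  show "{x. c * \<phi> x \<noteq> 0} \<subseteq> closure {x. \<phi> x \<noteq> 0}"
    by (auto intro: support_closure)
qed (use assms in \<open>auto intro!: times_cont_diff_mult times_cont_diff_const simp: test_functions_def\<close>)

text \<open>For e > 0 a smooth approximation of the absolute value: the Euclidean norm of (t, e),
  shifted by e so that 0 is fixed and supports do not grow. Coming from a norm it is 1-Lipschitz.
  The form with \<open>powr\<close> is the one that \<open>times_cont_diff_powr\<close>
  covers.\<close>

definition smooth_abs :: "real \<Rightarrow> real \<Rightarrow> real" where
  "smooth_abs e t = (t\<^sup>2 + e\<^sup>2) powr (1/2) - e"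

lemma smooth_abs_lipschitz:
  assumes "e > 0"
  shows "\<bar>smooth_abs e a - smooth_abs e b\<bar> \<le> \<bar>a - b\<bar>"
proof -
  have "\<bar>norm (a, e) - norm (b, e)\<bar> \<le> norm ((a, e) - (b, e))"
    by (rule norm_triangle_ineq3)
  then show ?thesis
    by (simp add: norm_Pair smooth_abs_def powr_half_sqrt)
qed

lemma smooth_abs_dist:
  assumes "e > 0"
  shows "\<bar>smooth_abs e a - \<bar>a\<bar>\<bar> \<le> e"
proof -
  have "norm (a, e) \<le> norm (a, 0::real) + norm (0::real, e)"
    using norm_triangle_ineq[of "(a, 0)" "(0, e)"] by simp
  moreover have "norm (a, e) \<ge> \<bar>a\<bar>" using norm_fst_le[of a e] by (simp add: norm_Pair)
  moreover have "norm (a, e) \<ge> 0" by simp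
  ultimately show ?thesis using assms
    by (simp add: norm_Pair smooth_abs_def powr_half_sqrt)
qed

lemma smooth_abs_0 [simp]: "e > 0 \<Longrightarrow> smooth_abs e 0 = 0"
  by (simp add: smooth_abs_def powr_half_sqrt)

lemma test_function_smooth_abs:
  assumes "\<phi> \<in> test_functions \<Omega>" "e > 0"
  shows "(\<lambda>x. smooth_abs e (\<phi> x)) \<in> test_functions \<Omega>"
proof (rule test_function_supportI)
  show "{x. smooth_abs e (\<phi> x) \<noteq> 0} \<subseteq> closure {x. \<phi> x \<noteq> 0}"
    using assms(2) by (intro subsetI support_closure) auto
  fix k
  have "\<phi> x * \<phi> x + e\<^sup>2 > 0" for x
    using assms(2) by (simp add: add_nonneg_pos)
  then have "times_cont_diff k (\<lambda>x. (\<phi> x * \<phi> x + e\<^sup>2) powr (1/2) + (- e))"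
    using test_function_D(1)[OF assms(1)]
    by (intro times_cont_diff_add times_cont_diff_powr times_cont_diff_mult times_cont_diff_const) auto
  then show "times_cont_diff k (\<lambda>x. smooth_abs e (\<phi> x))"
    by (simp add: smooth_abs_def power2_eq_square[of "\<phi> _"])
qed (use assms in \<open>auto simp: test_functions_def\<close>)

section \<open>The H^s norm and the closure of the test functions\<close>

lemma Hs_norm_sq_eq: "Hs_norm_sq s u = l2sq lebesgue u + gagliardo_sq s u"
  by (simp add: Hs_norm_sq_def l2sq_def)

lemma Hs_iff: "u \<in> Hs s \<longleftrightarrow> u \<in> borel_measurable lebesgue \<and> Hs_norm_sq s u < \<infinity>"
  by (auto simp: Hs_def Hs_norm_sq_def)

lemma Hs_norm_sq_commute: "Hs_norm_sq s (\<lambda>x. u x - v x) = Hs_norm_sq s (\<lambda>x. v x - u x)"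
  unfolding Hs_norm_sq_eq using gagliardo_commute l2sq_commute by metis

lemma Hs_norm_sq_add_le:
  assumes "u \<in> borel_measurable lebesgue" "v \<in> borel_measurable lebesgue"
  shows "Hs_norm_sq s (\<lambda>x. u x + v x) \<le> 2 * Hs_norm_sq s u + 2 * Hs_norm_sq s v"
  unfolding Hs_norm_sq_eq
  using add_mono[OF l2sq_add_le[OF assms] gagliardo_add_le[OF assms]]
  by (simp add: distrib_left ac_simps)

lemma Hs_norm_sq_triangle_le:
  assumes [measurable]: "u \<in> borel_measurable lebesgue" "v \<in> borel_measurable lebesgue" "w \<in> borel_measurable lebesgue"
  shows "Hs_norm_sq s (\<lambda>x. u x - w x) \<le> 2 * Hs_norm_sq s (\<lambda>x. u x - v x) + 2 * Hs_norm_sq s (\<lambda>x. v x - w x)"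
  using Hs_norm_sq_add_le[of "\<lambda>x. u x - v x" "\<lambda>x. v x - w x" s] by simp

lemma Hs_norm_sq_cmult:
  assumes "u \<in> borel_measurable lebesgue"
  shows "Hs_norm_sq s (\<lambda>x. c * u x) = ennreal (c\<^sup>2) * Hs_norm_sq s u"
  unfolding Hs_norm_sq_eq l2sq_scale[OF assms] gagliardo_cmult[OF assms]
  by (simp add: distrib_left)

lemma Hs_norm_sq_cong_AE:
  assumes "AE x in lebesgue. u x = v x"
  shows "Hs_norm_sq s u = Hs_norm_sq s v"
  unfolding Hs_norm_sq_eq using l2sq_cong_AE[OF assms] gagliardo_cong_AE[OF assms] by metis

lemma Hs_add: "u \<in> Hs s \<Longrightarrow> v \<in> Hs s \<Longrightarrow> (\<lambda>x. u x + v x) \<in> Hs s"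
  unfolding Hs_iff using Hs_norm_sq_add_le[of u v s]
  by (auto elim!: le_less_trans simp: ennreal_mult_less_top)

lemma Hs_cmult: "u \<in> Hs s \<Longrightarrow> (\<lambda>x. c * u x) \<in> Hs s"
  unfolding Hs_iff by (auto simp: Hs_norm_sq_cmult ennreal_mult_less_top)

lemma H0sD:
  assumes "u \<in> H0s s \<Omega>"
  shows "u \<in> borel_measurable lebesgue" "u \<in> Hs s" "x \<notin> \<Omega> \<Longrightarrow> u x = 0"
    "gagliardo_sq s u < \<infinity>" "l2sq lebesgue u < \<infinity>"
  using assms by (auto simp: H0s_def Hs_def l2sq_def)

lemma H0s_test:
  assumes "\<phi> \<in> test_functions \<Omega>" "Hs_norm_sq s \<phi> < \<infinity>"
  shows "\<phi> \<in> H0s s \<Omega>"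
  using assms unfolding H0s_def Hs_iff
  by (auto simp: test_function_D Hs_norm_sq_eq intro!: exI[of _ "\<lambda>k. \<phi>"])

text \<open>The definition of \<open>H0s\<close> does not state that the approximating test
  functions have finite norm. It follows by writing them as their difference to \<open>u\<close>, of
  finite norm, plus \<open>u\<close>.\<close>

lemma H0s_approx:
  assumes "u \<in> H0s s \<Omega>" "e > 0"
  obtains \<phi> where "\<phi> \<in> test_functions \<Omega>" "\<phi> \<in> H0s s \<Omega>" "Hs_norm_sq s (\<lambda>x. \<phi> x - u x) \<le> ennreal e"
proof -
  obtain \<phi> where \<phi>: "\<And>k. \<phi> k \<in> test_functions \<Omega>" "(\<lambda>k. Hs_norm_sq s (\<lambda>x. \<phi> k x - u x)) \<longlonglongrightarrow> 0"
    using assms by (auto simp: H0s_def)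
  from tendsto_0_ennrealD[OF this(2) assms(2)]
  obtain k where k: "Hs_norm_sq s (\<lambda>x. \<phi> k x - u x) \<le> ennreal e"
    by (auto simp: eventually_sequentially)
  have [measurable]: "u \<in> borel_measurable lebesgue" "\<phi> k \<in> borel_measurable lebesgue"
    using H0sD(1)[OF assms(1)] test_function_D(5)[OF \<phi>(1)] by auto
  have "(\<lambda>x. \<phi> k x - u x) \<in> Hs s"
    unfolding Hs_iff using k by (auto elim: le_less_trans)
  from Hs_add[OF this H0sD(2)[OF assms(1)]] have "\<phi> k \<in> Hs s" by simp
  with \<phi>(1) k show ?thesis using that H0s_test unfolding Hs_iff by blast
qed

text \<open>The closure is closed: approximate \<open>u\<close> by some \<open>w\<close>, then
  \<open>w\<close> by a test function. Vanishing at every point outside \<Omega> is not determined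
  by the norm and is therefore asked separately.\<close>

lemma H0s_closedI:
  assumes [measurable]: "u \<in> borel_measurable lebesgue" and "\<And>x. x \<notin> \<Omega> \<Longrightarrow> u x = 0"
    and ap: "\<And>e. e > 0 \<Longrightarrow> \<exists>w\<in>H0s s \<Omega>. Hs_norm_sq s (\<lambda>x. w x - u x) \<le> ennreal e"
  shows "u \<in> H0s s \<Omega>"
proof -
  have "\<exists>\<phi>\<in>test_functions \<Omega>. Hs_norm_sq s (\<lambda>x. \<phi> x - u x) \<le> ennreal (1 / real (Suc k))" for k
  proof -
    \<comment> \<open>The triangle inequality for squares gives 2 e + 2 e.\<close>
    define e where "e = 1 / (4 * real (Suc k))"
    have e: "e > 0" by (simp add: e_def)
    obtain w where w: "w \<in> H0s s \<Omega>" "Hs_norm_sq s (\<lambda>x. w x - u x) \<le> ennreal e"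
      using ap[OF e] by blast
    obtain \<phi> where \<phi>: "\<phi> \<in> test_functions \<Omega>" "Hs_norm_sq s (\<lambda>x. \<phi> x - w x) \<le> ennreal e"
      using H0s_approx[OF w(1) e] by metis
    have "Hs_norm_sq s (\<lambda>x. \<phi> x - u x) \<le> 2 * Hs_norm_sq s (\<lambda>x. \<phi> x - w x) + 2 * Hs_norm_sq s (\<lambda>x. w x - u x)"
      using H0sD(1)[OF w(1)] test_function_D(5)[OF \<phi>(1)] by (intro Hs_norm_sq_triangle_le) auto
    also have "\<dots> \<le> 2 * ennreal e + 2 * ennreal e"
      by (intro add_mono mult_left_mono w \<phi>) auto
    also have "\<dots> = ennreal (2 * e + 2 * e)"
      using e by (subst ennreal_plus) (auto simp: ennreal_mult)
    also have "2 * e + 2 * e = 1 / real (Suc k)" by (simp add: e_def del: of_nat_Suc)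
    finally show ?thesis using \<phi>(1) by blast
  qed
  then obtain \<phi> where \<phi>: "\<And>k. \<phi> k \<in> test_functions \<Omega>"
    "\<And>k. Hs_norm_sq s (\<lambda>x. \<phi> k x - u x) \<le> ennreal (1 / real (Suc k))"
    by metis
  from ennreal_inverse_Suc_tendsto
  have "(\<lambda>k. Hs_norm_sq s (\<lambda>x. \<phi> k x - u x)) \<longlonglongrightarrow> 0"
    by (rule tendsto_0_ennreal_le[where c = 1, OF _ always_eventually, simplified, OF _ allI])
      (use \<phi>(2) in \<open>simp\<close>)
  moreover have "u \<in> Hs s"
  proof -
    obtain w where w: "w \<in> H0s s \<Omega>" "Hs_norm_sq s (\<lambda>x. w x - u x) \<le> ennreal 1"
      using ap[of 1] by auto
    note [measurable] = H0sD(1)[OF w(1)]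
    have "Hs_norm_sq s (\<lambda>x. u x - w x) < \<infinity>"
      using w(2) by (subst Hs_norm_sq_commute) (auto elim: le_less_trans)
    then have "(\<lambda>x. u x - w x) \<in> Hs s" by (simp add: Hs_iff)
    from Hs_add[OF this H0sD(2)[OF w(1)]] show ?thesis by simp
  qed
  ultimately show ?thesis using assms(2) \<phi>(1) by (auto simp: H0s_def)
qed

lemma H0s_zero [simp]: "(\<lambda>x. 0) \<in> H0s s \<Omega>"
  by (rule H0s_test) (auto simp: test_function_zero Hs_norm_sq_eq)

lemma H0s_add:
  assumes u: "u \<in> H0s s \<Omega>" and v: "v \<in> H0s s \<Omega>"
  shows "(\<lambda>x. u x + v x) \<in> H0s s \<Omega>"
proof -
  note [measurable] = H0sD(1)[OF u] H0sD(1)[OF v]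
  obtain \<phi> where \<phi>: "\<And>k. \<phi> k \<in> test_functions \<Omega>" "(\<lambda>k. Hs_norm_sq s (\<lambda>x. \<phi> k x - u x)) \<longlonglongrightarrow> 0"
    using u by (auto simp: H0s_def)
  obtain \<psi> where \<psi>: "\<And>k. \<psi> k \<in> test_functions \<Omega>" "(\<lambda>k. Hs_norm_sq s (\<lambda>x. \<psi> k x - v x)) \<longlonglongrightarrow> 0"
    using v by (auto simp: H0s_def)
  note [measurable] = test_function_D(5)[OF \<phi>(1)] test_function_D(5)[OF \<psi>(1)]
  have "(\<lambda>k. 2 * Hs_norm_sq s (\<lambda>x. \<phi> k x - u x) + 2 * Hs_norm_sq s (\<lambda>x. \<psi> k x - v x)) \<longlonglongrightarrow> 2 * 0 + 2 * 0"
    by (intro tendsto_add ennreal_tendsto_cmult \<phi> \<psi>) auto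
  then have lim: "(\<lambda>k. 2 * Hs_norm_sq s (\<lambda>x. \<phi> k x - u x) + 2 * Hs_norm_sq s (\<lambda>x. \<psi> k x - v x)) \<longlonglongrightarrow> 0"
    by simp
  have "Hs_norm_sq s (\<lambda>x. (\<phi> k x + \<psi> k x) - (u x + v x)) \<le>
      2 * Hs_norm_sq s (\<lambda>x. \<phi> k x - u x) + 2 * Hs_norm_sq s (\<lambda>x. \<psi> k x - v x)" for k
    using Hs_norm_sq_add_le[of "\<lambda>x. \<phi> k x - u x" "\<lambda>x. \<psi> k x - v x" s] by (simp add: algebra_simps)
  then have "(\<lambda>k. Hs_norm_sq s (\<lambda>x. (\<phi> k x + \<psi> k x) - (u x + v x))) \<longlonglongrightarrow> 0"
    by (intro tendsto_0_ennreal_le[OF lim, where c = 1]) simp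
  moreover have "(\<lambda>x. \<phi> k x + \<psi> k x) \<in> test_functions \<Omega>" for k
    by (rule test_function_add[OF \<phi>(1) \<psi>(1)])
  ultimately show ?thesis
    using Hs_add[OF H0sD(2)[OF u] H0sD(2)[OF v]] H0sD(3)[OF u] H0sD(3)[OF v]
    unfolding H0s_def by (auto intro!: exI[of _ "\<lambda>k x. \<phi> k x + \<psi> k x"])
qed

lemma H0s_cmult:
  assumes u: "u \<in> H0s s \<Omega>"
  shows "(\<lambda>x. c * u x) \<in> H0s s \<Omega>"
proof -
  note [measurable] = H0sD(1)[OF u]
  obtain \<phi> where \<phi>: "\<And>k. \<phi> k \<in> test_functions \<Omega>" "(\<lambda>k. Hs_norm_sq s (\<lambda>x. \<phi> k x - u x)) \<longlonglongrightarrow> 0"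
    using u by (auto simp: H0s_def)
  note [measurable] = test_function_D(5)[OF \<phi>(1)]
  have "Hs_norm_sq s (\<lambda>x. c * \<phi> k x - c * u x) = ennreal (c\<^sup>2) * Hs_norm_sq s (\<lambda>x. \<phi> k x - u x)" for k
    using Hs_norm_sq_cmult[of "\<lambda>x. \<phi> k x - u x" s c] by (simp add: algebra_simps)
  then have "(\<lambda>k. Hs_norm_sq s (\<lambda>x. c * \<phi> k x - c * u x)) \<longlonglongrightarrow> 0"
    by (intro tendsto_0_ennreal_le[OF \<phi>(2), where c = "c\<^sup>2"]) simp
  then show ?thesis
    using Hs_cmult[OF H0sD(2)[OF u]] H0sD(3)[OF u] test_function_cmult[OF \<phi>(1)]
    unfolding H0s_def by (auto intro!: exI[of _ "\<lambda>k x. c * \<phi> k x"])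
qed

lemma H0s_diff:
  "u \<in> H0s s \<Omega> \<Longrightarrow> v \<in> H0s s \<Omega> \<Longrightarrow> (\<lambda>x. u x - v x) \<in> H0s s \<Omega>"
  using H0s_add[of u s \<Omega> "\<lambda>x. -1 * v x"] H0s_cmult[of v s \<Omega> "-1"] by simp

lemma H0s_sum:
  "(\<And>j. u j \<in> H0s s \<Omega>) \<Longrightarrow> (\<lambda>x. \<Sum>j<(n::nat). u j x) \<in> H0s s \<Omega>"
  by (induction n) (auto intro: H0s_add)

lemma H0s_cong_AE:
  fixes u v :: "'a::euclidean_space \<Rightarrow> real"
  assumes u: "u \<in> H0s s \<Omega>" and "AE x in lebesgue. u x = v x" and v: "v \<in> borel_measurable lebesgue" "\<And>x. x \<notin> \<Omega> \<Longrightarrow> v x = 0"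
  shows "v \<in> H0s s \<Omega>"
proof (rule H0s_closedI)
  fix e :: real
  have "Hs_norm_sq s (\<lambda>x. u x - v x) = Hs_norm_sq s (\<lambda>x :: 'a. 0)"
  proof (rule Hs_norm_sq_cong_AE)
    show "AE x in lebesgue. u x - v x = 0" using assms(2) by eventually_elim simp
  qed
  then have "Hs_norm_sq s (\<lambda>x. u x - v x) \<le> ennreal e" by (simp add: Hs_norm_sq_eq)
  with u show "\<exists>w\<in>H0s s \<Omega>. Hs_norm_sq s (\<lambda>x. w x - v x) \<le> ennreal e" by blast
qed (use v in auto)

section \<open>Energy: Poincare inequality, completeness, minimizing sequences\<close>

locale bounded_domain =
  fixes \<Omega> :: "'a::euclidean_space set" and s :: real
  assumes bounded_domain: "bounded \<Omega>"
begin

abbreviation gag :: "('a \<Rightarrow> real) \<Rightarrow> ennreal" where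
  "gag \<equiv> gagliardo_sq s"

abbreviation H0 :: "('a \<Rightarrow> real) set" where
  "H0 \<equiv> H0s s \<Omega>"

text \<open>A real number, so that the parallelogram identity can be solved for one of its terms; it
  represents \<open>gag\<close> on \<open>H0\<close>, where that is finite.\<close>

definition energy :: "('a \<Rightarrow> real) \<Rightarrow> real" where
  "energy u = enn2real (gag u)"

definition poincare_const :: real where
  "poincare_const = (SOME C. C > 0 \<and> (\<forall>u. u \<in> borel_measurable lebesgue \<longrightarrow> (\<forall>x. x \<notin> \<Omega> \<longrightarrow> u x = 0) \<longrightarrow>
    l2sq lebesgue u \<le> ennreal C * gag u))"

lemma poincare_const: "poincare_const > 0"
  "u \<in> borel_measurable lebesgue \<Longrightarrow> (\<And>x. x \<notin> \<Omega> \<Longrightarrow> u x = 0) \<Longrightarrow> l2sq lebesgue u \<le> ennreal poincare_const * gag u"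
proof -
  obtain C where "C > 0" "\<And>u. u \<in> borel_measurable lebesgue \<Longrightarrow> (\<And>x. x \<notin> \<Omega> \<Longrightarrow> u x = 0) \<Longrightarrow>
    l2sq lebesgue u \<le> ennreal C * gag u"
    using fractional_Poincare[OF bounded_domain, of s] by metis
  then have "\<exists>C. C > 0 \<and> (\<forall>u. u \<in> borel_measurable lebesgue \<longrightarrow> (\<forall>x. x \<notin> \<Omega> \<longrightarrow> u x = 0) \<longrightarrow>
    l2sq lebesgue u \<le> ennreal C * gag u)" by blast
  from someI_ex[OF this] show "poincare_const > 0"
    "u \<in> borel_measurable lebesgue \<Longrightarrow> (\<And>x. x \<notin> \<Omega> \<Longrightarrow> u x = 0) \<Longrightarrow> l2sq lebesgue u \<le> ennreal poincare_const * gag u"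
    unfolding poincare_const_def by blast+
qed

lemma Poincare: "u \<in> H0 \<Longrightarrow> l2sq lebesgue u \<le> ennreal poincare_const * gag u"
  by (rule poincare_const(2)) (auto dest: H0sD)

lemma energy_nonneg [simp]: "energy u \<ge> 0"
  by (simp add: energy_def)

lemma gag_energy: "u \<in> H0 \<Longrightarrow> gag u = ennreal (energy u)"
  using H0sD(4)[of u s \<Omega>] by (simp add: energy_def)

lemma energy_le_iff: "u \<in> H0 \<Longrightarrow> e \<ge> 0 \<Longrightarrow> gag u \<le> ennreal e \<longleftrightarrow> energy u \<le> e"
  by (simp add: gag_energy)

lemma energy_parallelogram:
  assumes "u \<in> H0" "v \<in> H0"
  shows "energy (\<lambda>x. u x + v x) + energy (\<lambda>x. u x - v x) = 2 * energy u + 2 * energy v"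
proof -
  have "ennreal (energy (\<lambda>x. u x + v x) + energy (\<lambda>x. u x - v x)) = ennreal (2 * energy u + 2 * energy v)"
    using gagliardo_parallelogram[OF H0sD(1)[OF assms(1)] H0sD(1)[OF assms(2)], of s]
    by (simp add: gag_energy H0s_add H0s_diff assms ennreal_mult)
  then show ?thesis by (subst (asm) ennreal_inj) auto
qed

lemma energy_cmult: "u \<in> H0 \<Longrightarrow> energy (\<lambda>x. c * u x) = c\<^sup>2 * energy u"
  unfolding energy_def by (subst gagliardo_cmult) (auto dest: H0sD simp: enn2real_mult)

lemma l2sq_tendsto_0:
  assumes "\<And>j. w j \<in> H0" "v \<in> H0" "(\<lambda>j. gag (\<lambda>x. w j x - v x)) \<longlonglongrightarrow> 0"
  shows "(\<lambda>j. l2sq lebesgue (\<lambda>x. w j x - v x)) \<longlonglongrightarrow> 0"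
  by (rule tendsto_0_ennreal_le[OF assms(3), where c = poincare_const])
    (intro always_eventually allI Poincare H0s_diff assms)

definition energy_Cauchy :: "(nat \<Rightarrow> 'a \<Rightarrow> real) \<Rightarrow> bool" where
  "energy_Cauchy w \<longleftrightarrow> (\<forall>e>0. \<exists>N. \<forall>i\<ge>N. \<forall>j\<ge>N. gag (\<lambda>x. w i x - w j x) \<le> ennreal e)"

text \<open>The Poincare inequality turns energy-Cauchy into L2-Cauchy. A subsequence converges
  a.e., hence so do its difference quotients a.e. on the product, and Fatou's lemma carries the
  Cauchy bounds over to the limit.\<close>

lemma H0s_complete:
  assumes w: "\<And>j. w j \<in> H0" and C: "energy_Cauchy w"
  obtains v where "v \<in> H0" "(\<lambda>j. gag (\<lambda>x. w j x - v x)) \<longlonglongrightarrow> 0"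
proof -
  note [measurable] = H0sD(1)[OF w]
  have "l2_Cauchy lebesgue w"
    unfolding l2_Cauchy_def
  proof (intro allI impI)
    fix e :: real assume "e > 0"
    then have "e / poincare_const > 0" using poincare_const(1) by simp
    then obtain N where N: "\<And>i j. i \<ge> N \<Longrightarrow> j \<ge> N \<Longrightarrow> gag (\<lambda>x. w i x - w j x) \<le> ennreal (e / poincare_const)"
      using C unfolding energy_Cauchy_def by metis
    have "l2sq lebesgue (\<lambda>x. w i x - w j x) \<le> ennreal e" if "i \<ge> N" "j \<ge> N" for i j
    proof -
      have "l2sq lebesgue (\<lambda>x. w i x - w j x) \<le> ennreal poincare_const * gag (\<lambda>x. w i x - w j x)"
        by (rule Poincare) (intro H0s_diff w)
      also have "\<dots> \<le> ennreal poincare_const * ennreal (e / poincare_const)"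
        by (intro mult_left_mono N that) simp
      also have "\<dots> = ennreal e"
        using poincare_const(1) \<open>e > 0\<close> by (simp add: ennreal_mult[symmetric])
      finally show ?thesis .
    qed
    then show "\<exists>N. \<forall>i\<ge>N. \<forall>j\<ge>N. l2sq lebesgue (\<lambda>x. w i x - w j x) \<le> ennreal e" by blast
  qed
  then obtain v r where [measurable]: "v \<in> borel_measurable lebesgue" and r: "strict_mono r"
    and ae: "AE x in lebesgue. (\<lambda>j. w (r j) x) \<longlonglongrightarrow> v x"
    and l2: "(\<lambda>j. l2sq lebesgue (\<lambda>x. w j x - v x)) \<longlonglongrightarrow> 0" and v0: "\<And>x. (\<And>j. w j x = 0) \<Longrightarrow> v x = 0"
    by (rule l2_complete[rotated]) (auto simp: H0sD(1)[OF w])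
  have ae2: "AE z in lebesgue. (\<lambda>j. diffq s (\<lambda>x. w i x - w (r j) x) z) \<longlonglongrightarrow> diffq s (\<lambda>x. w i x - v x) z" for i
    using AE_lebesgue_fst[OF ae] AE_lebesgue_snd[OF ae]
    by eventually_elim (unfold diffq_def divide_inverse, intro tendsto_intros)
  have tend: "(\<lambda>j. gag (\<lambda>x. w j x - v x)) \<longlonglongrightarrow> 0"
  proof (rule tendsto_0_ennrealI)
    fix e :: real assume "0 < e"
    then obtain N where N: "\<And>i j. i \<ge> N \<Longrightarrow> j \<ge> N \<Longrightarrow> gag (\<lambda>x. w i x - w j x) \<le> ennreal e"
      using C unfolding energy_Cauchy_def by metis
    have "gag (\<lambda>x. w i x - v x) \<le> ennreal e" if "i \<ge> N" for i
      unfolding gagliardo_sq_eq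
    proof (rule l2sq_Fatou[OF _ ae2])
      show "\<forall>\<^sub>F j in sequentially. l2sq lebesgue (diffq s (\<lambda>x. w i x - w (r j) x)) \<le> ennreal e"
        using eventually_ge_at_top[of N]
      proof eventually_elim
        case (elim j)
        then show ?case using N[OF that, of "r j"] seq_suble[OF r, of j] by (simp add: gagliardo_sq_eq)
      qed
    qed measurable
    then show "\<forall>\<^sub>F i in sequentially. gag (\<lambda>x. w i x - v x) \<le> ennreal e"
      by (auto simp: eventually_sequentially)
  qed
  have "v \<in> H0"
  proof (rule H0s_closedI)
    show "x \<notin> \<Omega> \<Longrightarrow> v x = 0" for x using v0 H0sD(3)[OF w] by blast
    fix e :: real assume "e > 0"
    have "(\<lambda>j. Hs_norm_sq s (\<lambda>x. w j x - v x)) \<longlonglongrightarrow> 0 + 0"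
      unfolding Hs_norm_sq_eq by (intro tendsto_add l2 tend)
    then have "eventually (\<lambda>j. Hs_norm_sq s (\<lambda>x. w j x - v x) \<le> ennreal e) sequentially"
      using \<open>e > 0\<close> by (intro tendsto_0_ennrealD) simp
    then show "\<exists>w\<in>H0. Hs_norm_sq s (\<lambda>x. w x - v x) \<le> ennreal e"
      using w by (auto simp: eventually_sequentially)
  qed measurable
  with tend that show ?thesis by blast
qed

lemma gag_limit_le:
  assumes "\<And>j. w j \<in> H0" "v \<in> H0" "(\<lambda>j. gag (\<lambda>x. w j x - v x)) \<longlonglongrightarrow> 0"
    and "eventually (\<lambda>j. gag (w j) \<le> ennreal e) sequentially" "e \<ge> 0"
  shows "gag v \<le> ennreal e"
  using assms unfolding gagliardo_sq_eq diffq_diff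
  by (intro l2sq_limit_le[of "\<lambda>j. diffq s (w j)"]) (auto intro!: diffq_measurable dest: H0sD)

text \<open>Used with sets shrinking to a prescribed L2 limit in \<open>H0s_weak_limit\<close>, and
  with one fixed constraint set in \<open>torsion_solution_exists\<close>. The bound
  \<open>M\<close> makes the increasing infima converge, which forces the energies of almost
  minimizers together.\<close>

lemma minimizing_sequence:
  assumes S: "\<And>n. S n \<subseteq> H0" "\<And>n. S n \<noteq> {}" "\<And>n. S (Suc n) \<subseteq> S n"
    and mid: "\<And>n u v. u \<in> S n \<Longrightarrow> v \<in> S n \<Longrightarrow> (\<lambda>x. (u x + v x) / 2) \<in> S n"
    and bd: "\<And>n. \<exists>u\<in>S n. energy u \<le> M"
  obtains w where "\<And>n. w n \<in> S n" "energy_Cauchy w"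
    "\<And>n u. u \<in> S n \<Longrightarrow> energy (w n) \<le> energy u + 1 / real (Suc n)"
proof -
  define d where "d n = Inf (energy ` S n)" for n
  have bdd: "bdd_below (energy ` S n)" for n by (intro bdd_belowI[of _ 0]) auto
  have d_le: "d n \<le> energy u" if "u \<in> S n" for n u
    unfolding d_def using bdd that by (intro cInf_lower) auto
  have inc: "d n \<le> d (Suc n)" for n
    unfolding d_def using S bdd by (intro cInf_superset_mono image_mono) auto
  have "d n \<le> M" for n using bd[of n] d_le by force
  have "incseq d" using inc by (intro incseq_SucI)
  with \<open>\<And>n. d n \<le> M\<close> obtain L where L: "d \<longlonglongrightarrow> L" "\<And>n. d n \<le> L"
    using incseq_convergent[of d M] by auto
  have "\<exists>u\<in>S n. energy u < d n + 1 / real (Suc n)" for n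
    using cInf_lessD[of "energy ` S n" "d n + 1 / real (Suc n)"] S(2) unfolding d_def by auto
  then obtain w where w: "\<And>n. w n \<in> S n" "\<And>n. energy (w n) < d n + 1 / real (Suc n)"
    by metis
  have wH: "w n \<in> H0" for n using w S by blast
  \<comment> \<open>For i at most j the midpoint lies in \<open>S i\<close>, so its energy is at
    least \<open>d i\<close>. The parallelogram identity then bounds the energy of the difference by
    twice the sum of the excesses of both energies over \<open>d i\<close>.\<close>
  have key: "energy (\<lambda>x. w i x - w j x) \<le> 2 * (L - d i) + 4 / real (Suc i)" if "i \<le> j" for i j
  proof -
    have "S j \<subseteq> S i" using that S(3) by (rule lift_Suc_antimono_le[rotated])
    then have m: "(\<lambda>x. (w i x + w j x) / 2) \<in> S i" using w(1) by (intro mid) auto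
    have "(\<lambda>x. w i x + w j x) = (\<lambda>x. 2 * ((w i x + w j x) / 2))" by (simp add: fun_eq_iff)
    then have "energy (\<lambda>x. w i x + w j x) = energy (\<lambda>x. 2 * ((w i x + w j x) / 2))" by metis
    also have "\<dots> = 4 * energy (\<lambda>x. (w i x + w j x) / 2)"
      using m S(1) by (subst energy_cmult) auto
    also have "\<dots> \<ge> 4 * d i" using d_le[OF m] by simp
    finally have "energy (\<lambda>x. w i x - w j x) \<le> 2 * energy (w i) + 2 * energy (w j) - 4 * d i"
      using energy_parallelogram[OF wH[of i] wH[of j]] by simp
    also have "\<dots> \<le> 2 * (d i + 1 / real (Suc i)) + 2 * (L + 1 / real (Suc i)) - 4 * d i"
    proof -
      have "1 / real (Suc j) \<le> 1 / real (Suc i)" using that by (simp add: frac_le)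
      then show ?thesis using w(2)[of i] w(2)[of j] L(2)[of j] by simp
    qed
    finally show ?thesis by simp
  qed
  have "energy_Cauchy w" unfolding energy_Cauchy_def
  proof (intro allI impI)
    fix e :: real assume "e > 0"
    have "(\<lambda>n. 2 * (L - d n) + 4 * (1 / real (Suc n))) \<longlonglongrightarrow> 2 * (L - L) + 4 * 0"
      by (intro tendsto_intros L LIMSEQ_Suc[OF lim_1_over_n])
    then have "eventually (\<lambda>n. 2 * (L - d n) + 4 * (1 / real (Suc n)) < e) sequentially"
      using \<open>e > 0\<close> by (intro order_tendstoD(2)) auto
    then obtain N where N: "\<And>n. n \<ge> N \<Longrightarrow> 2 * (L - d n) + 4 / real (Suc n) < e"
      by (auto simp: eventually_sequentially)
    have le: "gag (\<lambda>x. w i x - w j x) \<le> ennreal e" if "N \<le> i" "i \<le> j" for i j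
    proof -
      have "energy (\<lambda>x. w i x - w j x) \<le> e" using key[OF that(2)] N[OF that(1)] by simp
      then show ?thesis using energy_le_iff[of "\<lambda>x. w i x - w j x" e] \<open>e > 0\<close> H0s_diff[OF wH wH] by simp
    qed
    have "gag (\<lambda>x. w i x - w j x) \<le> ennreal e" if "N \<le> i" "N \<le> j" for i j
      using le[of i j] le[of j i] that gagliardo_commute[of s "w i" "w j"] by (cases "i \<le> j") auto
    then show "\<exists>N. \<forall>i\<ge>N. \<forall>j\<ge>N. gag (\<lambda>x. w i x - w j x) \<le> ennreal e" by blast
  qed
  moreover have "energy (w n) \<le> energy u + 1 / real (Suc n)" if "u \<in> S n" for n u
    using w(2)[of n] d_le[OF that] by linarith
  ultimately show ?thesis using w(1) that by blast
qed

lemma H0s_midpoint: "u \<in> H0 \<Longrightarrow> v \<in> H0 \<Longrightarrow> (\<lambda>x. (u x + v x) / 2) \<in> H0"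
  using H0s_cmult[OF H0s_add[of u s \<Omega> v], of "1/2"] by simp

text \<open>A weak compactness statement obtained from strong convergence only. The
  \<open>w j\<close> show that every L2 neighbourhood of \<open>u\<close> contains functions in
  \<open>H0\<close> of energy at most \<open>M\<close>; almost minimizers of the energy among these
  converge in energy, and their limit can only be \<open>u\<close>.\<close>

lemma H0s_weak_limit:
  assumes w: "\<And>j. w j \<in> H0" and M: "\<And>j. gag (w j) \<le> ennreal M" "M \<ge> 0"
    and u [measurable]: "u \<in> borel_measurable lebesgue" and l2: "(\<lambda>j. l2sq lebesgue (\<lambda>x. w j x - u x)) \<longlonglongrightarrow> 0"
  obtains v where "v \<in> H0" "AE x in lebesgue. v x = u x" "gag v \<le> ennreal M"
proof -
  define S where "S n = {v\<in>H0. l2sq lebesgue (\<lambda>x. v x - u x) \<le> ennreal (1 / real (Suc n)) \<and> gag v \<le> ennreal M}" for n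
  have S_H0: "S n \<subseteq> H0" for n by (auto simp: S_def)
  have ex: "\<exists>j. w j \<in> S n" for n
    using tendsto_0_ennrealD[OF l2, of "1 / real (Suc n)"] w M
    by (auto simp: S_def eventually_sequentially simp del: of_nat_Suc)
  have dec: "S (Suc n) \<subseteq> S n" for n
  proof -
    have "ennreal (1 / real (Suc (Suc n))) \<le> ennreal (1 / real (Suc n))"
      by (intro ennreal_leI) (simp add: frac_le)
    then show ?thesis unfolding S_def by (auto intro: order_trans simp del: of_nat_Suc)
  qed
  have mid: "(\<lambda>x. (v x + v' x) / 2) \<in> S n" if "v \<in> S n" "v' \<in> S n" for n v v'
  proof -
    have H: "v \<in> H0" "v' \<in> H0" using that S_H0 by auto
    note [measurable] = H0sD(1)[OF H(1)] H0sD(1)[OF H(2)]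
    have eq: "(\<lambda>x. (v x + v' x) / 2 - u x) = (\<lambda>x. ((v x - u x) + (v' x - u x)) / 2)"
      by (simp add: fun_eq_iff field_simps)
    have "l2sq lebesgue (\<lambda>x. (v x + v' x) / 2 - u x) \<le> ennreal (1 / real (Suc n))"
      unfolding eq using that by (intro l2sq_midpoint_le) (auto simp: S_def)
    moreover have "gag (\<lambda>x. (v x + v' x) / 2) \<le> ennreal M"
    proof -
      have "diffq s (\<lambda>x. (v x + v' x) / 2) = (\<lambda>z. (diffq s v z + diffq s v' z) / 2)"
        using diffq_cmult[of s "1/2" "\<lambda>x. v x + v' x"] by (simp add: diffq_add)
      then show ?thesis unfolding gagliardo_sq_eq using that
        by (auto intro!: l2sq_midpoint_le simp: S_def gagliardo_sq_eq)
    qed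
    ultimately show ?thesis using H0s_midpoint[OF H] by (simp add: S_def del: of_nat_Suc)
  qed
  have bd: "\<exists>v\<in>S n. energy v \<le> M" for n
    using ex[of n] M energy_le_iff[OF w M(2)] by blast
  obtain y where y: "\<And>n. y n \<in> S n" "energy_Cauchy y"
    by (rule minimizing_sequence[of S M]) (use S_H0 ex dec mid bd in blast)+
  have yH: "y n \<in> H0" for n using y(1) S_H0 by blast
  obtain v where v: "v \<in> H0" "(\<lambda>j. gag (\<lambda>x. y j x - v x)) \<longlonglongrightarrow> 0"
    using H0s_complete[OF yH y(2)] by blast
  have "AE x in lebesgue. v x = u x"
  proof (rule l2sq_limit_unique)
    show "(\<lambda>j. l2sq lebesgue (\<lambda>x. y j x - v x)) \<longlonglongrightarrow> 0"
      by (rule l2sq_tendsto_0[OF yH v])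
    show "(\<lambda>j. l2sq lebesgue (\<lambda>x. y j x - u x)) \<longlonglongrightarrow> 0"
      by (rule tendsto_0_ennreal_le[OF ennreal_inverse_Suc_tendsto, where c = 1]) (use y(1) in \<open>auto simp: S_def\<close>)
  qed (use yH v(1) u in \<open>auto dest: H0sD\<close>)
  moreover have "gag v \<le> ennreal M"
    by (rule gag_limit_le[OF yH v]) (use y(1) M in \<open>auto simp: S_def\<close>)
  ultimately show ?thesis using v(1) that by blast
qed

text \<open>Smoothed absolute values of approximating test functions are test functions of bounded
  energy. They are shown to converge to |u| in L2 only, not in energy, and this is what
  \<open>H0s_weak_limit\<close> can handle.\<close>

lemma H0s_abs:
  assumes u: "u \<in> H0"
  shows "(\<lambda>x. \<bar>u x\<bar>) \<in> H0"
proof -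
  note [measurable] = H0sD(1)[OF u]
  define e where "e k = 1 / real (Suc k)" for k
  have e: "e k > 0" "e k \<le> 1" for k by (auto simp: e_def)
  have "\<exists>\<phi>. \<phi> \<in> test_functions \<Omega> \<and> \<phi> \<in> H0 \<and> Hs_norm_sq s (\<lambda>x. \<phi> x - u x) \<le> ennreal (e k)" for k
    by (rule H0s_approx[OF u e(1)[of k]]) blast
  then obtain \<phi> where \<phi>: "\<And>k. \<phi> k \<in> test_functions \<Omega>" "\<And>k. \<phi> k \<in> H0" "\<And>k. Hs_norm_sq s (\<lambda>x. \<phi> k x - u x) \<le> ennreal (e k)"
    by metis
  define w where "w k = (\<lambda>x. smooth_abs (e k) (\<phi> k x))" for k
  have w_test: "w k \<in> test_functions \<Omega>" for k
    unfolding w_def by (rule test_function_smooth_abs[OF \<phi>(1) e(1)])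
  have gw: "gag (w k) \<le> gag (\<phi> k)" for k
    unfolding gagliardo_sq_eq w_def
    by (intro l2sq_mono_AE AE_I2) (auto simp: diffq_def e intro!: divide_right_mono smooth_abs_lipschitz)
  have lw: "l2sq lebesgue (w k) \<le> l2sq lebesgue (\<phi> k)" for k
    unfolding w_def using smooth_abs_lipschitz[OF e(1), of k _ 0] e by (intro l2sq_mono_AE AE_I2) auto
  have wH: "w k \<in> H0" for k
    using gw[of k] lw[of k] H0sD(4,5)[OF \<phi>(2)[of k]]
    by (intro H0s_test w_test) (auto simp: Hs_norm_sq_eq)
  \<comment> \<open>The test functions are within squared distance 1 of \<open>u\<close>, so their
    energy is at most 2 + 2 \<open>energy u\<close>; smoothing does not increase it.\<close>
  define M where "M = 2 * 1 + 2 * energy u"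
  have gM: "gag (w k) \<le> ennreal M" for k
  proof -
    have "gag (w k) \<le> gag (\<lambda>x. (\<phi> k x - u x) + u x)" using gw[of k] by simp
    also have "\<dots> \<le> 2 * gag (\<lambda>x. \<phi> k x - u x) + 2 * gag u"
      using H0sD(1)[OF \<phi>(2)[of k]] by (intro gagliardo_add_le) auto
    also have "gag (\<lambda>x. \<phi> k x - u x) \<le> ennreal 1"
    proof -
      have "gag (\<lambda>x. \<phi> k x - u x) \<le> Hs_norm_sq s (\<lambda>x. \<phi> k x - u x)" by (simp add: Hs_norm_sq_eq)
      also have "\<dots> \<le> ennreal 1" using \<phi>(3)[of k] e(2)[of k] by (meson ennreal_leI order_trans)
      finally show ?thesis .
    qed
    finally show ?thesis using u by (simp add: M_def gag_energy ennreal_mult mult_left_mono)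
  qed
  \<comment> \<open>Smoothing is off by up to \<open>e k\<close> even where \<open>u\<close> is well
    approximated; a ball of finite measure around \<Omega> turns this into a small L2 error. The
    locale does not make \<Omega> itself measurable.\<close>
  obtain R where R: "\<Omega> \<subseteq> cball 0 R" using bounded_domain bounded_subset_ballD[of \<Omega> 0] ball_subset_cball by blast
  define B :: "'a set" where "B = cball 0 R"
  define m where "m = measure lebesgue B"
  have emB: "emeasure lebesgue B = ennreal m"
    unfolding B_def m_def by (rule emeasure_eq_measure2[OF lmeasurable_cball])
  have [measurable]: "B \<in> sets lebesgue" by (simp add: B_def)
  have le: "l2sq lebesgue (\<lambda>x. w k x - \<bar>u x\<bar>) \<le> ennreal ((2 + 2 * m) * e k)" for k
  proof -
    note [measurable] = H0sD(1)[OF \<phi>(2)[of k]]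
    have "l2sq lebesgue (\<lambda>x. w k x - \<bar>u x\<bar>) \<le> l2sq lebesgue (\<lambda>x. \<bar>\<phi> k x - u x\<bar> + e k * indicator B x)"
    proof (intro l2sq_mono_AE AE_I2)
      fix x
      have "\<bar>w k x - \<bar>u x\<bar>\<bar> \<le> \<bar>\<phi> k x - u x\<bar> + e k * indicator B x"
      proof (cases "x \<in> B")
        case True
        have "\<bar>smooth_abs (e k) (\<phi> k x) - smooth_abs (e k) (u x)\<bar> \<le> \<bar>\<phi> k x - u x\<bar>"
          "\<bar>smooth_abs (e k) (u x) - \<bar>u x\<bar>\<bar> \<le> e k"
          by (intro smooth_abs_lipschitz smooth_abs_dist e)+
        then show ?thesis using True by (simp add: w_def)
      next
        case False
        then have "x \<notin> \<Omega>" using R by (auto simp: B_def)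
        then show ?thesis using H0sD(3)[OF wH] H0sD(3)[OF u] H0sD(3)[OF \<phi>(2)] False by simp
      qed
      then show "\<bar>w k x - \<bar>u x\<bar>\<bar> \<le> \<bar>\<bar>\<phi> k x - u x\<bar> + e k * indicator B x\<bar>" by linarith
    qed
    also have "\<dots> \<le> 2 * l2sq lebesgue (\<lambda>x. \<bar>\<phi> k x - u x\<bar>) + 2 * l2sq lebesgue (\<lambda>x. e k * indicator B x)"
      by (rule l2sq_add_le) measurable
    also have "l2sq lebesgue (\<lambda>x. \<bar>\<phi> k x - u x\<bar>) = l2sq lebesgue (\<lambda>x. \<phi> k x - u x)"
      by (simp add: l2sq_def)
    also have "\<dots> \<le> ennreal (e k)"
      using \<phi>(3)[of k] by (rule order_trans[rotated]) (simp add: Hs_norm_sq_eq)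
    also have "l2sq lebesgue (\<lambda>x. e k * indicator B x) = ennreal ((e k)\<^sup>2) * l2sq lebesgue (indicator B)"
      by (rule l2sq_scale) measurable
    also have "l2sq lebesgue (indicator B) = ennreal m"
      unfolding l2sq_def emB[symmetric]
    proof (subst nn_integral_indicator[symmetric])
      show "(\<integral>\<^sup>+ x. ennreal ((indicator B x)\<^sup>2) \<partial>lebesgue) = integral\<^sup>N lebesgue (indicator B)"
        by (rule nn_integral_cong) (simp add: indicator_def)
    qed measurable
    also have "ennreal ((e k)\<^sup>2) * ennreal m \<le> ennreal (e k * m)"
      using e[of k] by (simp add: ennreal_mult[symmetric] m_def power2_eq_square mult_left_le_one_le mult.assoc ennreal_leI)
    finally have "l2sq lebesgue (\<lambda>x. w k x - \<bar>u x\<bar>) \<le> 2 * ennreal (e k) + 2 * ennreal (e k * m)"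
      by (simp add: mult_left_mono add_mono)
    also have "\<dots> = ennreal (2 * e k + 2 * (e k * m))"
      using e[of k] by (simp add: ennreal_mult m_def)
    finally show ?thesis by (simp add: algebra_simps)
  qed
  have "(\<lambda>k. l2sq lebesgue (\<lambda>x. w k x - \<bar>u x\<bar>)) \<longlonglongrightarrow> 0"
  proof (rule tendsto_0_ennreal_le[where c = "2 + 2 * m"])
    show "(\<lambda>k. ennreal (e k)) \<longlonglongrightarrow> 0"
      unfolding e_def by (rule ennreal_inverse_Suc_tendsto)
    show "\<forall>\<^sub>F k in sequentially. l2sq lebesgue (\<lambda>x. w k x - \<bar>u x\<bar>) \<le> ennreal (2 + 2 * m) * ennreal (e k)"
    proof (intro always_eventually allI)
      fix k
      have "ennreal ((2 + 2 * m) * e k) = ennreal (2 + 2 * m) * ennreal (e k)"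
        by (rule ennreal_mult) (use e[of k] in \<open>auto simp: m_def\<close>)
      with le[of k] show "l2sq lebesgue (\<lambda>x. w k x - \<bar>u x\<bar>) \<le> ennreal (2 + 2 * m) * ennreal (e k)" by simp
    qed
  qed
  then obtain v where v: "v \<in> H0" "AE x in lebesgue. v x = \<bar>u x\<bar>"
    by (rule H0s_weak_limit[OF wH gM, rotated 2]) (auto simp: M_def)
  show ?thesis
    by (rule H0s_cong_AE[OF v]) (auto simp: H0sD(3)[OF u])
qed

section \<open>Capacity and quasi-continuity\<close>

lemma energy_sum_le:
  assumes "\<And>j::nat. g j \<in> H0"
  shows "energy (\<lambda>x. \<Sum>j<n. g j x) \<le> (\<Sum>j<n. 2 ^ (j + 1) * energy (g j))"
proof -
  have "gag (\<lambda>x. \<Sum>j<n. g j x) \<le> (\<Sum>j<n. 2 ^ (j + 1) * gag (g j))"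
    by (rule gagliardo_sum_le) (rule H0sD(1)[OF assms])
  also have "\<dots> = (\<Sum>j<n. ennreal (2 ^ (j + 1) * energy (g j)))"
    unfolding ennreal_two_power gag_energy[OF assms] by (intro sum.cong refl ennreal_mult[symmetric]) auto
  also have "\<dots> = ennreal (\<Sum>j<n. 2 ^ (j + 1) * energy (g j))"
    by (intro sum_ennreal) simp
  finally show ?thesis
    by (subst (asm) energy_le_iff) (auto intro!: H0s_sum assms sum_nonneg)
qed

text \<open>The sum of the series serves as a common majorant, at the cost of the weights from
  \<open>gagliardo_sum_le\<close>. This avoids suprema of infinitely many functions in
  \<open>H0\<close>.\<close>

lemma nonneg_series:
  assumes g: "\<And>j. g j \<in> H0" "\<And>j x. g j x \<ge> 0" and M: "(\<Sum>j. 2 ^ (j + 1) * gag (g j)) \<le> ennreal M" "M \<ge> 0"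
  obtains G where "G \<in> H0" "gag G \<le> ennreal M" "AE x in lebesgue. \<forall>j. g j x \<le> G x"
proof -
  define a where "a j = 2 ^ (j + 1) * energy (g j)" for j
  have a0: "a j \<ge> 0" for j by (simp add: a_def)
  have aeq: "2 ^ (j + 1) * gag (g j) = ennreal (a j)" for j
    unfolding a_def gag_energy[OF g(1)] ennreal_two_power by (intro ennreal_mult[symmetric]) auto
  have sm: "(\<Sum>j. ennreal (a j)) \<le> ennreal M" using M by (simp only: aeq)
  then have sa: "summable a"
    using a0 by (intro summable_suminf_not_top) (auto simp: top_unique)
  have aM: "(\<Sum>j<n. a j) \<le> M" for n
  proof -
    have "(\<Sum>j<n. a j) \<le> suminf a" using sa a0 by (intro sum_le_suminf) auto
    moreover have "suminf a \<le> M"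
      using sm M(2) suminf_ennreal2[OF a0 sa] by simp
    ultimately show ?thesis by simp
  qed
  define S where "S n = (\<lambda>x. \<Sum>j<n. g j x)" for n
  have SH: "S n \<in> H0" for n unfolding S_def by (intro H0s_sum g)
  have tail: "energy (\<lambda>x. S n x - S m x) \<le> (\<Sum>j. a (j + m))" if "m \<le> n" for m n
  proof -
    have "(\<lambda>x. S n x - S m x) = (\<lambda>x. \<Sum>j<n - m. g (j + m) x)"
    proof
      fix x
      have "(\<Sum>j<n. g j x) = (\<Sum>j<m. g j x) + (\<Sum>j\<in>{m..<n}. g j x)"
        using that by (metis atLeast0LessThan sum.atLeastLessThan_concat zero_le)
      moreover have "(\<Sum>j\<in>{m..<n}. g j x) = (\<Sum>j<n - m. g (j + m) x)"
        using that sum.shift_bounds_nat_ivl[of "\<lambda>j. g j x" 0 m "n - m"] by (simp add: atLeast0LessThan)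
      ultimately show "S n x - S m x = (\<Sum>j<n - m. g (j + m) x)" by (simp add: S_def)
    qed
    then have "energy (\<lambda>x. S n x - S m x) \<le> (\<Sum>j<n - m. 2 ^ (j + 1) * energy (g (j + m)))"
      using energy_sum_le[of "\<lambda>j. g (j + m)" "n - m"] g by simp
    also have "\<dots> \<le> (\<Sum>j<n - m. a (j + m))"
      \<comment> \<open>The tail restarts the weights at 2^(j+1), below the weight 2^(j+m+1)
        contained in \<open>a (j + m)\<close>.\<close>
      unfolding a_def by (intro sum_mono mult_right_mono power_increasing) auto
    also have "\<dots> \<le> (\<Sum>j. a (j + m))"
      using sa a0 by (intro sum_le_suminf) (auto simp: summable_iff_shift)
    finally show ?thesis .
  qed
  have "energy_Cauchy S" unfolding energy_Cauchy_def
  proof (intro allI impI)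
    fix e :: real assume "e > 0"
    then obtain N where N: "\<And>n. n \<ge> N \<Longrightarrow> norm (\<Sum>i. a (i + n)) < e"
      using suminf_exist_split[OF _ sa] by blast
    have le: "gag (\<lambda>x. S i x - S j x) \<le> ennreal e" if "N \<le> j" "j \<le> i" for i j
      using tail[OF that(2)] N[OF that(1)] \<open>e > 0\<close> energy_le_iff[OF H0s_diff[OF SH SH], of e i j] by simp
    have "gag (\<lambda>x. S i x - S j x) \<le> ennreal e" if "N \<le> i" "N \<le> j" for i j
      using le[of i j] le[of j i] that gagliardo_commute[of s "S i" "S j"] by (cases "i \<le> j") auto
    then show "\<exists>N. \<forall>i\<ge>N. \<forall>j\<ge>N. gag (\<lambda>x. S i x - S j x) \<le> ennreal e" by blast
  qed
  then obtain G where G: "G \<in> H0" "(\<lambda>j. gag (\<lambda>x. S j x - G x)) \<longlonglongrightarrow> 0"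
    using H0s_complete[of S] SH by blast
  have "gag (S n) \<le> ennreal M" for n
    using energy_sum_le[of g n, OF g(1)] aM[of n] M(2) energy_le_iff[OF SH, of M n]
    by (simp add: S_def a_def)
  then have gG: "gag G \<le> ennreal M"
    using M(2) by (intro gag_limit_le[OF SH G]) auto
  have "AE x in lebesgue. g j x \<le> G x" for j
  proof -
    note [measurable] = H0sD(1)[OF g(1)] H0sD(1)[OF G(1)]
    \<comment> \<open>By nonnegativity \<open>g j\<close> lies below all later partial sums, so its
      excess over \<open>G\<close> is at most their distance to \<open>G\<close>, which tends to 0
      in L2.\<close>
    have "l2sq lebesgue (\<lambda>x. max (g j x - G x) 0) \<le> l2sq lebesgue (\<lambda>x. S n x - G x)" if "n > j" for n
    proof (intro l2sq_mono_AE AE_I2)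
      fix x
      have "g j x \<le> S n x" unfolding S_def using that g(2) by (intro member_le_sum) auto
      then show "\<bar>max (g j x - G x) 0\<bar> \<le> \<bar>S n x - G x\<bar>" by auto
    qed
    then have "eventually (\<lambda>n. l2sq lebesgue (\<lambda>x. max (g j x - G x) 0) \<le> l2sq lebesgue (\<lambda>x. S n x - G x)) sequentially"
      by (rule eventually_mono[OF eventually_gt_at_top[of j]])
    then have "l2sq lebesgue (\<lambda>x. max (g j x - G x) 0) \<le> 0"
      by (rule tendsto_lowerbound[OF l2sq_tendsto_0[OF SH G]]) simp
    then have "AE x in lebesgue. max (g j x - G x) 0 = 0"
      by (intro l2sq_0_imp_AE) auto
    then show ?thesis by eventually_elim auto
  qed
  then have "AE x in lebesgue. \<forall>j. g j x \<le> G x" by (simp add: AE_all_countable)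
  with G(1) gG that show ?thesis by blast
qed

section \<open>Capacity: countable subadditivity up to weights, null sets\<close>

abbreviation cp :: "'a set \<Rightarrow> ennreal" where
  "cp A \<equiv> cap s A \<Omega>"

lemma cap_le:
  assumes "u \<in> H0" "open V" "A \<subseteq> V" "AE x in lebesgue. x \<in> V \<longrightarrow> 1 \<le> u x"
  shows "cp A \<le> gag u"
  unfolding cap_def using assms by (intro INF_lower) blast

text \<open>Nonnegativity is added to the requirements in \<open>cap\<close>. Passing from u to |u|
  shows that this costs no energy, and it makes a sum of competitors a competitor for the
  union.\<close>

definition competitor :: "'a set \<Rightarrow> ('a \<Rightarrow> real) \<Rightarrow> 'a set \<Rightarrow> bool" where
  "competitor A u V \<longleftrightarrow> u \<in> H0 \<and> (\<forall>x. u x \<ge> 0) \<and> open V \<and> A \<subseteq> V \<and> (AE x in lebesgue. x \<in> V \<longrightarrow> 1 \<le> u x)"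

lemma competitorD:
  assumes "competitor A u V"
  shows "u \<in> H0" "u x \<ge> 0" "open V" "A \<subseteq> V" "AE x in lebesgue. x \<in> V \<longrightarrow> 1 \<le> u x"
  using assms by (auto simp: competitor_def)

lemma cap_lessE:
  assumes "cp A < b"
  obtains u V where "competitor A u V" "gag u < b"
proof -
  obtain u V where u: "u \<in> H0" "open V" "A \<subseteq> V" "AE x in lebesgue. x \<in> V \<longrightarrow> 1 \<le> u x" "gag u < b"
    using assms unfolding cap_def INF_less_iff by blast
  have "AE x in lebesgue. x \<in> V \<longrightarrow> 1 \<le> \<bar>u x\<bar>" using u(4) by eventually_elim auto
  moreover have "gag (\<lambda>x. \<bar>u x\<bar>) < b" using gagliardo_abs_le u(5) by (rule le_less_trans)
  ultimately show ?thesis using that[of "\<lambda>x. \<bar>u x\<bar>" V] H0s_abs[OF u(1)] u(2,3) by (simp add: competitor_def)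
qed

lemma cap_mono: "A \<subseteq> B \<Longrightarrow> cp A \<le> cp B"
  unfolding cap_def by (intro INF_superset_mono) auto

lemma cap_empty [simp]: "cp {} = 0"
  using cap_le[of "\<lambda>x. 0" "{}" "{}"] by simp

text \<open>Competitors for the single sets are summed by \<open>nonneg_series\<close>. The weights
  come from there and are harmless for null sets and for geometrically small capacities.\<close>

lemma cap_UN_le: "cp (\<Union>j. U j) \<le> (\<Sum>j. 2 ^ (j + 1) * cp (U j))"
proof (cases "(\<Sum>j. 2 ^ (j + 1) * cp (U j)) = top")
  case False
  define R where "R = enn2real (\<Sum>j. 2 ^ (j + 1) * cp (U j))"
  have R: "(\<Sum>j. 2 ^ (j + 1) * cp (U j)) = ennreal R" "R \<ge> 0" using False by (auto simp: R_def less_top)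
  show ?thesis unfolding R(1)
  proof (rule ennreal_le_epsilon)
    fix e :: real assume e: "e > 0"
    \<comment> \<open>With the weights 2^(j+1) these errors add up to exactly
      \<open>e\<close>.\<close>
    define d where "d j = e / 4 * (1/4) ^ j" for j :: nat
    have d: "d j > 0" for j using e by (simp add: d_def)
    have fin: "cp (U j) < top" for j
    proof (rule ccontr)
      assume "\<not> cp (U j) < top"
      then have "cp (U j) = top" by (metis top.not_eq_extremum)
      then have "2 ^ (j + 1) * cp (U j) = top" unfolding ennreal_two_power by (simp add: ennreal_mult_top)
      moreover have "2 ^ (j + 1) * cp (U j) \<le> (\<Sum>j. 2 ^ (j + 1) * cp (U j))"
        using sum_le_suminf[of "\<lambda>j. 2 ^ (j + 1) * cp (U j)" "{j}"] by simp
      ultimately show False using False by (simp add: top_unique)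
    qed
    have "\<exists>u V. competitor (U j) u V \<and> gag u < cp (U j) + ennreal (d j)" for j
    proof -
      have "cp (U j) < cp (U j) + ennreal (d j)"
        using fin[of j] d[of j] ennreal_add_left_cancel_less[of "cp (U j)" 0 "ennreal (d j)"] by auto
      from cap_lessE[OF this] show ?thesis by metis
    qed
    then obtain u V where c: "\<And>j. competitor (U j) (u j) (V j)" and lt: "\<And>j. gag (u j) < cp (U j) + ennreal (d j)"
      by metis
    note u = competitorD[OF c]
    have "(\<Sum>j. 2 ^ (j + 1) * gag (u j)) \<le> (\<Sum>j. 2 ^ (j + 1) * cp (U j) + 2 ^ (j + 1) * ennreal (d j))"
      unfolding distrib_left[symmetric] using less_imp_le[OF lt] by (intro suminf_le mult_left_mono) auto
    also have "\<dots> = (\<Sum>j. 2 ^ (j + 1) * cp (U j)) + (\<Sum>j. 2 ^ (j + 1) * ennreal (d j))"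
      by (rule suminf_add[symmetric]) auto
    also have "(\<Sum>j. 2 ^ (j + 1) * ennreal (d j)) = ennreal e"
      using suminf_geometric_half[of "e / 4" 0] e by (simp add: d_def)
    finally have "(\<Sum>j. 2 ^ (j + 1) * gag (u j)) \<le> ennreal (R + e)"
      using e R by simp
    then obtain G where G: "G \<in> H0" "gag G \<le> ennreal (R + e)" "AE x in lebesgue. \<forall>j. u j x \<le> G x"
      by (rule nonneg_series[OF u(1,2)]) (use e R in auto)
    have "AE x in lebesgue. \<forall>j. x \<in> V j \<longrightarrow> 1 \<le> u j x"
      using u(5) by (simp add: AE_all_countable)
    with G(3) have ae: "AE x in lebesgue. x \<in> (\<Union>j. V j) \<longrightarrow> 1 \<le> G x"
      by eventually_elim (auto intro: order_trans)
    have "cp (\<Union>j. U j) \<le> gag G"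
      by (rule cap_le[OF G(1) _ _ ae]) (use u(3,4) in auto)
    also note G(2)
    also have "ennreal (R + e) = ennreal R + ennreal e" using e R by simp
    finally show "cp (\<Union>j. U j) \<le> ennreal R + ennreal e" .
  qed
qed simp

lemma cap_null_UN: "(\<And>j. cp (U j) = 0) \<Longrightarrow> cp (\<Union>j::nat. U j) = 0"
  using cap_UN_le[of U] by simp

text \<open>The constants are the weights of \<open>cap_UN_le\<close> at the indices 0 and
  1.\<close>

lemma cap_Un_le: "cp (A \<union> B) \<le> 2 * cp A + 4 * cp B"
proof -
  define U where "U j = (if j = 0 then A else if j = 1 then B else {})" for j :: nat
  have "A \<union> B = (\<Union>j. U j)" by (auto simp: U_def split: if_splits)
  then have "cp (A \<union> B) \<le> (\<Sum>j. 2 ^ (j + 1) * cp (U j))" using cap_UN_le by metis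
  also have "\<dots> = (\<Sum>j\<in>{0, 1}. 2 ^ (j + 1) * cp (U j))"
    by (rule suminf_finite) (auto simp: U_def)
  also have "\<dots> = 2 * cp A + 4 * cp B" by (simp add: U_def)
  finally show ?thesis .
qed

lemma cap_null_Un: "cp A = 0 \<Longrightarrow> cp B = 0 \<Longrightarrow> cp (A \<union> B) = 0"
  using cap_Un_le[of A B] by simp

lemma cap_tail_le:
  assumes "\<And>j. cp (E j) \<le> ennreal (c * (1/4) ^ j)" "c \<ge> 0"
  shows "cp (\<Union>i. E (k + i)) \<le> ennreal (4 * c * (1/4) ^ k)"
proof -
  have "cp (\<Union>i. E (k + i)) \<le> (\<Sum>i. 2 ^ (i + 1) * cp (E (k + i)))" by (rule cap_UN_le)
  also have "\<dots> \<le> (\<Sum>i. 2 ^ (i + 1) * ennreal (c * (1/4) ^ (k + i)))"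
    using assms(1) by (intro suminf_le mult_left_mono) auto
  also have "\<dots> = ennreal (4 * c * (1/4) ^ k)" by (rule suminf_geometric_half[OF assms(2)])
  finally show ?thesis .
qed

text \<open>Competitors of small energy have small L2 norm by the Poincare inequality, yet are at
  least 1 a.e. on a neighbourhood of \<open>N\<close>. The intersection of these neighbourhoods is a
  Borel null set containing \<open>N\<close>.\<close>

lemma cap_null_AE:
  assumes "cp N = 0"
  shows "AE x in lebesgue. x \<notin> N"
proof -
  have "\<exists>u V. competitor N u V \<and> gag u < ennreal (1 / real (Suc k))" for k
  proof -
    have "cp N < ennreal (1 / real (Suc k))" using assms by (simp del: of_nat_Suc)
    from cap_lessE[OF this] show ?thesis by metis
  qed
  then obtain u V where c: "\<And>j. competitor N (u j) (V j)" and lt: "\<And>j. gag (u j) < ennreal (1 / real (Suc j))"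
    by metis
  note u = competitorD[OF c]
  define B where "B = (\<Inter>j. V j)"
  have "B \<in> sets borel" unfolding B_def using u(3) by (intro sets.countable_INT) auto
  then have [measurable]: "B \<in> sets lebesgue" by simp
  have "l2sq lebesgue (indicator B) \<le> ennreal poincare_const * ennreal (1 / real (Suc k))" for k
  proof -
    have "l2sq lebesgue (indicator B) \<le> l2sq lebesgue (u k)"
      by (rule l2sq_mono_AE, use u(5)[of k] in eventually_elim) (auto simp: B_def indicator_def)
    also have "\<dots> \<le> ennreal poincare_const * gag (u k)" by (rule Poincare[OF u(1)])
    also have "\<dots> \<le> ennreal poincare_const * ennreal (1 / real (Suc k))"
      using lt[of k] by (intro mult_left_mono) auto
    finally show ?thesis .
  qed
  moreover have "(\<lambda>k. ennreal poincare_const * ennreal (1 / real (Suc k))) \<longlonglongrightarrow> ennreal poincare_const * 0"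
    by (intro ennreal_tendsto_cmult ennreal_inverse_Suc_tendsto) auto
  ultimately have "l2sq lebesgue (indicator B) \<le> ennreal poincare_const * 0"
    by (intro tendsto_lowerbound[OF _ always_eventually]) auto
  then have "AE x in lebesgue. indicator B x = (0::real)"
    by (intro l2sq_0_imp_AE) auto
  then show ?thesis by eventually_elim (use u(4) in \<open>auto simp: B_def indicator_def split: if_splits\<close>)
qed

section \<open>Quasi-continuity and its stability under limits in energy\<close>

lemma quasi_continuousE:
  assumes "quasi_continuous s \<Omega> u" "e > 0"
  obtains G where "open G" "G \<subseteq> \<Omega>" "cp G \<le> ennreal e" "continuous_on (- G) u"
proof -
  obtain G where G: "\<And>k. open (G k)" "\<And>k. G k \<subseteq> \<Omega>" "(\<lambda>k. cp (G k)) \<longlonglongrightarrow> 0" "\<And>k. continuous_on (- G k) u"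
    using assms(1) unfolding quasi_continuous_def small_open_seq_def by blast
  obtain k where "cp (G k) \<le> ennreal e"
    using tendsto_0_ennrealD[OF G(3) assms(2)] by (auto simp: eventually_sequentially)
  with G that show ?thesis by blast
qed

text \<open>The exceptional sets \<open>E j\<close> are not nested; the unions of their tails are,
  and the geometric rate keeps the capacity of the tails small.\<close>

lemma small_open_seq_tails:
  assumes "\<And>j. open (E j)" "\<And>j. E j \<subseteq> \<Omega>" "\<And>j. cp (E j) \<le> ennreal (c * (1/4) ^ j)" "c \<ge> 0"
  shows "small_open_seq s \<Omega> (\<lambda>k. \<Union>i. E (k + i))"
proof -
  have "(\<lambda>k. ennreal (4 * c * (1/4) ^ k)) \<longlonglongrightarrow> ennreal (4 * c * 0)"
    by (intro tendsto_ennrealI tendsto_intros LIMSEQ_power_zero) auto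
  then have l: "(\<lambda>k. ennreal (4 * c * (1/4) ^ k)) \<longlonglongrightarrow> 0" by simp
  have "(\<lambda>k. cp (\<Union>i. E (k + i))) \<longlonglongrightarrow> 0"
    by (rule tendsto_0_ennreal_le[OF l, where c = 1]) (use cap_tail_le[OF assms(3,4)] in simp)
  moreover have "decseq (\<lambda>k. \<Union>i. E (k + i))"
  proof (rule decseq_SucI)
    fix k show "(\<Union>i. E (Suc k + i)) \<subseteq> (\<Union>i. E (k + i))"
      by (auto intro!: exI[of _ "Suc _"])
  qed
  ultimately show ?thesis using assms unfolding small_open_seq_def by blast
qed

lemma quasi_continuousI:
  assumes "\<And>e. e > 0 \<Longrightarrow> \<exists>G. open G \<and> G \<subseteq> \<Omega> \<and> cp G \<le> ennreal e \<and> continuous_on (- G) u"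
  shows "quasi_continuous s \<Omega> u"
proof -
  have "\<exists>G. open G \<and> G \<subseteq> \<Omega> \<and> cp G \<le> ennreal (1 * (1/4) ^ j) \<and> continuous_on (- G) u" for j :: nat
    by (rule assms) simp
  then obtain E where E: "\<And>j::nat. open (E j)" "\<And>j. E j \<subseteq> \<Omega>" "\<And>j. cp (E j) \<le> ennreal (1 * (1/4) ^ j)"
    "\<And>j. continuous_on (- E j) u"
    by metis
  have "E k \<subseteq> (\<Union>i. E (k + i))" for k
    by (metis UN_upper UNIV_I add_0_right)
  then have "continuous_on (- (\<Union>i. E (k + i))) u" for k
    by (intro continuous_on_subset[OF E(4)[of k]]) blast
  moreover have "small_open_seq s \<Omega> (\<lambda>k. \<Union>i. E (k + i))"
    by (rule small_open_seq_tails[OF E(1-3)]) simp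
  ultimately show ?thesis unfolding quasi_continuous_def by blast
qed

lemma quasi_continuous_continuous: "continuous_on UNIV u \<Longrightarrow> quasi_continuous s \<Omega> u"
  by (intro quasi_continuousI exI[of _ "{}"]) auto

text \<open>The tolerance e/6 offsets the weights 2 + 4 of \<open>cap_Un_le\<close>.\<close>

lemma cap_Un_small:
  assumes "cp A \<le> ennreal (e / 6)" "cp B \<le> ennreal (e / 6)" "e > 0"
  shows "cp (A \<union> B) \<le> ennreal e"
proof -
  have "cp (A \<union> B) \<le> 2 * cp A + 4 * cp B" by (rule cap_Un_le)
  also have "\<dots> \<le> 2 * ennreal (e / 6) + 4 * ennreal (e / 6)"
    by (intro add_mono mult_left_mono assms) auto
  also have "\<dots> = ennreal (2 * (e / 6) + 4 * (e / 6))"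
    using assms(3) by (subst ennreal_plus, simp, simp, subst ennreal_mult, simp, simp, subst ennreal_mult, simp_all)
  finally show ?thesis by simp
qed

lemma quasi_continuous_combine:
  assumes u: "quasi_continuous s \<Omega> u" and v: "quasi_continuous s \<Omega> v"
    and "\<And>S. continuous_on S u \<Longrightarrow> continuous_on S v \<Longrightarrow> continuous_on S w"
  shows "quasi_continuous s \<Omega> w"
proof (rule quasi_continuousI)
  fix e :: real assume e: "e > 0"
  then have e6: "e / 6 > 0" by simp
  obtain G where G: "open G" "G \<subseteq> \<Omega>" "cp G \<le> ennreal (e / 6)" "continuous_on (- G) u"
    using quasi_continuousE[OF u e6] by blast
  obtain H where H: "open H" "H \<subseteq> \<Omega>" "cp H \<le> ennreal (e / 6)" "continuous_on (- H) v"
    using quasi_continuousE[OF v e6] by blast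
  have "continuous_on (- (G \<union> H)) w"
    by (intro assms(3)) (auto intro: continuous_on_subset[OF G(4)] continuous_on_subset[OF H(4)])
  then show "\<exists>G. open G \<and> G \<subseteq> \<Omega> \<and> cp G \<le> ennreal e \<and> continuous_on (- G) w"
    using G H cap_Un_small[OF G(3) H(3) e] by (intro exI[of _ "G \<union> H"]) auto
qed

lemma quasi_continuous_add:
  "quasi_continuous s \<Omega> u \<Longrightarrow> quasi_continuous s \<Omega> v \<Longrightarrow> quasi_continuous s \<Omega> (\<lambda>x. u x + v x)"
  by (rule quasi_continuous_combine[of u v]) (simp_all add: continuous_on_add)

lemma quasi_continuous_cmult:
  "quasi_continuous s \<Omega> u \<Longrightarrow> quasi_continuous s \<Omega> (\<lambda>x. c * u x)"
  by (rule quasi_continuous_combine[of u u]) (simp_all add: continuous_on_mult_left)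

lemma energy_Cauchy_convergent:
  assumes w: "\<And>j. w j \<in> H0" and v: "v \<in> H0" and lim: "(\<lambda>j. gag (\<lambda>x. w j x - v x)) \<longlonglongrightarrow> 0"
  shows "energy_Cauchy w"
  unfolding energy_Cauchy_def
proof (intro allI impI)
  fix e :: real assume e: "e > 0"
  then have "e / 4 > 0" by simp
  from tendsto_0_ennrealD[OF lim this] obtain N
    where N: "\<And>j. j \<ge> N \<Longrightarrow> gag (\<lambda>x. w j x - v x) \<le> ennreal (e / 4)"
    by (auto simp: eventually_sequentially)
  have "gag (\<lambda>x. w i x - w j x) \<le> ennreal e" if "i \<ge> N" "j \<ge> N" for i j
  proof -
    note [measurable] = H0sD(1)[OF w] H0sD(1)[OF v]
    have "gag (\<lambda>x. (w i x - v x) - (w j x - v x)) \<le> 2 * gag (\<lambda>x. w i x - v x) + 2 * gag (\<lambda>x. w j x - v x)"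
      by (rule gagliardo_diff_le) measurable
    also have "\<dots> \<le> 2 * ennreal (e / 4) + 2 * ennreal (e / 4)"
      by (intro add_mono mult_left_mono N that) auto
    also have "\<dots> = ennreal 4 * ennreal (e / 4)" by (simp flip: distrib_right)
    also have "\<dots> = ennreal (4 * (e / 4))" by (rule ennreal_mult[symmetric]) (use e in auto)
    finally show ?thesis by simp
  qed
  then show "\<exists>N. \<forall>i\<ge>N. \<forall>j\<ge>N. gag (\<lambda>x. w i x - w j x) \<le> ennreal e" by blast
qed

text \<open>A Chebyshev inequality for capacity. The superlevel set becomes open once the
  exceptional sets \<open>E\<close> and \<open>F\<close> are added, and |d|/t plus competitors for
  these two is a competitor for the union. Applying the factor 2 twice gives the 4.\<close>

lemma cap_superlevel_le:
  assumes d: "d \<in> H0" and E: "open E" "cp E < b" and F: "open F" "cp F < b'"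
    and cont: "continuous_on (- (E \<union> F)) d" and t: "t > 0"
  defines "U \<equiv> {x. \<bar>d x\<bar> > t} \<union> E \<union> F"
  shows "open U" "cp U \<le> 2 * (ennreal ((1 / t)\<^sup>2) * gag d) + 4 * b + 4 * b'"
proof -
  have "closed ((- (E \<union> F)) \<inter> d -` {-t..t})"
    by (intro continuous_closed_preimage cont) (use E F in auto)
  moreover have "- U = (- (E \<union> F)) \<inter> d -` {-t..t}"
    by (auto simp: U_def)
  ultimately show U: "open U" by (simp only: open_closed)
  obtain u V where u: "competitor E u V" "gag u < b" using cap_lessE[OF E(2)] .
  obtain v W where v: "competitor F v W" "gag v < b'" using cap_lessE[OF F(2)] .
  note u' = competitorD[OF u(1)] and v' = competitorD[OF v(1)]
  define f where "f x = (1 / t) * \<bar>d x\<bar> + (u x + v x)" for x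
  note [measurable] = H0sD(1)[OF d] H0sD(1)[OF u'(1)] H0sD(1)[OF v'(1)]
  have f: "f \<in> H0"
    unfolding f_def by (intro H0s_add H0s_cmult H0s_abs d u' v')
  have "AE x in lebesgue. x \<in> U \<longrightarrow> 1 \<le> f x"
    using u'(5) v'(5)
  proof eventually_elim
    case (elim x)
    have nn: "(1 / t) * \<bar>d x\<bar> \<ge> 0" "u x \<ge> 0" "v x \<ge> 0" using t u'(2) v'(2) by auto
    show ?case
    proof
      assume "x \<in> U"
      then consider "\<bar>d x\<bar> > t" | "x \<in> E" | "x \<in> F" by (auto simp: U_def)
      then show "1 \<le> f x"
      proof cases
        case 1
        then have "(1 / t) * \<bar>d x\<bar> \<ge> 1" using t by (simp add: field_simps)
        with nn show ?thesis by (simp add: f_def)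
      qed (use elim nn u'(4) v'(4) in \<open>auto simp: f_def\<close>)
    qed
  qed
  then have "cp U \<le> gag f" by (rule cap_le[OF f U subset_refl])
  also have "\<dots> \<le> 2 * gag (\<lambda>x. (1 / t) * \<bar>d x\<bar>) + 2 * gag (\<lambda>x. u x + v x)"
    unfolding f_def by (rule gagliardo_add_le) measurable
  also have "\<dots> \<le> 2 * (ennreal ((1 / t)\<^sup>2) * gag (\<lambda>x. \<bar>d x\<bar>)) + 2 * (2 * gag u + 2 * gag v)"
  proof (intro add_mono mult_left_mono)
    show "gag (\<lambda>x. (1 / t) * \<bar>d x\<bar>) \<le> ennreal ((1 / t)\<^sup>2) * gag (\<lambda>x. \<bar>d x\<bar>)"
      by (rule eq_refl, rule gagliardo_cmult) measurable
    show "gag (\<lambda>x. u x + v x) \<le> 2 * gag u + 2 * gag v"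
      by (rule gagliardo_add_le) measurable
  qed auto
  also have "\<dots> \<le> 2 * (ennreal ((1 / t)\<^sup>2) * gag d) + 2 * (2 * b + 2 * b')"
    using u(2) v(2) by (intro add_mono mult_left_mono gagliardo_abs_le) auto
  also have "\<dots> = 2 * (ennreal ((1 / t)\<^sup>2) * gag d) + 4 * b + 4 * b'"
    by (simp add: distrib_left mult.assoc[symmetric] add.assoc)
  finally show "cp U \<le> 2 * (ennreal ((1 / t)\<^sup>2) * gag d) + 4 * b + 4 * b'" .
qed

text \<open>An Egorov theorem for capacity: a fast subsequence converges uniformly off open sets of
  arbitrarily small capacity. This gives the quasi-continuous version together with q.e. pointwise
  convergence, by which conditions holding q.e. pass to the limit.\<close>

lemma quasi_limit:
  assumes w: "\<And>j. w j \<in> H0" "\<And>j. quasi_continuous s \<Omega> (w j)"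
    and v: "v \<in> H0" and lim: "(\<lambda>j. gag (\<lambda>x. w j x - v x)) \<longlonglongrightarrow> 0"
  obtains v' N r where "v' \<in> H0" "quasi_continuous s \<Omega> v'" "AE x in lebesgue. v' x = v x"
    "N \<subseteq> \<Omega>" "cp N = 0" "strict_mono r" "\<And>x. x \<notin> N \<Longrightarrow> (\<lambda>j. w (r j) x) \<longlonglongrightarrow> v' x"
proof -
  have "l2_Cauchy lebesgue (\<lambda>j. diffq s (w j))"
    using energy_Cauchy_convergent[OF w(1) v lim]
    by (simp add: l2_Cauchy_def energy_Cauchy_def gagliardo_sq_eq diffq_diff)
  \<comment> \<open>Exceeding the threshold (1/2)^j costs a factor 4^j in capacity, so the rate
    (1/16)^j leaves (1/4)^j, as \<open>small_open_seq_tails\<close> asks.\<close>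
  then obtain r where r: "strict_mono r"
    and fast: "\<And>j. gag (\<lambda>x. w (r (Suc j)) x - w (r j) x) \<le> ennreal ((1/16) ^ j)"
    by (rule l2_Cauchy_fast_subseq[where e = "\<lambda>j. (1/16) ^ j"]) (auto simp: gagliardo_sq_eq diffq_diff)
  define y where "y j = w (r j)" for j
  have y: "y j \<in> H0" "quasi_continuous s \<Omega> (y j)" for j using w by (auto simp: y_def)
  have "\<exists>G. open G \<and> G \<subseteq> \<Omega> \<and> cp G \<le> ennreal ((1/4) ^ j) \<and> continuous_on (- G) (y j)" for j
    by (rule quasi_continuousE[OF y(2)[of j], of "(1/4) ^ j"]) auto
  then obtain E where E: "\<And>j. open (E j)" "\<And>j. E j \<subseteq> \<Omega>" "\<And>j. cp (E j) \<le> ennreal ((1/4) ^ j)"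
    "\<And>j. continuous_on (- E j) (y j)"
    by metis
  define d where "d j x = y (Suc j) x - y j x" for j x
  have dH: "d j \<in> H0" for j unfolding d_def by (intro H0s_diff y)
  define U where "U j = {x. \<bar>d j x\<bar> > (1/2) ^ j} \<union> E j \<union> E (Suc j)" for j
  have dc: "continuous_on (- (E j \<union> E (Suc j))) (d j)" for j
    unfolding d_def by (intro continuous_intros continuous_on_subset[OF E(4)]) auto
  \<comment> \<open>The factor 2 makes the bound strict, as \<open>cap_superlevel_le\<close> takes
    strict bounds.\<close>
  have lt: "cp (E j) < ennreal (2 * (1/4) ^ j)" for j
    by (rule le_less_trans[OF E(3)]) (simp add: ennreal_less_iff)
  have U_open: "open (U j)" for j
    unfolding U_def by (rule cap_superlevel_le(1)[OF dH E(1) lt E(1) lt dc]) simp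
  \<comment> \<open>With q = (1/4)^j the three terms are 2 q, 8 q and 2 q, the bound for
    \<open>E (Suc j)\<close> being four times smaller than that for \<open>E j\<close>.\<close>
  have U_cap: "cp (U j) \<le> ennreal (12 * (1/4) ^ j)" for j
  proof -
    define q :: real where "q = (1/4) ^ j"
    have q: "q \<ge> 0" by (simp add: q_def)
    have "cp (U j) \<le> 2 * (ennreal ((1 / (1/2) ^ j)\<^sup>2) * gag (d j)) + 4 * ennreal (2 * (1/4) ^ j) + 4 * ennreal (2 * (1/4) ^ Suc j)"
      unfolding U_def by (rule cap_superlevel_le(2)[OF dH E(1) lt E(1) lt dc]) simp
    also have "\<dots> \<le> 2 * (ennreal ((1 / (1/2) ^ j)\<^sup>2) * ennreal ((1/16) ^ j)) + 4 * ennreal (2 * (1/4) ^ j) + 4 * ennreal (2 * (1/4) ^ Suc j)"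
      using fast[of j] unfolding d_def y_def by (intro add_right_mono mult_left_mono) auto
    also have "ennreal ((1 / (1/2) ^ j)\<^sup>2) * ennreal ((1/16) ^ j) = ennreal q"
    proof -
      have "(1 / (1/2 :: real) ^ j)\<^sup>2 = 4 ^ j"
        by (simp add: power_one_over power2_eq_square flip: power_mult_distrib)
      then have "(1 / (1/2) ^ j)\<^sup>2 * (1/16) ^ j = (4 * (1/16 :: real)) ^ j"
        by (simp only: power_mult_distrib)
      then show ?thesis by (simp add: ennreal_mult[symmetric] q_def)
    qed
    also have "2 * ennreal q + 4 * ennreal (2 * (1/4) ^ j) + 4 * ennreal (2 * (1/4) ^ Suc j)
      = ennreal (2 * q) + ennreal (4 * (2 * q)) + ennreal (4 * (2 * (q / 4)))"
      unfolding power_Suc q_def[symmetric] using q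
      by (subst (1 2 3) numeral_mult_ennreal) auto
    also have "\<dots> = ennreal (2 * q + 4 * (2 * q) + 4 * (2 * (q / 4)))"
      using q by (subst ennreal_plus, simp, simp, subst ennreal_plus, simp_all)
    finally show ?thesis by (simp add: q_def)
  qed
  have U_sub: "U j \<subseteq> \<Omega>" for j
    using E(2) H0sD(3)[OF dH] by (auto simp: U_def) (metis abs_zero not_less_iff_gr_or_eq zero_less_power zero_less_divide_1_iff zero_less_numeral)
  define T where "T k = (\<Union>i. U (k + i))" for k
  have T_small: "small_open_seq s \<Omega> T"
    unfolding T_def by (rule small_open_seq_tails[OF U_open U_sub U_cap]) simp
  have T_bound: "\<bar>d (k + i) x\<bar> \<le> (1/2) ^ (k + i)" if "x \<notin> T k" for x k i
    using that by (auto simp: T_def U_def not_less)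
  have T_E: "E (k + i) \<subseteq> T k" for k i by (auto simp: T_def U_def)
  define N where "N = (\<Inter>k. T k)"
  have "cp N \<le> cp (T k)" for k by (rule cap_mono) (auto simp: N_def)
  moreover have "(\<lambda>k. cp (T k)) \<longlonglongrightarrow> 0" using T_small by (simp add: small_open_seq_def)
  ultimately have "cp N \<le> 0" by (intro tendsto_lowerbound[OF _ always_eventually]) auto
  then have N0: "cp N = 0" by simp
  have T_open: "open (T k)" for k using T_small by (simp add: small_open_seq_def)
  have [measurable]: "N \<in> sets lebesgue"
  proof -
    have "N \<in> sets borel" unfolding N_def using T_open by (intro sets.countable_INT) auto
    then show ?thesis by simp
  qed
  \<comment> \<open>The value on \<open>N\<close> is immaterial for quasi-continuity because
    \<open>N\<close> is contained in every \<open>T k\<close>; fixing it makes \<open>v'\<close>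
    measurable.\<close>
  define v' where "v' x = (if x \<in> N then 0 else lim (\<lambda>j. y j x))" for x
  \<comment> \<open>Outside \<open>T k\<close> the increments from index k on are at most
    (1/2)^(k+i), so the telescoping series converges uniformly there.\<close>
  have unif: "\<exists>g. uniform_limit (- T k) (\<lambda>n x. y (k + n) x - y k x) g sequentially" for k
  proof -
    have "uniform_limit (- T k) (\<lambda>n x. \<Sum>i<n. d (k + i) x) (\<lambda>x. \<Sum>i. d (k + i) x) sequentially"
    proof (rule Weierstrass_m_test[where M = "\<lambda>i. (1/2) ^ (k + i)"])
      show "summable (\<lambda>i. (1/2 :: real) ^ (k + i))"
        by (simp add: power_add summable_mult summable_geometric)
    qed (use T_bound in auto)
    moreover have "(\<Sum>i<n. d (k + i) x) = y (k + n) x - y k x" for n x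
      using sum_lessThan_telescope[of "\<lambda>i. y (k + i) x" n] by (simp add: d_def)
    ultimately show ?thesis by (simp only:) blast
  qed
  have conv: "(\<lambda>j. y j x) \<longlonglongrightarrow> v' x" if xN: "x \<notin> N" for x
  proof -
    obtain k where "x \<notin> T k" using xN by (auto simp: N_def)
    then have k: "x \<in> - T k" by simp
    obtain g where g: "uniform_limit (- T k) (\<lambda>n x. y (k + n) x - y k x) g sequentially" using unif by blast
    have "(\<lambda>n. y (k + n) x - y k x + y k x) \<longlonglongrightarrow> g x + y k x"
      by (intro tendsto_add tendsto_uniform_limitI[OF g k] tendsto_const)
    then have "(\<lambda>n. y (n + k) x) \<longlonglongrightarrow> g x + y k x" by (simp add: add.commute)
    then have "(\<lambda>n. y n x) \<longlonglongrightarrow> g x + y k x" by (rule LIMSEQ_offset)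
    then show ?thesis using xN by (simp add: v'_def limI)
  qed
  have cont: "continuous_on (- T k) v'" for k
  proof -
    obtain g where g: "uniform_limit (- T k) (\<lambda>n x. y (k + n) x - y k x) g sequentially" using unif by blast
    have cy: "continuous_on (- T k) (y (k + n))" for n
      by (rule continuous_on_subset[OF E(4)]) (use T_E in auto)
    have "continuous_on (- T k) g"
      by (rule uniform_limit_theorem[OF always_eventually g]) (use cy cy[of 0] in \<open>auto intro!: continuous_intros\<close>)
    then have "continuous_on (- T k) (\<lambda>x. g x + y k x)" using cy[of 0] by (auto intro!: continuous_intros)
    moreover have "g x + y k x = v' x" if x: "x \<in> - T k" for x
    proof -
      have "(\<lambda>n. y (k + n) x - y k x) \<longlonglongrightarrow> g x" by (rule tendsto_uniform_limitI[OF g x])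
      moreover have "(\<lambda>n. y (k + n) x) \<longlonglongrightarrow> v' x"
        using LIMSEQ_ignore_initial_segment[OF conv[of x], of k] x by (auto simp: N_def add.commute)
      then have "(\<lambda>n. y (k + n) x - y k x) \<longlonglongrightarrow> v' x - y k x" by (intro tendsto_intros)
      ultimately have "g x = v' x - y k x" by (rule LIMSEQ_unique)
      then show ?thesis by simp
    qed
    ultimately show ?thesis by (rule continuous_on_eq)
  qed
  have qc: "quasi_continuous s \<Omega> v'"
    unfolding quasi_continuous_def using T_small cont by blast
  note [measurable] = H0sD(1)[OF y(1)] H0sD(1)[OF v]
  have v'_meas [measurable]: "v' \<in> borel_measurable lebesgue"
    unfolding v'_def by (intro measurable_If borel_measurable_lim_metric) measurable
  have v'_0: "v' x = 0" if "x \<notin> \<Omega>" for x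
    using H0sD(3)[OF y(1) that] by (simp add: v'_def limI)
  have "AE x in lebesgue. v' x - v x = 0"
  proof (rule l2sq_0_imp_AE)
    have lim': "(\<lambda>j. gag (\<lambda>x. y j x - v x)) \<longlonglongrightarrow> 0"
      using LIMSEQ_subseq_LIMSEQ[OF lim r] by (simp add: y_def o_def)
    have "l2sq lebesgue (\<lambda>x. v' x - v x) \<le> ennreal e" if "e > 0" for e
    proof (rule l2sq_Fatou)
      show "AE x in lebesgue. (\<lambda>j. y j x - v x) \<longlonglongrightarrow> v' x - v x"
        using cap_null_AE[OF N0] by eventually_elim (intro tendsto_intros conv)
      show "\<forall>\<^sub>F j in sequentially. l2sq lebesgue (\<lambda>x. y j x - v x) \<le> ennreal e"
        by (rule tendsto_0_ennrealD[OF l2sq_tendsto_0[OF y(1) v lim'] that])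
    qed measurable
    then show "l2sq lebesgue (\<lambda>x. v' x - v x) = 0"
      using ennreal_le_epsilon[of 0 "l2sq lebesgue (\<lambda>x. v' x - v x)"] by simp
  qed measurable
  then have ae: "AE x in lebesgue. v' x = v x" by eventually_elim simp
  have "AE x in lebesgue. v x = v' x" using ae by eventually_elim simp
  then have v'H: "v' \<in> H0" by (rule H0s_cong_AE[OF v _ v'_meas v'_0])
  have NO: "N \<subseteq> \<Omega>" using U_sub by (fastforce simp: N_def T_def)
  show ?thesis
    by (rule that[of v' N r]) (fact v'H qc ae NO N0 r conv[unfolded y_def])+
qed

text \<open>Test functions are continuous, so \<open>quasi_limit\<close> applies to an approximating
  sequence.\<close>

lemma quasi_continuous_representative:
  assumes u: "u \<in> H0"
  obtains v where "v \<in> H0" "quasi_continuous s \<Omega> v" "AE x in lebesgue. v x = u x"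
proof -
  have "\<exists>\<phi>. \<phi> \<in> test_functions \<Omega> \<and> \<phi> \<in> H0 \<and> Hs_norm_sq s (\<lambda>x. \<phi> x - u x) \<le> ennreal (1 / real (Suc k))" for k
    by (rule H0s_approx[OF u, of "1 / real (Suc k)"]) auto
  then obtain \<phi> where \<phi>: "\<And>k. \<phi> k \<in> test_functions \<Omega>" "\<And>k. \<phi> k \<in> H0"
    "\<And>k. Hs_norm_sq s (\<lambda>x. \<phi> k x - u x) \<le> ennreal (1 / real (Suc k))"
    by metis
  have "gag (\<lambda>x. \<phi> k x - u x) \<le> ennreal (1 / real (Suc k))" for k
    by (rule order_trans[OF _ \<phi>(3)]) (simp add: Hs_norm_sq_eq)
  then have "(\<lambda>k. gag (\<lambda>x. \<phi> k x - u x)) \<longlonglongrightarrow> 0"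
    by (intro tendsto_0_ennreal_le[OF ennreal_inverse_Suc_tendsto, where c = 1]) auto
  then show ?thesis
    by (rule quasi_limit[OF \<phi>(2) quasi_continuous_continuous[OF test_function_D(4)[OF \<phi>(1)]] u]) (rule that)
qed

end

section \<open>Torsion functions\<close>

text \<open>Dyadic shells reduce the integral of a radially bounded kernel to countable sums of ball
  volumes.\<close>

lemma dyadic_shell:
  fixes r :: real assumes "r > 0"
  obtains (small) j :: nat where "2 powr (- real j) / 2 \<le> r" "r \<le> 2 powr (- real j)"
  | (large) j :: nat where "2 powr real j \<le> r" "r \<le> 2 * 2 powr real j"
proof (cases "r \<le> 1")
  case True
  define j where "j = nat \<lfloor>- log 2 r\<rfloor>"
  have "log 2 r \<le> 0" using True assms by simp
  then have j: "real j \<le> - log 2 r" "- log 2 r < real j + 1" by (auto simp: j_def)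
  have "log 2 r \<le> - real j" using j by simp
  then have "r \<le> 2 powr (- real j)" using assms by (simp add: log_le_iff)
  moreover have "- real j - 1 \<le> log 2 r" using j by simp
  then have "2 powr (- real j - 1) \<le> r" using assms by (simp add: le_log_iff)
  then have "2 powr (- real j) / 2 \<le> r" by (simp add: powr_diff)
  ultimately show thesis using small by blast
next
  case False
  define j where "j = nat \<lfloor>log 2 r\<rfloor>"
  have "log 2 r \<ge> 0" using False by simp
  then have j: "real j \<le> log 2 r" "log 2 r < real j + 1" by (auto simp: j_def)
  have "2 powr real j \<le> r" using j assms by (simp add: le_log_iff)
  moreover have "r \<le> 2 powr (real j + 1)" using j assms log_le_iff[of 2 r "real j + 1"] by simp
  then have "r \<le> 2 * 2 powr real j" by (simp add: powr_add)
  ultimately show thesis using large by blast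
qed

lemma emeasure_lebesgue_cball:
  "r \<ge> 0 \<Longrightarrow> emeasure lebesgue (cball (c::'a::euclidean_space) r) = ennreal (unit_ball_vol (real DIM('a)) * r ^ DIM('a))"
  using emeasure_cball[of r c] by simp

lemma suminf_powr_finite:
  assumes "a > 0" "c \<ge> 0"
  shows "(\<Sum>j. ennreal (c * 2 powr (- a * real j))) < top"
proof -
  have eq: "c * 2 powr (- a * real j) = c * (2 powr (- a)) ^ j" for j
    using powr_realpow[of "2 powr (- a)" j] by (simp add: powr_powr)
  have "(2::real) powr (- a) < 1" using assms by (simp add: powr_less_one)
  then have "summable (\<lambda>j. c * (2 powr (- a)) ^ j)"
    by (intro summable_mult summable_geometric) simp
  then have "(\<Sum>j. ennreal (c * (2 powr (- a)) ^ j)) = ennreal (\<Sum>j. c * (2 powr (- a)) ^ j)"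
    using assms by (intro suminf_ennreal2) auto
  then show ?thesis by (simp only: eq) simp
qed

lemma one_minus_cos_le: "1 - cos t \<le> t\<^sup>2" for t :: real
proof -
  have "1 - cos t = 2 * (sin (t / 2))\<^sup>2"
    using cos_double_sin[of "t / 2"] by simp
  also have "\<dots> \<le> 2 * (t / 2)\<^sup>2"
  proof -
    have "\<bar>sin (t / 2)\<bar>\<^sup>2 \<le> \<bar>t / 2\<bar>\<^sup>2" by (rule power_mono[OF abs_sin_x_le_abs_x]) simp
    then show ?thesis by (simp only: power2_abs mult_le_cancel_left_pos zero_less_numeral)
  qed
  also have "\<dots> \<le> t\<^sup>2" by (simp add: power2_eq_square)
  finally show ?thesis .
qed

text \<open>Near 0 the bound 1 - cos t \<le> t^2 makes the j-th shell contribute a multiple of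
  2^(-(2-2s)j), summable since s < 1; far out 1 - cos t \<le> 2 gives a multiple of 2^(-2sj),
  summable since s > 0.\<close>

lemma frac_kernel_integrable:
  fixes b :: "'a::euclidean_space"
  assumes s: "0 < s" "s < 1" and b: "norm b = 1"
  shows "integrable lebesgue (\<lambda>\<zeta>. (1 - cos (\<zeta> \<bullet> b)) / norm \<zeta> powr (real DIM('a) + 2 * s))"
proof -
  define n where "n = DIM('a)"
  define p where "p = real n + 2 * s"
  define V where "V = unit_ball_vol (real n)"
  have V: "V \<ge> 0" by (simp add: V_def)
  define f where "f \<zeta> = (1 - cos (\<zeta> \<bullet> b)) / norm \<zeta> powr p" for \<zeta> :: 'a
  have [measurable]: "f \<in> borel_measurable lebesgue"
    unfolding f_def by (rule lebesgue_measurable_from_borel) measurable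
  have [measurable]: "cball (0::'a) r \<in> sets lebesgue" for r by simp
  have f0: "f \<zeta> \<ge> 0" for \<zeta> by (simp add: f_def)
  define x where "x j = (2::real) powr (- real j)" for j :: nat
  define y where "y j = (2::real) powr (real j)" for j :: nat
  have xy: "x j > 0" "y j > 0" for j by (auto simp: x_def y_def)
  \<comment> \<open>Upper bounds for the kernel on a shell, largest numerator over smallest norm.
    Below they are attached to whole balls instead of shells, which only increases the sum.\<close>
  define \<alpha> where "\<alpha> j = (x j)\<^sup>2 / (x j / 2) powr p" for j
  define \<beta> where "\<beta> j = 2 / y j powr p" for j
  have \<alpha>\<beta>: "\<alpha> j \<ge> 0" "\<beta> j \<ge> 0" for j by (auto simp: \<alpha>_def \<beta>_def)
  define g where "g \<zeta> = (\<Sum>j. ennreal (\<alpha> j) * indicator (cball 0 (x j)) \<zeta>)" for \<zeta> :: 'a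
  define h where "h \<zeta> = (\<Sum>j. ennreal (\<beta> j) * indicator (cball 0 (2 * y j)) \<zeta>)" for \<zeta> :: 'a
  have p: "p > 0" using s by (simp add: p_def add_nonneg_pos)
  have "ennreal (f \<zeta>) \<le> g \<zeta> + h \<zeta>" for \<zeta>
  proof (cases "\<zeta> = 0")
    case True
    then show ?thesis by (simp add: f_def)
  next
    case False
    then have "norm \<zeta> > 0" by simp
    then show ?thesis
    proof (cases rule: dyadic_shell)
      case (small j)
      have "(\<zeta> \<bullet> b)\<^sup>2 \<le> (norm \<zeta>)\<^sup>2"
        using Cauchy_Schwarz_ineq2[of \<zeta> b] b by (simp add: abs_le_square_iff[symmetric])
      then have "1 - cos (\<zeta> \<bullet> b) \<le> (norm \<zeta>)\<^sup>2" using one_minus_cos_le[of "\<zeta> \<bullet> b"] by linarith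
      also have "\<dots> \<le> (x j)\<^sup>2" using small by (intro power_mono) (auto simp: x_def)
      finally have "f \<zeta> \<le> (x j)\<^sup>2 / (x j / 2) powr p"
        unfolding f_def using small xy[of j] p by (intro frac_le powr_mono2) (auto simp: x_def)
      then have "ennreal (f \<zeta>) \<le> ennreal (\<alpha> j) * indicator (cball 0 (x j)) \<zeta>"
        using small by (simp add: \<alpha>_def x_def ennreal_leI)
      also have "\<dots> \<le> g \<zeta>"
        unfolding g_def by (rule ennreal_le_suminf)
      also have "\<dots> \<le> g \<zeta> + h \<zeta>" by simp
      finally show ?thesis .
    next
      case (large j)
      have "1 - cos (\<zeta> \<bullet> b) \<le> 2" using cos_ge_minus_one[of "\<zeta> \<bullet> b"] by linarith
      then have "f \<zeta> \<le> 2 / y j powr p"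
        unfolding f_def using large xy[of j] p by (intro frac_le powr_mono2) (auto simp: y_def)
      then have "ennreal (f \<zeta>) \<le> ennreal (\<beta> j) * indicator (cball 0 (2 * y j)) \<zeta>"
        using large by (simp add: \<beta>_def y_def ennreal_leI)
      also have "\<dots> \<le> h \<zeta>"
        unfolding h_def by (rule ennreal_le_suminf)
      also have "\<dots> \<le> g \<zeta> + h \<zeta>" by simp
      finally show ?thesis .
    qed
  qed
  then have "(\<integral>\<^sup>+ \<zeta>. ennreal (f \<zeta>) \<partial>lebesgue) \<le> (\<integral>\<^sup>+ \<zeta>. g \<zeta> + h \<zeta> \<partial>lebesgue)"
    by (intro nn_integral_mono)
  also have "\<dots> = (\<integral>\<^sup>+ \<zeta>. g \<zeta> \<partial>lebesgue) + (\<integral>\<^sup>+ \<zeta>. h \<zeta> \<partial>lebesgue)"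
    unfolding g_def h_def by (intro nn_integral_add) measurable
  also have "(\<integral>\<^sup>+ \<zeta>. g \<zeta> \<partial>lebesgue) = (\<Sum>j. ennreal (\<alpha> j) * emeasure lebesgue (cball (0::'a) (x j)))"
    unfolding g_def by (subst nn_integral_suminf) (auto simp: nn_integral_cmult)
  also have "\<dots> = (\<Sum>j. ennreal (V * 2 powr p * 2 powr (- (2 - 2 * s) * real j)))"
  proof (intro suminf_cong)
    fix j
    have "\<alpha> j * (V * x j ^ n) = V * (x j powr 2 * x j powr n / (x j / 2) powr p)"
      using xy[of j] by (simp add: \<alpha>_def powr_realpow)
    also have "x j powr 2 * x j powr n / (x j / 2) powr p = 2 powr p * x j powr (2 + n - p)"
      using xy[of j] by (simp add: powr_add powr_diff powr_divide)
    also have "x j powr (2 + n - p) = 2 powr (- (2 - 2 * s) * real j)"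
      by (simp add: x_def p_def powr_powr algebra_simps)
    finally show "ennreal (\<alpha> j) * emeasure lebesgue (cball (0::'a) (x j)) = ennreal (V * 2 powr p * 2 powr (- (2 - 2 * s) * real j))"
      using xy[of j] \<alpha>\<beta> V by (subst emeasure_lebesgue_cball) (auto simp: V_def[symmetric] n_def[symmetric] ennreal_mult[symmetric] mult.assoc)
  qed
  also have "(\<integral>\<^sup>+ \<zeta>. h \<zeta> \<partial>lebesgue) = (\<Sum>j. ennreal (\<beta> j) * emeasure lebesgue (cball (0::'a) (2 * y j)))"
    unfolding h_def by (subst nn_integral_suminf) (auto simp: nn_integral_cmult)
  also have "\<dots> = (\<Sum>j. ennreal (V * 2 * 2 ^ n * 2 powr (- (2 * s) * real j)))"
  proof (intro suminf_cong)
    fix j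
    have "\<beta> j * (V * (2 * y j) ^ n) = V * 2 * 2 ^ n * (y j powr n / y j powr p)"
      using xy[of j] by (simp add: \<beta>_def powr_realpow power_mult_distrib)
    also have "y j powr n / y j powr p = y j powr (n - p)"
      by (simp add: powr_diff)
    also have "y j powr (n - p) = 2 powr (- (2 * s) * real j)"
      by (simp add: y_def p_def powr_powr algebra_simps)
    finally show "ennreal (\<beta> j) * emeasure lebesgue (cball (0::'a) (2 * y j)) = ennreal (V * 2 * 2 ^ n * 2 powr (- (2 * s) * real j))"
      using xy[of j] \<alpha>\<beta> V by (subst emeasure_lebesgue_cball) (auto simp: V_def[symmetric] n_def[symmetric] ennreal_mult[symmetric] mult.assoc)
  qed
  also have "(\<Sum>j. ennreal (V * 2 powr p * 2 powr (- (2 - 2 * s) * real j))) + (\<Sum>j. ennreal (V * 2 * 2 ^ n * 2 powr (- (2 * s) * real j))) < top"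
    using V s by (simp only: ennreal_add_less_top) (intro conjI suminf_powr_finite, auto)
  finally have "(\<integral>\<^sup>+ \<zeta>. ennreal (f \<zeta>) \<partial>lebesgue) < \<infinity>" by simp
  then have "integrable lebesgue f"
    using f0 by (intro integrableI_nonneg) auto
  then show ?thesis unfolding f_def[abs_def] p_def n_def .
qed

text \<open>Integrability matters as much as positivity: the integral of a non-integrable function
  is 0 by convention and so is \<open>inverse 0\<close>, which would make the torsion equation
  degenerate.\<close>

lemma frac_const_pos:
  assumes s: "0 < s" "s < 1"
  shows "frac_const TYPE('a::euclidean_space) s > 0"
proof -
  define b :: 'a where "b = (SOME b. b \<in> Basis)"
  have "b \<in> Basis" unfolding b_def using nonempty_Basis by (simp add: some_in_eq)
  then have b: "norm b = 1" by simp
  define f where "f \<zeta> = (1 - cos (\<zeta> \<bullet> b)) / norm \<zeta> powr (real DIM('a) + 2 * s)" for \<zeta> :: 'a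
  have int: "integrable lebesgue f"
    unfolding f_def by (rule frac_kernel_integrable[OF s b])
  have f0: "f \<zeta> \<ge> 0" for \<zeta> by (simp add: f_def)
  have "integral\<^sup>L lebesgue f \<noteq> 0"
  proof
    assume "integral\<^sup>L lebesgue f = 0"
    then have ae: "AE \<zeta> in lebesgue. f \<zeta> = 0"
      using integral_nonneg_eq_0_iff_AE[OF int] f0 by simp
    \<comment> \<open>On this ball the inner product with \<open>b\<close> lies between 1/2 and 3/2,
      inside (0, pi), where the cosine is below 1.\<close>
    have "f \<zeta> \<noteq> 0" if "\<zeta> \<in> ball b (1/2)" for \<zeta>
    proof -
      have "\<bar>(\<zeta> - b) \<bullet> b\<bar> \<le> norm (\<zeta> - b)" using Cauchy_Schwarz_ineq2[of "\<zeta> - b" b] b by simp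
      moreover have "norm (\<zeta> - b) < 1/2" using that by (simp add: dist_norm norm_minus_commute)
      moreover have "(\<zeta> - b) \<bullet> b = \<zeta> \<bullet> b - 1" using b by (simp add: inner_diff_left norm_eq_1)
      ultimately have z: "1/2 < \<zeta> \<bullet> b" "\<zeta> \<bullet> b < 3/2" by linarith+
      then have "cos (\<zeta> \<bullet> b) < cos 0" using pi_gt3 by (intro cos_monotone_0_pi) auto
      moreover have "\<zeta> \<noteq> 0" using z by auto
      ultimately show ?thesis by (simp add: f_def)
    qed
    then have "AE \<zeta> in lebesgue. \<zeta> \<notin> ball b (1/2)" using ae by (auto elim: eventually_mono)
    then have "ball b (1/2) \<in> null_sets lebesgue" by (subst AE_iff_null_sets) auto
    then have "measure lebesgue (ball b (1/2)) = 0" by (rule measure_eq_0_null_sets)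
    then show False using content_ball_pos[of "1/2" b] by simp
  qed
  moreover have "integral\<^sup>L lebesgue f \<ge> 0" using f0 by simp
  ultimately have "integral\<^sup>L lebesgue f > 0" by simp
  then show ?thesis unfolding frac_const_def f_def[abs_def] b_def by simp
qed

section \<open>Functions vanishing q.e. outside a set, and the torsion problem\<close>

context bounded_domain
begin

lemma holds_qe_combine:
  assumes "holds_qe s \<Omega> S P" "holds_qe s \<Omega> S Q" "\<And>x. P x \<Longrightarrow> Q x \<Longrightarrow> R x"
  shows "holds_qe s \<Omega> S R"
proof -
  obtain N M where "N \<subseteq> \<Omega>" "cp N = 0" "\<forall>x\<in>S - N. P x" "M \<subseteq> \<Omega>" "cp M = 0" "\<forall>x\<in>S - M. Q x"
    using assms(1,2) unfolding holds_qe_def by blast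
  then have "N \<union> M \<subseteq> \<Omega>" "cp (N \<union> M) = 0" "\<forall>x\<in>S - (N \<union> M). R x"
    using assms(3) cap_null_Un by auto
  then show ?thesis unfolding holds_qe_def by blast
qed

abbreviation H0_on :: "'a set \<Rightarrow> ('a \<Rightarrow> real) set" where
  "H0_on A \<equiv> H0s_on s \<Omega> A"

lemma H0_onD:
  assumes "u \<in> H0_on A"
  shows "u \<in> H0" "quasi_continuous s \<Omega> u" "holds_qe s \<Omega> (- A) (\<lambda>x. u x = 0)"
  using assms by (auto simp: H0s_on_def)

lemma H0_on_zero: "(\<lambda>x. 0) \<in> H0_on A"
  by (auto simp: H0s_on_def holds_qe_def intro!: quasi_continuous_continuous exI[of _ "{}"])

lemma H0_on_add:
  assumes "u \<in> H0_on A" "v \<in> H0_on A"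
  shows "(\<lambda>x. u x + v x) \<in> H0_on A"
  using H0s_add[OF H0_onD(1)[OF assms(1)] H0_onD(1)[OF assms(2)]]
    quasi_continuous_add[OF H0_onD(2)[OF assms(1)] H0_onD(2)[OF assms(2)]]
    holds_qe_combine[OF H0_onD(3)[OF assms(1)] H0_onD(3)[OF assms(2)], of "\<lambda>x. u x + v x = 0"]
  by (auto simp: H0s_on_def)

lemma H0_on_cmult:
  assumes "u \<in> H0_on A"
  shows "(\<lambda>x. c * u x) \<in> H0_on A"
  using H0s_cmult[OF H0_onD(1)[OF assms(1)]]
    quasi_continuous_cmult[OF H0_onD(2)[OF assms(1)]]
    holds_qe_combine[OF H0_onD(3)[OF assms(1)] H0_onD(3)[OF assms(1)], of "\<lambda>x. c * u x = 0"]
  by (auto simp: H0s_on_def)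

lemma H0_on_AE_zero:
  assumes "u \<in> H0_on A"
  shows "AE x in lebesgue. x \<notin> A \<longrightarrow> u x = 0"
proof -
  obtain N where "N \<subseteq> \<Omega>" "cp N = 0" "\<forall>x\<in>- A - N. u x = 0"
    using H0_onD(3)[OF assms] unfolding holds_qe_def by blast
  then show ?thesis using cap_null_AE[of N] by (auto elim: eventually_mono)
qed

text \<open>Off a countable union of sets of zero capacity, a subsequence converges pointwise and
  all its members vanish outside \<open>A\<close>; hence so does the limit.\<close>

lemma H0_on_limit:
  assumes w: "\<And>j. w j \<in> H0_on A" and v: "v \<in> H0" and lim: "(\<lambda>j. gag (\<lambda>x. w j x - v x)) \<longlonglongrightarrow> 0"
  obtains v' where "v' \<in> H0_on A" "AE x in lebesgue. v' x = v x"
proof -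
  obtain v' N r where v': "v' \<in> H0" "quasi_continuous s \<Omega> v'" "AE x in lebesgue. v' x = v x"
    and N: "N \<subseteq> \<Omega>" "cp N = 0" and r: "strict_mono r" and conv: "\<And>x. x \<notin> N \<Longrightarrow> (\<lambda>j. w (r j) x) \<longlonglongrightarrow> v' x"
    by (rule quasi_limit[OF H0_onD(1)[OF w] H0_onD(2)[OF w] v lim]) blast
  have "\<exists>N\<subseteq>\<Omega>. cp N = 0 \<and> (\<forall>x\<in>- A - N. w j x = 0)" for j
    using H0_onD(3)[OF w] unfolding holds_qe_def by blast
  then obtain M where M: "\<And>j. M j \<subseteq> \<Omega>" "\<And>j. cp (M j) = 0" "\<And>j x. x \<notin> A \<Longrightarrow> x \<notin> M j \<Longrightarrow> w j x = 0"
    by (metis ComplI DiffI)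
  define L where "L = N \<union> (\<Union>j. M j)"
  have "cp L = 0" unfolding L_def by (intro cap_null_Un cap_null_UN M N)
  moreover have "L \<subseteq> \<Omega>" using M N by (auto simp: L_def)
  moreover have "v' x = 0" if x: "x \<notin> A" "x \<notin> L" for x
  proof -
    have "(\<lambda>j. w (r j) x) \<longlonglongrightarrow> v' x" using x by (intro conv) (auto simp: L_def)
    moreover have "w j x = 0" for j using x M(3) by (auto simp: L_def)
    ultimately show ?thesis by (simp add: LIMSEQ_const_iff)
  qed
  ultimately have "holds_qe s \<Omega> (- A) (\<lambda>x. v' x = 0)" unfolding holds_qe_def by blast
  then show ?thesis using that v' by (auto simp: H0s_on_def)
qed

text \<open>The bilinear form of the torsion problem without the factor c(n,s)/2, so that
  \<open>energy\<close> is its quadratic form on \<open>H0\<close>.\<close>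

definition inner_Hs :: "('a \<Rightarrow> real) \<Rightarrow> ('a \<Rightarrow> real) \<Rightarrow> real" where
  "inner_Hs u v = (LINT z|lebesgue. diffq s u z * diffq s v z)"

lemma inner_Hs_integrable:
  "u \<in> H0 \<Longrightarrow> v \<in> H0 \<Longrightarrow> integrable lebesgue (\<lambda>z. diffq s u z * diffq s v z)"
  by (intro l2_mult_integrable) (auto dest: H0sD simp: gagliardo_sq_eq[symmetric])

lemma inner_Hs_add_right:
  "u \<in> H0 \<Longrightarrow> v \<in> H0 \<Longrightarrow> w \<in> H0 \<Longrightarrow> inner_Hs u (\<lambda>x. v x + w x) = inner_Hs u v + inner_Hs u w"
  unfolding inner_Hs_def diffq_add distrib_left by (intro Bochner_Integration.integral_add inner_Hs_integrable)

lemma inner_Hs_cmult_right: "inner_Hs u (\<lambda>x. c * v x) = c * inner_Hs u v"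
  unfolding inner_Hs_def diffq_cmult by (simp add: mult.left_commute[of _ c])

lemma inner_Hs_cmult_left: "inner_Hs (\<lambda>x. c * u x) v = c * inner_Hs u v"
  unfolding inner_Hs_def diffq_cmult by (simp add: mult.assoc)

lemma inner_Hs_commute: "inner_Hs u v = inner_Hs v u"
  unfolding inner_Hs_def by (simp add: mult.commute)

lemma inner_Hs_self: "u \<in> H0 \<Longrightarrow> inner_Hs u u = energy u"
  unfolding inner_Hs_def energy_def gagliardo_sq_eq
  by (rule l2sq_eq_integral[symmetric]) (auto dest: H0sD simp: gagliardo_sq_eq[symmetric])

lemma energy_add:
  assumes "u \<in> H0" "v \<in> H0"
  shows "energy (\<lambda>x. u x + v x) = energy u + 2 * inner_Hs u v + energy v"
proof -
  have "energy (\<lambda>x. u x + v x) = inner_Hs (\<lambda>x. u x + v x) (\<lambda>x. u x + v x)"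
    by (rule inner_Hs_self[symmetric]) (rule H0s_add[OF assms])
  also have "\<dots> = inner_Hs (\<lambda>x. u x + v x) u + inner_Hs (\<lambda>x. u x + v x) v"
    by (intro inner_Hs_add_right H0s_add assms)
  also have "\<dots> = inner_Hs u (\<lambda>x. u x + v x) + inner_Hs v (\<lambda>x. u x + v x)"
    by (simp only: inner_Hs_commute)
  also have "\<dots> = energy u + 2 * inner_Hs u v + energy v"
    using assms inner_Hs_commute[of v u] by (simp add: inner_Hs_add_right inner_Hs_self)
  finally show ?thesis .
qed

lemma bounded_enclosing_ball:
  obtains B where "B \<in> sets lebesgue" "\<Omega> \<subseteq> B" "emeasure lebesgue B < \<infinity>" "measure lebesgue B > 0"
proof -
  obtain R where R: "\<Omega> \<subseteq> ball 0 R"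
    using bounded_domain bounded_subset_ballD[of \<Omega> 0] by blast
  define r where "r = max R 1"
  have "\<Omega> \<subseteq> cball 0 r" using R ball_subset_cball[of 0 r] by (auto simp: r_def)
  moreover have "measure lebesgue (cball (0::'a) r) > 0" by (simp add: r_def content_cball_pos)
  moreover have "emeasure lebesgue (cball (0::'a) r) < \<infinity>"
    using emeasure_lebesgue_cball[of r "0::'a"] by (simp add: r_def)
  ultimately show thesis by (intro that[of "cball 0 r"]) auto
qed

abbreviation integ :: "('a \<Rightarrow> real) \<Rightarrow> real" where
  "integ u \<equiv> (LINT x|lebesgue. u x)"

text \<open>Cauchy-Schwarz against the indicator of an enclosing ball, followed by the Poincare
  inequality. It makes the linear functional \<open>integ\<close> continuous for the energy.\<close>

lemma integ_bound:
  obtains C where "C > 0" "\<And>u. u \<in> H0 \<Longrightarrow> integrable lebesgue u" "\<And>u. u \<in> H0 \<Longrightarrow> (integ u)\<^sup>2 \<le> C * energy u"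
proof -
  obtain B where B [measurable]: "B \<in> sets lebesgue" and OB: "\<Omega> \<subseteq> B"
    and fin: "emeasure lebesgue B < \<infinity>" and pos: "measure lebesgue B > 0"
    using bounded_enclosing_ball .
  define m where "m = measure lebesgue B"
  have iB: "integrable lebesgue (indicator B :: 'a \<Rightarrow> real)" using fin by (simp add: integrable_indicator_iff)
  have l2B: "l2sq lebesgue (indicator B :: 'a \<Rightarrow> real) < \<infinity>"
  proof -
    have "l2sq lebesgue (indicator B) = (\<integral>\<^sup>+x. indicator B x \<partial>lebesgue)"
      unfolding l2sq_def by (rule nn_integral_cong) (simp add: indicator_def)
    then show ?thesis using fin by simp
  qed
  have uB: "(\<lambda>x. u x * indicator B x) = u" if "u \<in> H0" for u
    using H0sD(3)[OF that] OB by (auto simp: fun_eq_iff indicator_def)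
  have int: "integrable lebesgue u" if u: "u \<in> H0" for u
    using l2_mult_integrable[OF H0sD(1)[OF u] _ H0sD(5)[OF u] l2B] uB[OF u] by simp
  have "(integ u)\<^sup>2 \<le> (m * poincare_const) * energy u" if u: "u \<in> H0" for u
  proof -
    define L where "L = (LINT x|lebesgue. u x * u x)"
    \<comment> \<open>The mean over \<open>B\<close>, which minimizes the integral of (u - t)^2 over
      \<open>B\<close>.\<close>
    define t where "t = integ u / m"
    have i1: "integrable lebesgue (\<lambda>x. u x * u x)"
      by (intro l2_mult_integrable H0sD[OF u])
    have "0 \<le> (LINT x|lebesgue. (u x - t * indicator B x)\<^sup>2)" by simp
    also have "(\<lambda>x. (u x - t * indicator B x)\<^sup>2) = (\<lambda>x. u x * u x - (2 * t) * u x + t\<^sup>2 * indicator B x)"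
    proof
      fix x
      have "u x * indicator B x = u x" using uB[OF u] by (metis)
      then have a: "u x * (t * indicator B x) = t * u x" by (metis mult.left_commute)
      have b: "(indicator B x)\<^sup>2 = (indicator B x :: real)" by (simp add: indicator_def)
      show "(u x - t * indicator B x)\<^sup>2 = u x * u x - (2 * t) * u x + t\<^sup>2 * indicator B x"
        using a by (simp add: power2_diff power_mult_distrib b power2_eq_square[of "u x"])
    qed
    also have "(LINT x|lebesgue. u x * u x - (2 * t) * u x + t\<^sup>2 * indicator B x) = L - (2 * t) * integ u + t\<^sup>2 * m"
      using i1 int[OF u] iB by (simp add: L_def m_def)
    also have "\<dots> = L - (integ u)\<^sup>2 / m"
      using pos by (simp add: t_def m_def power2_eq_square field_simps)
    finally have "(integ u)\<^sup>2 \<le> m * L" using pos by (simp add: m_def field_simps)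
    also have "L \<le> poincare_const * energy u"
    proof -
      have "l2sq lebesgue u = ennreal L"
        using l2sq_eq_integral[OF H0sD(1)[OF u] H0sD(5)[OF u]] H0sD(5)[OF u] unfolding L_def
        by (metis ennreal_enn2real infinity_ennreal_def)
      then have "ennreal L \<le> ennreal (poincare_const * energy u)"
        using Poincare[OF u] poincare_const(1) by (simp add: gag_energy[OF u] ennreal_mult)
      then show ?thesis using poincare_const(1) by (subst (asm) ennreal_le_iff) auto
    qed
    finally show ?thesis using pos by (simp add: m_def mult.assoc)
  qed
  moreover have "m * poincare_const > 0" using pos poincare_const(1) by (simp add: m_def)
  ultimately show thesis using that int by blast
qed

lemma torsion_solution_iff:
  "torsion_solution s \<Omega> A u \<longleftrightarrow> u \<in> H0_on A \<and>
     (\<forall>\<phi>\<in>H0_on A. frac_const TYPE('a) s / 2 * inner_Hs u \<phi> = integ \<phi>)"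
proof -
  have "(LINT x:\<Omega>|lebesgue. \<phi> x) = integ \<phi>" if "\<phi> \<in> H0_on A" for \<phi>
    unfolding set_lebesgue_integral_def using H0sD(3)[OF H0_onD(1)[OF that]]
    by (intro Bochner_Integration.integral_cong) (auto simp: indicator_def)
  then show ?thesis
    unfolding torsion_solution_def inner_Hs_def diffq_mult by auto
qed

text \<open>Up to scaling, the torsion function minimizes the energy among the functions of integral 1.\<close>

lemma torsion_solution_exists:
  assumes s: "0 < s" "s < 1"
  shows "\<exists>u. torsion_solution s \<Omega> A u"
proof (cases "\<forall>\<phi>\<in>H0_on A. integ \<phi> = 0")
  \<comment> \<open>The constraint set of the minimization would be empty, but then the right side
    of the equation vanishes and 0 is a solution.\<close>
  case True
  then have "torsion_solution s \<Omega> A (\<lambda>x. 0)"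
    unfolding torsion_solution_iff by (auto simp: H0_on_zero inner_Hs_def diffq_zero)
  then show ?thesis by blast
next
  case False
  then obtain \<phi>0 where \<phi>0: "\<phi>0 \<in> H0_on A" "integ \<phi>0 \<noteq> 0" by blast
  obtain C where C: "C > 0" and int: "\<And>u. u \<in> H0 \<Longrightarrow> integrable lebesgue u"
    and CI: "\<And>u. u \<in> H0 \<Longrightarrow> (integ u)\<^sup>2 \<le> C * energy u"
    using integ_bound by metis
  define S where "S = {u \<in> H0_on A. integ u = 1}"
  have SK: "u \<in> H0_on A" "u \<in> H0" "integ u = 1" if "u \<in> S" for u using that H0_onD(1) by (auto simp: S_def)
  have f0: "(\<lambda>x. (1 / integ \<phi>0) * \<phi>0 x) \<in> S"
    using \<phi>0 H0_on_cmult[OF \<phi>0(1), of "1 / integ \<phi>0"] by (simp add: S_def)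
  have mid: "(\<lambda>x. (u x + v x) / 2) \<in> S" if "u \<in> S" "v \<in> S" for u v
  proof -
    have "(\<lambda>x. (1/2) * (u x + v x)) \<in> H0_on A" by (intro H0_on_cmult H0_on_add SK that)
    moreover have "integ (\<lambda>x. (u x + v x) / 2) = 1"
      using int[OF SK(2)[OF that(1)]] int[OF SK(2)[OF that(2)]] SK(3)[OF that(1)] SK(3)[OF that(2)] by simp
    ultimately show ?thesis by (simp add: S_def)
  qed
  obtain w where w: "\<And>n. w n \<in> S" "energy_Cauchy w" "\<And>n u. u \<in> S \<Longrightarrow> energy (w n) \<le> energy u + 1 / real (Suc n)"
  proof (rule minimizing_sequence[of "\<lambda>_. S" "energy (\<lambda>x. (1 / integ \<phi>0) * \<phi>0 x)"])
    show "S \<subseteq> H0" using SK by blast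
    show "S \<noteq> {}" using f0 by blast
    show "\<exists>u\<in>S. energy u \<le> energy (\<lambda>x. (1 / integ \<phi>0) * \<phi>0 x)" using f0 by blast
  qed (use mid in auto)
  have wH: "w n \<in> H0" "w n \<in> H0_on A" for n using SK w(1) by auto
  obtain v where v: "v \<in> H0" "(\<lambda>j. gag (\<lambda>x. w j x - v x)) \<longlonglongrightarrow> 0"
    using H0s_complete[of w] wH(1) w(2) by blast
  obtain v' where v': "v' \<in> H0_on A" "AE x in lebesgue. v' x = v x"
    using H0_on_limit[OF wH(2) v] by blast
  have v'H: "v' \<in> H0" using v'(1) by (rule H0_onD)
  have eq: "energy v' = energy v" unfolding energy_def using gagliardo_cong_AE[OF v'(2)] by metis
  have "integ v' = integ v"
    by (rule integral_cong_AE) (use v'(2) v(1) v'H in \<open>auto dest: H0sD\<close>)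
  also have "integ v = 1"
  proof -
    \<comment> \<open>The constraint survives the limit because \<open>integ\<close> is continuous
      for the energy.\<close>
    have "(1 - integ v)\<^sup>2 \<le> 0 + e" if e: "e > 0" for e
    proof -
      have "e / C > 0" using e C by simp
      from tendsto_0_ennrealD[OF v(2) this] obtain j where j: "gag (\<lambda>x. w j x - v x) \<le> ennreal (e / C)"
        by (auto simp: eventually_sequentially)
      have d: "(\<lambda>x. w j x - v x) \<in> H0" by (intro H0s_diff wH v)
      have "integ (\<lambda>x. w j x - v x) = 1 - integ v"
        using int[OF wH(1)] int[OF v(1)] SK(3)[OF w(1)] by simp
      then have "(1 - integ v)\<^sup>2 \<le> C * energy (\<lambda>x. w j x - v x)" using CI[OF d] by simp
      also have "energy (\<lambda>x. w j x - v x) \<le> e / C" using j energy_le_iff[OF d, of "e / C"] \<open>e / C > 0\<close> by simp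
      finally show ?thesis using C by simp
    qed
    then have "(1 - integ v)\<^sup>2 \<le> 0" by (rule field_le_epsilon)
    then show ?thesis by simp
  qed
  finally have v'S: "v' \<in> S" using v'(1) by (simp add: S_def)
  have min: "energy v' \<le> energy u" if u: "u \<in> S" for u
  proof (rule field_le_epsilon)
    fix e :: real assume e: "e > 0"
    have "eventually (\<lambda>n. 1 / real (Suc n) < e) sequentially"
      using order_tendstoD(2)[OF LIMSEQ_Suc[OF lim_1_over_n] e] .
    then have "eventually (\<lambda>n. gag (w n) \<le> ennreal (energy u + e)) sequentially"
    proof eventually_elim
      case (elim n)
      then have "energy (w n) \<le> energy u + e" using w(3)[OF u, of n] by linarith
      then show ?case using energy_le_iff[OF wH(1), of "energy u + e" n] e by simp
    qed
    then have "gag v \<le> ennreal (energy u + e)"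
      using e by (intro gag_limit_le[OF wH(1) v]) auto
    then show "energy v' \<le> energy u + e" using energy_le_iff[OF v(1), of "energy u + e"] e eq by simp
  qed
  \<comment> \<open>First variation: adding multiples of a \<phi> with zero integral stays in the
    constraint set. The denominator E + 1 in \<open>t\<close>, instead of E, avoids division by zero
    and still makes the change of energy negative.\<close>
  have orth: "inner_Hs v' \<phi> = 0" if \<phi>: "\<phi> \<in> H0_on A" "integ \<phi> = 0" for \<phi>
  proof (rule ccontr)
    define b where "b = inner_Hs v' \<phi>"
    define E where "E = energy \<phi>"
    define t where "t = - b / (E + 1)"
    assume "inner_Hs v' \<phi> \<noteq> 0"
    then have b: "b\<^sup>2 > 0" by (simp add: b_def)
    have E: "E \<ge> 0" by (simp add: E_def)
    have \<phi>H: "\<phi> \<in> H0" using \<phi>(1) by (rule H0_onD)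
    have "(\<lambda>x. v' x + t * \<phi> x) \<in> S"
      using H0_on_add[OF v'(1) H0_on_cmult[OF \<phi>(1), of t]] SK(3)[OF v'S] int[OF v'H] int[OF \<phi>H] \<phi>(2)
      by (simp add: S_def)
    then have "energy v' \<le> energy (\<lambda>x. v' x + t * \<phi> x)" by (rule min)
    also have "\<dots> = energy v' + 2 * (t * b) + t\<^sup>2 * E"
      using energy_add[OF v'H H0s_cmult[OF \<phi>H, of t]] by (simp add: inner_Hs_cmult_right energy_cmult[OF \<phi>H] b_def E_def)
    finally have "0 \<le> 2 * (t * b) + t\<^sup>2 * E" by simp
    also have "\<dots> = - (b\<^sup>2 * (E + 2)) / (E + 1)\<^sup>2"
      using E unfolding t_def by (simp add: divide_simps power2_eq_square) (simp add: algebra_simps)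
    also have "\<dots> < 0" using b E by (intro divide_neg_pos) auto
    finally show False by simp
  qed
  define E0 where "E0 = energy v'"
  have "1 \<le> C * E0" using CI[OF v'H] SK(3)[OF v'S] by (simp add: E0_def)
  then have "0 < C * E0" by linarith
  then have E0: "E0 > 0" using C by (rule zero_less_mult_pos)
  define c where "c = frac_const TYPE('a) s"
  have c: "c > 0" unfolding c_def by (rule frac_const_pos[OF s])
  \<comment> \<open>Chosen so that c/2 times \<tau> times the energy of \<open>v'\<close> is
    1.\<close>
  define \<tau> where "\<tau> = 2 / (c * E0)"
  have "torsion_solution s \<Omega> A (\<lambda>x. \<tau> * v' x)"
    unfolding torsion_solution_iff c_def[symmetric]
  proof (intro conjI ballI)
    show "(\<lambda>x. \<tau> * v' x) \<in> H0_on A" by (rule H0_on_cmult[OF v'(1)])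
    fix \<phi> assume \<phi>: "\<phi> \<in> H0_on A"
    then have \<phi>H: "\<phi> \<in> H0" by (rule H0_onD)
    \<comment> \<open>Subtracting the multiple of \<open>v'\<close> with the same integral leaves a
      direction covered by \<open>orth\<close>.\<close>
    define \<psi> where "\<psi> x = \<phi> x + (- integ \<phi>) * v' x" for x
    have "\<psi> \<in> H0_on A" unfolding \<psi>_def by (intro H0_on_add H0_on_cmult \<phi> v')
    moreover have "integ \<psi> = 0"
      unfolding \<psi>_def using int[OF v'H] int[OF \<phi>H] SK(3)[OF v'S] by simp
    ultimately have "inner_Hs v' \<psi> = 0" by (rule orth)
    then have "inner_Hs v' \<phi> = integ \<phi> * E0"
      unfolding \<psi>_def E0_def
      by (subst (asm) inner_Hs_add_right[OF v'H \<phi>H H0s_cmult[OF v'H]]) (simp add: inner_Hs_cmult_right[of _ "- integ \<phi>", simplified] inner_Hs_self[OF v'H])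
    then show "c / 2 * inner_Hs (\<lambda>x. \<tau> * v' x) \<phi> = integ \<phi>"
      unfolding inner_Hs_cmult_left using c E0 by (simp add: \<tau>_def)
  qed
  then show ?thesis by blast
qed

text \<open>With the solution as its own test function, the squared equation is quadratic in the
  energy on the left, while \<open>integ_bound\<close> makes the right side linear in it. The
  constant of \<open>integ_bound\<close> does not involve \<open>A\<close>, so the bound is
  uniform.\<close>

lemma torsion_energy_bound:
  assumes s: "0 < s" "s < 1"
  obtains M where "M \<ge> 0" "\<And>A u. torsion_solution s \<Omega> A u \<Longrightarrow> gag u \<le> ennreal M"
proof -
  obtain C where C: "C > 0" and CI: "\<And>u. u \<in> H0 \<Longrightarrow> (integ u)\<^sup>2 \<le> C * energy u"
    using integ_bound by metis
  define c where "c = frac_const TYPE('a) s"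
  have c: "c > 0" unfolding c_def by (rule frac_const_pos[OF s])
  have "gag u \<le> ennreal (4 * C / c\<^sup>2)" if "torsion_solution s \<Omega> A u" for A u
  proof -
    have u: "u \<in> H0_on A" "c / 2 * inner_Hs u u = integ u"
      using that unfolding torsion_solution_iff c_def by auto
    have uH: "u \<in> H0" using u(1) by (rule H0_onD)
    define E where "E = energy u"
    have "(c / 2 * E)\<^sup>2 \<le> C * E" using CI[OF uH] u(2) by (simp add: inner_Hs_self[OF uH] E_def)
    then have le: "(c\<^sup>2 * E) * E \<le> (4 * C) * E" by (simp add: power2_eq_square field_simps)
    have "E \<le> 4 * C / c\<^sup>2"
    proof (cases "E = 0")
      case False
      then have "E > 0" by (simp add: E_def less_le)
      with le have "c\<^sup>2 * E \<le> 4 * C" by (rule mult_right_le_imp_le)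
      then show ?thesis using c by (simp add: field_simps)
    qed (use C c in simp)
    then show ?thesis using C c energy_le_iff[OF uH] by (simp add: E_def)
  qed
  then show thesis using that[of "4 * C / c\<^sup>2"] C by auto
qed

end

section \<open>Compactness\<close>

text \<open>For N > 0 the label of the half-open cube of side 1/N containing x, coded as a vector
  with integer coordinates; the cells are the fibres of this map.\<close>

definition grid_cell :: "real \<Rightarrow> 'a::euclidean_space \<Rightarrow> 'a" where
  "grid_cell N x = (\<Sum>b\<in>Basis. of_int \<lfloor>N * (x \<bullet> b)\<rfloor> *\<^sub>R b)"

lemma grid_cell_inner: "b \<in> Basis \<Longrightarrow> grid_cell N x \<bullet> b = of_int \<lfloor>N * (x \<bullet> b)\<rfloor>"
  by (simp add: grid_cell_def inner_sum_left inner_Basis if_distrib[of "\<lambda>t. _ * t"] cong: if_cong)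

lemma grid_cell_measurable [measurable]: "grid_cell N \<in> borel_measurable borel"
  unfolding grid_cell_def by measurable

lemma grid_cell_diam:
  fixes x y :: "'a::euclidean_space"
  assumes "N > 0" "grid_cell N x = grid_cell N y"
  shows "norm (x - y) \<le> real DIM('a) / N"
proof -
  have "\<bar>(x - y) \<bullet> b\<bar> \<le> 1 / N" if b: "b \<in> Basis" for b
  proof -
    have "of_int \<lfloor>N * (x \<bullet> b)\<rfloor> = (of_int \<lfloor>N * (y \<bullet> b)\<rfloor> :: real)"
      using grid_cell_inner[OF b, of N x] grid_cell_inner[OF b, of N y] assms(2) by simp
    then have "\<bar>N * (x \<bullet> b) - N * (y \<bullet> b)\<bar> \<le> 1" by linarith
    then have "\<bar>N * ((x - y) \<bullet> b)\<bar> \<le> 1" by (simp add: inner_diff_left right_diff_distrib)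
    then show ?thesis using assms(1) by (simp add: abs_mult field_simps)
  qed
  then have "(\<Sum>b\<in>Basis. \<bar>(x - y) \<bullet> b\<bar>) \<le> real DIM('a) * (1 / N)"
    by (intro sum_bounded_above) auto
  then show ?thesis using norm_le_l1[of "x - y"] by simp
qed

lemma grid_cell_finite:
  fixes \<Omega> :: "'a::euclidean_space set"
  assumes "bounded \<Omega>" "N > 0"
  shows "finite (grid_cell N ` \<Omega>)"
proof -
  obtain R where R: "\<And>x. x \<in> \<Omega> \<Longrightarrow> norm x \<le> R" using assms(1) bounded_iff by metis
  define M where "M = \<lceil>N * R\<rceil> + 1"
  define P where "P = (Basis :: 'a set) \<rightarrow>\<^sub>E {- M..M}"
  have "finite P" unfolding P_def by (intro finite_PiE) auto
  moreover have "grid_cell N ` \<Omega> \<subseteq> (\<lambda>f. \<Sum>b\<in>Basis. of_int (f b) *\<^sub>R b) ` P"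
  proof (rule image_subsetI)
    fix x assume x: "x \<in> \<Omega>"
    define f where "f = restrict (\<lambda>b. \<lfloor>N * (x \<bullet> b)\<rfloor>) (Basis :: 'a set)"
    have "\<lfloor>N * (x \<bullet> b)\<rfloor> \<in> {- M..M}" if b: "b \<in> Basis" for b
    proof -
      have "\<bar>x \<bullet> b\<bar> \<le> R" using Basis_le_norm[OF b, of x] R[OF x] by linarith
      then have "\<bar>N * (x \<bullet> b)\<bar> \<le> N * R" using assms(2) by (simp add: abs_mult)
      then show ?thesis unfolding M_def by (auto simp: le_floor_iff floor_le_iff) linarith+
    qed
    then have "f \<in> P" by (auto simp: f_def P_def)
    moreover have "grid_cell N x = (\<Sum>b\<in>Basis. of_int (f b) *\<^sub>R b)"
      unfolding grid_cell_def f_def by (intro sum.cong) auto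
    ultimately show "grid_cell N x \<in> (\<lambda>f. \<Sum>b\<in>Basis. of_int (f b) *\<^sub>R b) ` P" by blast
  qed
  ultimately show ?thesis by (rule finite_surj)
qed

text \<open>A cell lies in a ball and contains an open cube of side 1/N. The lower bound is needed
  for dividing by the measure of a cell.\<close>

lemma grid_cell_measure:
  fixes x :: "'a::euclidean_space"
  assumes N: "N > 0"
  defines "Q \<equiv> {y. grid_cell N y = grid_cell N x}"
  shows "Q \<in> fmeasurable lebesgue" "measure lebesgue Q \<ge> (1 / N) ^ DIM('a)"
proof -
  have "Q = grid_cell N -` {grid_cell N x} \<inter> space borel" by (auto simp: Q_def)
  also have "\<dots> \<in> sets borel" by (rule measurable_sets[OF grid_cell_measurable]) simp
  finally have Q: "Q \<in> sets lebesgue" by simp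
  have "Q \<subseteq> cball x (real DIM('a) / N)"
    using grid_cell_diam[OF N] by (auto simp: Q_def dist_norm norm_minus_commute)
  then show f: "Q \<in> fmeasurable lebesgue"
    by (rule fmeasurableI2[OF lmeasurable_cball]) (rule Q)
  define k where "k = grid_cell N x"
  define l where "l = (1 / N) *\<^sub>R k"
  define u where "u = l + (1 / N) *\<^sub>R One"
  have ib: "u \<bullet> b = l \<bullet> b + 1 / N" if "b \<in> Basis" for b using that by (simp add: u_def inner_add_left)
  have "box l u \<subseteq> Q"
  proof
    fix y assume y: "y \<in> box l u"
    have "\<lfloor>N * (y \<bullet> b)\<rfloor> = \<lfloor>N * (x \<bullet> b)\<rfloor>" if b: "b \<in> Basis" for b
    proof -
      have "l \<bullet> b < y \<bullet> b" "y \<bullet> b < l \<bullet> b + 1 / N" using y b ib[OF b] by (auto simp: box_def)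
      moreover have "l \<bullet> b = of_int \<lfloor>N * (x \<bullet> b)\<rfloor> / N" using b by (simp add: l_def k_def grid_cell_inner)
      ultimately show ?thesis using N by (intro floor_unique) (auto simp: field_simps)
    qed
    then show "y \<in> Q" by (simp add: Q_def grid_cell_def)
  qed
  then have "measure lebesgue (box l u) \<le> measure lebesgue Q"
    by (intro measure_mono_fmeasurable f) auto
  moreover have "measure lebesgue (box l u) = (1 / N) ^ DIM('a)"
  proof -
    have "measure lborel (box l u) = (\<Prod>b\<in>Basis. (u - l) \<bullet> b)"
      using N ib by (subst measure_lborel_box) auto
    also have "\<dots> = (\<Prod>b\<in>(Basis :: 'a set). 1 / N)"
      using ib by (intro prod.cong) (auto simp: inner_diff_left)
    finally show ?thesis by simp
  qed
  ultimately show "measure lebesgue Q \<ge> (1 / N) ^ DIM('a)" by simp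
qed

text \<open>The variance identity, from expanding the square under the double integral. It splits
  the L2 norm on a cell into an oscillation, which the energy controls, and a mean.\<close>

lemma square_integral_product:
  fixes w :: "'a::euclidean_space \<Rightarrow> real"
  assumes Q: "Q \<in> fmeasurable lebesgue" and w: "integrable lebesgue w" and w2: "integrable lebesgue (\<lambda>x. (w x)\<^sup>2)"
  defines "q \<equiv> indicator Q :: 'a \<Rightarrow> real"
  shows "integrable lebesgue (\<lambda>z. q (fst z) * q (snd z) * (w (fst z) - w (snd z))\<^sup>2)"
    and "measure lebesgue Q * (LINT x|lebesgue. q x * (w x)\<^sup>2) =
      1 / 2 * (LINT z|lebesgue. q (fst z) * q (snd z) * (w (fst z) - w (snd z))\<^sup>2) + (LINT x|lebesgue. q x * w x)\<^sup>2"
proof -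
  have Qs: "Q \<in> sets lebesgue" using Q by (rule fmeasurableD)
  have q: "integrable lebesgue q"
    using Q unfolding q_def fmeasurable_def by (intro integrable_real_indicator) blast+
  have qw: "integrable lebesgue (\<lambda>x. q x * w x)"
    unfolding q_def using integrable_mult_indicator[OF Qs w] by simp
  have qw2: "integrable lebesgue (\<lambda>x. q x * (w x)\<^sup>2)"
    unfolding q_def using integrable_mult_indicator[OF Qs w2] by simp
  have eq: "(\<lambda>z. q (fst z) * q (snd z) * (w (fst z) - w (snd z))\<^sup>2) =
    (\<lambda>z. (q (fst z) * (w (fst z))\<^sup>2) * q (snd z) + q (fst z) * (q (snd z) * (w (snd z))\<^sup>2)
      - 2 * ((q (fst z) * w (fst z)) * (q (snd z) * w (snd z))))"
    by (simp add: fun_eq_iff power2_eq_square algebra_simps)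
  note I1 = lebesgue_integral_product[OF qw2 q] and I2 = lebesgue_integral_product[OF q qw2]
    and I3 = lebesgue_integral_product[OF qw qw]
  show "integrable lebesgue (\<lambda>z. q (fst z) * q (snd z) * (w (fst z) - w (snd z))\<^sup>2)"
    unfolding eq using I1(1) I2(1) I3(1) by (intro Bochner_Integration.integrable_diff Bochner_Integration.integrable_add integrable_mult_right)
  have "(LINT z|lebesgue. q (fst z) * q (snd z) * (w (fst z) - w (snd z))\<^sup>2) =
    (LINT x|lebesgue. q x * (w x)\<^sup>2) * (LINT x|lebesgue. q x) + (LINT x|lebesgue. q x) * (LINT x|lebesgue. q x * (w x)\<^sup>2)
    - 2 * ((LINT x|lebesgue. q x * w x) * (LINT x|lebesgue. q x * w x))"
    unfolding eq
    by (simp only: Bochner_Integration.integral_diff Bochner_Integration.integral_add integral_mult_right_zero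
        Bochner_Integration.integrable_add integrable_mult_right I1 I2 I3)
  moreover have "(LINT x|lebesgue. q x) = measure lebesgue Q"
    unfolding q_def by simp
  ultimately show "measure lebesgue Q * (LINT x|lebesgue. q x * (w x)\<^sup>2) =
      1 / 2 * (LINT z|lebesgue. q (fst z) * q (snd z) * (w (fst z) - w (snd z))\<^sup>2) + (LINT x|lebesgue. q x * w x)\<^sup>2"
    by (simp add: power2_eq_square[of "integral\<^sup>L lebesgue _"] algebra_simps)
qed

lemma finite_family_convergent_subseq:
  fixes a :: "'b \<Rightarrow> nat \<Rightarrow> real"
  assumes "finite I" "\<And>i k. i \<in> I \<Longrightarrow> \<bar>a i k\<bar> \<le> B"
  shows "\<exists>r. strict_mono (r :: nat \<Rightarrow> nat) \<and> (\<forall>i\<in>I. convergent (\<lambda>k. a i (r k)))"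
  using assms
proof (induction I)
  case empty
  then show ?case by (auto intro: exI[of _ id] simp: strict_mono_def)
next
  case (insert i I)
  then obtain r :: "nat \<Rightarrow> nat" where r: "strict_mono r" "\<forall>i\<in>I. convergent (\<lambda>k. a i (r k))" by auto
  have "bounded (range (\<lambda>k. a i (r k)))"
    using insert.prems by (intro boundedI[of _ B]) auto
  then obtain l q where q: "strict_mono (q :: nat \<Rightarrow> nat)" "((\<lambda>k. a i (r k)) \<circ> q) \<longlonglongrightarrow> l"
    using bounded_imp_convergent_subsequence by blast
  have "convergent (\<lambda>k. a j ((r \<circ> q) k))" if "j \<in> insert i I" for j
  proof (cases "j = i")
    case True
    then show ?thesis using q(2) by (auto simp: o_def convergent_def)
  next
    case False
    then have "convergent ((\<lambda>k. a j (r k)) \<circ> q)" using that r(2) q(1) by (intro convergent_subseq_convergent) auto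
    then show ?thesis by (simp add: o_def)
  qed
  then show ?case using strict_mono_o[OF r(1) q(1)] by blast
qed

section \<open>Grid estimate and compactness in L2\<close>

context bounded_domain
begin

lemma square_le_diffq:
  fixes w :: "'a \<Rightarrow> real"
  assumes "norm (x - y) \<le> D" "real DIM('a) + 2 * s \<ge> 0"
  shows "(w x - w y)\<^sup>2 \<le> D powr (real DIM('a) + 2 * s) * (diffq s w (x, y))\<^sup>2"
proof (cases "x = y")
  case False
  define p where "p = real DIM('a) + 2 * s"
  have n: "norm (x - y) > 0" using False by simp
  have "(diffq s w (x, y))\<^sup>2 = (w x - w y)\<^sup>2 / norm (x - y) powr p"
    using diffq_mult[of s w "(x, y)" w] by (simp add: power2_eq_square p_def)
  then have "(w x - w y)\<^sup>2 = norm (x - y) powr p * (diffq s w (x, y))\<^sup>2" using n by simp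
  also have "\<dots> \<le> D powr p * (diffq s w (x, y))\<^sup>2"
    using assms n by (intro mult_right_mono powr_mono2) (auto simp: p_def)
  finally show ?thesis by (simp add: p_def)
qed simp

text \<open>The variance identity on each cell, with p = n + 2s: the oscillation is bounded by
  (n/N)^p times the energy of pairs inside the cell, and dividing by the measure, at least N^(-n),
  leaves n^p N^(-2s). Pairs belong to at most one cell, so the local energies add up to at most
  \<open>energy w\<close>.\<close>

lemma grid_estimate:
  assumes s: "s > 0" and N: "N > 0" and w: "w \<in> H0"
  defines "q \<equiv> \<lambda>k. indicator {y. grid_cell N y = k} :: 'a \<Rightarrow> real"
  shows "(LINT x|lebesgue. (w x)\<^sup>2) \<le> (real DIM('a) powr (real DIM('a) + 2 * s) * N powr (- 2 * s)) * energy w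
     + N ^ DIM('a) * (\<Sum>k\<in>grid_cell N ` \<Omega>. (LINT x|lebesgue. q k x * w x)\<^sup>2)"
proof -
  define n where "n = DIM('a)"
  define p where "p = real n + 2 * s"
  define K where "K = grid_cell N ` \<Omega>"
  define D where "D = real n / N"
  define c where "c = D powr p * N ^ n / 2"
  define I where "I k = (LINT x|lebesgue. q k x * w x)" for k
  define G where "G k = (LINT z|lebesgue. q k (fst z) * q k (snd z) * (diffq s w z)\<^sup>2)" for k
  have finK: "finite K" unfolding K_def by (rule grid_cell_finite[OF bounded_domain N])
  have p: "p \<ge> 0" using s by (simp add: p_def)
  obtain C where int: "\<And>u. u \<in> H0 \<Longrightarrow> integrable lebesgue u" using integ_bound by metis
  have w1: "integrable lebesgue w" using int[OF w] .
  have w2: "integrable lebesgue (\<lambda>x. (w x)\<^sup>2)"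
    using l2_mult_integrable[OF H0sD(1)[OF w] H0sD(1)[OF w] H0sD(5)[OF w] H0sD(5)[OF w]] by (simp add: power2_eq_square)
  have d2: "integrable lebesgue (\<lambda>z. (diffq s w z)\<^sup>2)"
    using inner_Hs_integrable[OF w w] by (simp add: power2_eq_square)
  have energy: "energy w = (LINT z|lebesgue. (diffq s w z)\<^sup>2)"
    using inner_Hs_self[OF w] by (simp add: inner_Hs_def power2_eq_square)
  have Qs: "{y. grid_cell N y = k} \<in> fmeasurable lebesgue" "measure lebesgue {y. grid_cell N y = k} \<ge> (1 / N) ^ n"
    if "k \<in> K" for k
    using that grid_cell_measure[OF N, where 'a = 'a] by (auto simp: K_def n_def)
  have qm [measurable]: "q k \<in> borel_measurable lebesgue" if "k \<in> K" for k
    unfolding q_def using Qs(1)[OF that] by (intro borel_measurable_indicator) (rule fmeasurableD)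
  have Gint: "integrable lebesgue (\<lambda>z. q k (fst z) * q k (snd z) * (diffq s w z)\<^sup>2)" if "k \<in> K" for k
  proof (rule Bochner_Integration.integrable_bound[OF d2])
    note [measurable] = qm[OF that] H0sD(1)[OF w]
    show "(\<lambda>z. q k (fst z) * q k (snd z) * (diffq s w z)\<^sup>2) \<in> borel_measurable lebesgue" by measurable
    show "AE z in lebesgue. norm (q k (fst z) * q k (snd z) * (diffq s w z)\<^sup>2) \<le> norm ((diffq s w z)\<^sup>2)"
      by (rule AE_I2) (simp add: q_def indicator_def)
  qed
  have cell: "(LINT x|lebesgue. q k x * (w x)\<^sup>2) \<le> c * G k + N ^ n * (I k)\<^sup>2" if k: "k \<in> K" for k
  proof -
    define \<mu> where "\<mu> = measure lebesgue {y. grid_cell N y = k}"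
    have \<mu>: "\<mu> \<ge> (1 / N) ^ n" using Qs(2)[OF k] by (simp add: \<mu>_def)
    moreover have "(1 / N) ^ n > 0" using N by simp
    ultimately have \<mu>0: "\<mu> > 0" by linarith
    have "1 / \<mu> \<le> 1 / (1 / N) ^ n" using \<mu> \<open>(1 / N) ^ n > 0\<close> by (intro frac_le) auto
    then have \<mu>N: "1 / \<mu> \<le> N ^ n" using N by (simp add: power_divide)
    have qk: "q k = indicator {y. grid_cell N y = k}" by (simp add: q_def)
    note sq = square_integral_product[OF Qs(1)[OF k] w1 w2, folded qk]
    have "(LINT z|lebesgue. q k (fst z) * q k (snd z) * (w (fst z) - w (snd z))\<^sup>2) \<le>
      (LINT z|lebesgue. D powr p * (q k (fst z) * q k (snd z) * (diffq s w z)\<^sup>2))"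
    proof (rule integral_mono[OF sq(1)])
      show "integrable lebesgue (\<lambda>z. D powr p * (q k (fst z) * q k (snd z) * (diffq s w z)\<^sup>2))"
        by (intro integrable_mult_right Gint k)
      fix z :: "'a \<times> 'a"
      show "q k (fst z) * q k (snd z) * (w (fst z) - w (snd z))\<^sup>2 \<le> D powr p * (q k (fst z) * q k (snd z) * (diffq s w z)\<^sup>2)"
      proof (cases "grid_cell N (fst z) = k \<and> grid_cell N (snd z) = k")
        case True
        then have "norm (fst z - snd z) \<le> D" unfolding D_def n_def by (intro grid_cell_diam N) simp
        from square_le_diffq[OF this, of w] p show ?thesis using True by (simp add: q_def p_def n_def)
      qed (auto simp: q_def indicator_def)
    qed
    also have "\<dots> = D powr p * G k" by (simp add: G_def)
    finally have "\<mu> * (LINT x|lebesgue. q k x * (w x)\<^sup>2) \<le> 1 / 2 * (D powr p * G k) + (I k)\<^sup>2"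
      using sq(2) by (simp add: \<mu>_def I_def)
    then have "(LINT x|lebesgue. q k x * (w x)\<^sup>2) \<le> (1 / 2 * (D powr p * G k) + (I k)\<^sup>2) * (1 / \<mu>)"
      using \<mu>0 by (simp add: field_simps)
    also have "\<dots> \<le> (1 / 2 * (D powr p * G k) + (I k)\<^sup>2) * N ^ n"
    proof (rule mult_left_mono[OF \<mu>N])
      have "G k \<ge> 0" unfolding G_def by (intro Bochner_Integration.integral_nonneg) (simp add: q_def)
      then show "0 \<le> 1 / 2 * (D powr p * G k) + (I k)\<^sup>2" by simp
    qed
    finally show ?thesis by (simp add: c_def algebra_simps)
  qed
  \<comment> \<open>The cells are disjoint, so at most one summand is nonzero.\<close>
  have sum_q: "(\<Sum>k\<in>K. q k x * a k) = (if grid_cell N x \<in> K then a (grid_cell N x) else 0)" for x and a :: "'a \<Rightarrow> real"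
  proof -
    have "(\<Sum>k\<in>K. q k x * a k) = (\<Sum>k\<in>K. if grid_cell N x = k then a k else 0)"
      by (intro sum.cong) (auto simp: q_def indicator_def)
    then show ?thesis using finK by simp
  qed
  have "(\<lambda>x. (w x)\<^sup>2) = (\<lambda>x. \<Sum>k\<in>K. q k x * (w x)\<^sup>2)"
  proof
    fix x show "(w x)\<^sup>2 = (\<Sum>k\<in>K. q k x * (w x)\<^sup>2)"
      using sum_q[of x "\<lambda>_. (w x)\<^sup>2"] H0sD(3)[OF w, of x] by (cases "x \<in> \<Omega>") (auto simp: K_def)
  qed
  then have "(LINT x|lebesgue. (w x)\<^sup>2) = (LINT x|lebesgue. (\<Sum>k\<in>K. q k x * (w x)\<^sup>2))" by metis
  also have "\<dots> = (\<Sum>k\<in>K. (LINT x|lebesgue. q k x * (w x)\<^sup>2))"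
  proof (rule Bochner_Integration.integral_sum)
    fix k assume "k \<in> K"
    then show "integrable lebesgue (\<lambda>x. q k x * (w x)\<^sup>2)"
      unfolding q_def using integrable_mult_indicator[OF fmeasurableD[OF Qs(1)] w2, of k] by simp
  qed
  also have "\<dots> \<le> (\<Sum>k\<in>K. c * G k + N ^ n * (I k)\<^sup>2)" by (intro sum_mono cell)
  also have "\<dots> = c * (\<Sum>k\<in>K. G k) + N ^ n * (\<Sum>k\<in>K. (I k)\<^sup>2)"
    by (simp add: sum.distrib sum_distrib_left)
  also have "c * (\<Sum>k\<in>K. G k) \<le> (real n powr p * N powr (- 2 * s)) * energy w"
  proof (rule mult_mono)
    have "c \<le> D powr p * N ^ n" using N by (simp add: c_def)
    also have "\<dots> = real n powr p * (N powr n / N powr p)"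
      using N by (simp add: D_def powr_divide powr_realpow)
    also have "N powr n / N powr p = N powr (- 2 * s)" by (simp add: p_def powr_diff[symmetric])
    finally show "c \<le> real n powr p * N powr (- 2 * s)" .
    have "(\<Sum>k\<in>K. G k) = (LINT z|lebesgue. (\<Sum>k\<in>K. q k (fst z) * q k (snd z) * (diffq s w z)\<^sup>2))"
      unfolding G_def by (rule Bochner_Integration.integral_sum[symmetric]) (rule Gint)
    also have "\<dots> \<le> (LINT z|lebesgue. (diffq s w z)\<^sup>2)"
    proof (rule integral_mono[OF _ d2])
      show "integrable lebesgue (\<lambda>z. \<Sum>k\<in>K. q k (fst z) * q k (snd z) * (diffq s w z)\<^sup>2)"
        by (intro Bochner_Integration.integrable_sum Gint)
      fix z :: "'a \<times> 'a"
      show "(\<Sum>k\<in>K. q k (fst z) * q k (snd z) * (diffq s w z)\<^sup>2) \<le> (diffq s w z)\<^sup>2"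
        unfolding mult.assoc sum_q by (simp add: q_def indicator_def)
    qed
    finally show "(\<Sum>k\<in>K. G k) \<le> energy w" by (simp only: energy)
    show "0 \<le> (\<Sum>k\<in>K. G k)"
      unfolding G_def by (intro sum_nonneg Bochner_Integration.integral_nonneg) (simp add: q_def)
  qed simp
  finally show ?thesis
    by (simp add: I_def K_def n_def p_def)
qed

text \<open>The integrals over the cells of all grids of size \<open>1 / (j + 1)\<close> converge along a
  diagonal subsequence, and by the grid estimate this gives a Cauchy sequence.\<close>

lemma Rellich:
  assumes s: "s > 0" and v: "\<And>k. v k \<in> H0" and M: "\<And>k. gag (v k) \<le> ennreal M" "M \<ge> 0"
  obtains r u where "strict_mono (r :: nat \<Rightarrow> nat)" "u \<in> H0" "quasi_continuous s \<Omega> u"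
    "(\<lambda>k. l2sq lebesgue (\<lambda>x. v (r k) x - u x)) \<longlonglongrightarrow> 0"
proof -
  obtain C where C: "C > 0" and int: "\<And>u. u \<in> H0 \<Longrightarrow> integrable lebesgue u"
    and CI: "\<And>u. u \<in> H0 \<Longrightarrow> (integ u)\<^sup>2 \<le> C * energy u"
    using integ_bound by metis
  define n where "n = DIM('a)"
  define K where "K j = grid_cell (real (Suc j)) ` \<Omega>" for j
  have finK: "finite (K j)" for j unfolding K_def by (rule grid_cell_finite[OF bounded_domain]) simp
  define q where "q j k = (indicator {y. grid_cell (real (Suc j)) y = k} :: 'a \<Rightarrow> real)" for j k
  define a where "a j k i = (LINT x|lebesgue. q j k x * v i x)" for j k i
  have qm: "{y. grid_cell (real (Suc j)) y = k} \<in> sets lebesgue" if "k \<in> K j" for j k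
    using that grid_cell_measure(1)[of "real (Suc j)", where 'a = 'a] by (auto simp: K_def dest!: fmeasurableD)
  have qint: "integrable lebesgue (\<lambda>x. q j k x * u x)" if "k \<in> K j" "u \<in> H0" for j k u
    unfolding q_def using integrable_mult_indicator[OF qm[OF that(1)] int[OF that(2)]] by simp
  \<comment> \<open>The integral over a cell is at most that of |v i|, which \<open>H0s_abs\<close>
    keeps in \<open>H0\<close> with energy at most \<open>M\<close>.\<close>
  have abd: "\<bar>a j k i\<bar> \<le> sqrt (C * M)" if k: "k \<in> K j" for j k i
  proof -
    have "\<bar>a j k i\<bar> \<le> (LINT x|lebesgue. \<bar>q j k x * v i x\<bar>)"
      unfolding a_def using integral_norm_bound[of lebesgue "\<lambda>x. q j k x * v i x"] by simp
    also have "\<dots> \<le> integ (\<lambda>x. \<bar>v i x\<bar>)"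
      by (rule integral_mono[OF integrable_abs[OF qint[OF k v]] int[OF H0s_abs[OF v]]])
        (simp add: q_def indicator_def)
    finally have "(a j k i)\<^sup>2 \<le> (integ (\<lambda>x. \<bar>v i x\<bar>))\<^sup>2"
      by (simp add: abs_le_square_iff[symmetric])
    also have "\<dots> \<le> C * energy (\<lambda>x. \<bar>v i x\<bar>)" by (rule CI[OF H0s_abs[OF v]])
    also have "\<dots> \<le> C * M"
    proof (intro mult_left_mono)
      have "gag (\<lambda>x. \<bar>v i x\<bar>) \<le> ennreal M" using gagliardo_abs_le M(1) by (rule order_trans)
      then show "energy (\<lambda>x. \<bar>v i x\<bar>) \<le> M" using energy_le_iff[OF H0s_abs[OF v] M(2)] by simp
    qed (use C in simp)
    finally show ?thesis by (metis real_le_rsqrt power2_abs)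
  qed
  interpret subseqs "\<lambda>j r. \<forall>k\<in>K j. convergent (\<lambda>i. a j k (r i))"
  proof
    fix j and r :: "nat \<Rightarrow> nat" assume "strict_mono r"
    have "\<exists>r'. strict_mono r' \<and> (\<forall>k\<in>K j. convergent (\<lambda>i. a j k (r (r' i))))"
      by (rule finite_family_convergent_subseq[OF finK, of j "\<lambda>k i. a j k (r i)" "sqrt (C * M)"]) (rule abd)
    then show "\<exists>r'. strict_mono r' \<and> (\<forall>k\<in>K j. convergent (\<lambda>i. a j k ((r \<circ> r') i)))" by simp
  qed
  define r where "r = diagseq"
  have r: "strict_mono r" unfolding r_def by (rule subseq_diagseq)
  have conv: "convergent (\<lambda>i. a j k (r i))" if "k \<in> K j" for j k
  proof -
    \<comment> \<open>The diagonal sequence is a subsequence of the refinement made for grid j only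
      after its first j + 1 terms.\<close>
    have "\<forall>k\<in>K j. convergent (\<lambda>i. a j k ((diagseq \<circ> ((+) (Suc j))) i))"
    proof (rule diagseq_holds)
      fix j r t assume "strict_mono (r :: nat \<Rightarrow> nat)" "\<forall>k\<in>K j. convergent (\<lambda>i. a j k (t i))"
      then show "\<forall>k\<in>K j. convergent (\<lambda>i. a j k ((t \<circ> r) i))"
        using convergent_subseq_convergent[of "\<lambda>i. a j _ (t i)" r] by (auto simp: o_def)
    qed
    then have "convergent (\<lambda>i. a j k (r (i + Suc j)))" using that by (simp add: r_def add.commute)
    then show ?thesis using convergent_ignore_initial_segment[of "\<lambda>i. a j k (r i)" "Suc j"] by simp
  qed
  have "l2_Cauchy lebesgue (\<lambda>k. v (r k))"
    unfolding l2_Cauchy_def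
  proof (intro allI impI)
    fix e :: real assume e: "e > 0"
    define A where "A = real n powr (real n + 2 * s)"
    \<comment> \<open>The grid is fixed first: 4 M bounds the energy of every difference of two
      members, so a fine grid makes the energy term of \<open>grid_estimate\<close> at most
      e/2.\<close>
    have "((\<lambda>j. A * real (Suc j) powr (- 2 * s) * (4 * M)) \<longlongrightarrow> A * 0 * (4 * M)) sequentially"
      using s by (intro tendsto_intros tendsto_neg_powr filterlim_compose[OF filterlim_real_sequentially filterlim_Suc]) auto
    then have "eventually (\<lambda>j. A * real (Suc j) powr (- 2 * s) * (4 * M) < e / 2) sequentially"
      using e by (intro order_tendstoD(2)) auto
    then obtain j where j: "A * real (Suc j) powr (- 2 * s) * (4 * M) < e / 2"
      by (auto simp: eventually_sequentially)
    define N where "N = real (Suc j)"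
    have N: "N > 0" by (simp add: N_def)
    define l where "l k = lim (\<lambda>i. a j k (r i))" for k
    have l: "(\<lambda>i. a j k (r i)) \<longlonglongrightarrow> l k" if "k \<in> K j" for k
      using conv[OF that] by (simp add: l_def convergent_LIMSEQ_iff)
    \<comment> \<open>For the finitely many cells of this fixed grid the integrals are eventually
      near their limits; the factor 4 pays for passing through \<open>l k\<close> when two indices
      are compared.\<close>
    have "(\<lambda>i. N ^ n * (\<Sum>k\<in>K j. 4 * (a j k (r i) - l k)\<^sup>2)) \<longlonglongrightarrow> N ^ n * (\<Sum>k\<in>K j. 4 * (l k - l k)\<^sup>2)"
      by (intro tendsto_intros l)
    then have "eventually (\<lambda>i. N ^ n * (\<Sum>k\<in>K j. 4 * (a j k (r i) - l k)\<^sup>2) < e / 2) sequentially"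
      using e by (intro order_tendstoD(2)) auto
    then obtain i0 where i0: "\<And>i. i \<ge> i0 \<Longrightarrow> N ^ n * (\<Sum>k\<in>K j. 4 * (a j k (r i) - l k)\<^sup>2) < e / 2"
      by (auto simp: eventually_sequentially)
    have "l2sq lebesgue (\<lambda>x. v (r i) x - v (r i') x) \<le> ennreal e" if i: "i \<ge> i0" "i' \<ge> i0" for i i'
    proof -
      define w where "w x = v (r i) x - v (r i') x" for x
      have w: "w \<in> H0" unfolding w_def by (intro H0s_diff v)
      have "energy w \<le> 4 * M"
      proof -
        have "energy (v i) \<le> M" for i using energy_le_iff[OF v M(2)] M(1) by simp
        then have "2 * energy (v (r i)) + 2 * energy (v (r i')) \<le> 2 * M + 2 * M" by (intro add_mono mult_left_mono) auto
        then show ?thesis using energy_parallelogram[OF v[of "r i"] v[of "r i'"]] energy_nonneg[of "\<lambda>x. v (r i) x + v (r i') x"]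
          unfolding w_def by linarith
      qed
      then have 1: "A * N powr (- 2 * s) * energy w \<le> e / 2"
        using j mult_left_mono[of "energy w" "4 * M" "A * N powr (- 2 * s)"] by (simp add: A_def N_def)
      have "(LINT x|lebesgue. q j k x * w x) = a j k (r i) - a j k (r i')" if "k \<in> K j" for k
        unfolding w_def right_diff_distrib a_def by (intro Bochner_Integration.integral_diff qint that v)
      then have "N ^ n * (\<Sum>k\<in>K j. (LINT x|lebesgue. q j k x * w x)\<^sup>2) = N ^ n * (\<Sum>k\<in>K j. (a j k (r i) - a j k (r i'))\<^sup>2)"
        by simp
      also have "\<dots> \<le> N ^ n * (\<Sum>k\<in>K j. 2 * (a j k (r i) - l k)\<^sup>2 + 2 * (a j k (r i') - l k)\<^sup>2)"
      proof (intro mult_left_mono sum_mono)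
        fix k
        have "(x - y)\<^sup>2 \<le> 2 * (x - z)\<^sup>2 + 2 * (y - z)\<^sup>2" for x y z :: real
        proof -
          have "2 * (x - z)\<^sup>2 + 2 * (y - z)\<^sup>2 - (x - y)\<^sup>2 = (x + y - 2 * z)\<^sup>2"
            by (simp add: power2_eq_square algebra_simps)
          then show ?thesis by (metis zero_le_power2 diff_ge_0_iff_ge)
        qed
        then show "(a j k (r i) - a j k (r i'))\<^sup>2 \<le> 2 * (a j k (r i) - l k)\<^sup>2 + 2 * (a j k (r i') - l k)\<^sup>2" .
      qed (use N in simp)
      also have "\<dots> = (N ^ n * (\<Sum>k\<in>K j. 4 * (a j k (r i) - l k)\<^sup>2) + N ^ n * (\<Sum>k\<in>K j. 4 * (a j k (r i') - l k)\<^sup>2)) / 2"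
        by (simp add: sum.distrib sum_distrib_left[symmetric] field_simps)
      also have "\<dots> \<le> e / 2" using i0[OF i(1)] i0[OF i(2)] by simp
      finally have 2: "N ^ n * (\<Sum>k\<in>K j. (LINT x|lebesgue. q j k x * w x)\<^sup>2) \<le> e / 2" .
      have "(LINT x|lebesgue. (w x)\<^sup>2) \<le> A * N powr (- 2 * s) * energy w + N ^ n * (\<Sum>k\<in>K j. (LINT x|lebesgue. q j k x * w x)\<^sup>2)"
        using grid_estimate[OF s N w] unfolding A_def n_def K_def q_def N_def .
      then have "(LINT x|lebesgue. (w x)\<^sup>2) \<le> e" using 1 2 by linarith
      moreover have "l2sq lebesgue w = ennreal (LINT x|lebesgue. (w x)\<^sup>2)"
        using l2sq_eq_integral[OF H0sD(1)[OF w] H0sD(5)[OF w]] H0sD(5)[OF w]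
        by (metis (no_types, lifting) ennreal_enn2real infinity_ennreal_def power2_eq_square Bochner_Integration.integral_cong)
      ultimately show ?thesis by (simp add: w_def[abs_def] ennreal_leI)
    qed
    then show "\<exists>N. \<forall>i\<ge>N. \<forall>j\<ge>N. l2sq lebesgue (\<lambda>x. v (r i) x - v (r j) x) \<le> ennreal e" by blast
  qed
  then obtain g where [measurable]: "g \<in> borel_measurable lebesgue" and g: "(\<lambda>k. l2sq lebesgue (\<lambda>x. v (r k) x - g x)) \<longlonglongrightarrow> 0"
    by (rule l2_complete[rotated]) (blast | rule H0sD(1)[OF v])+
  \<comment> \<open>The L2 limit is first placed in \<open>H0\<close>, then replaced by a
    quasi-continuous representative; both changes are made on null sets.\<close>
  obtain u' where u': "u' \<in> H0" "AE x in lebesgue. u' x = g x"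
    by (rule H0s_weak_limit[of "\<lambda>k. v (r k)" M g]) (use v M g in auto)
  obtain u where u: "u \<in> H0" "quasi_continuous s \<Omega> u" "AE x in lebesgue. u x = u' x"
    using quasi_continuous_representative[OF u'(1)] by blast
  have "l2sq lebesgue (\<lambda>x. v (r k) x - u x) = l2sq lebesgue (\<lambda>x. v (r k) x - g x)" for k
    by (rule l2sq_cong_AE) (use u(3) u'(2) in eventually_elim, simp)
  with g have "(\<lambda>k. l2sq lebesgue (\<lambda>x. v (r k) x - u x)) \<longlonglongrightarrow> 0" by simp
  with that r u show ?thesis by blast
qed

text \<open>The subsequence is refined coordinate by coordinate; convergence in the earlier
  coordinates is inherited.\<close>

lemma Rellich_tuple:
  fixes v :: "nat \<Rightarrow> nat \<Rightarrow> 'a \<Rightarrow> real"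
  assumes s: "s > 0" and M: "M \<ge> 0"
    and v: "\<And>i k. i \<in> {1..m} \<Longrightarrow> v i k \<in> H0" "\<And>i k. i \<in> {1..m} \<Longrightarrow> gag (v i k) \<le> ennreal M"
  shows "\<exists>r u. strict_mono (r :: nat \<Rightarrow> nat) \<and> (\<forall>i\<in>{1..m}. u i \<in> H0 \<and> quasi_continuous s \<Omega> (u i) \<and>
    (\<lambda>k. l2sq lebesgue (\<lambda>x. v i (r k) x - u i x)) \<longlonglongrightarrow> 0)"
  using v
proof (induction m)
  case 0
  then show ?case by (auto intro: exI[of _ id] simp: strict_mono_def)
next
  case (Suc m)
  have "\<exists>r u. strict_mono (r :: nat \<Rightarrow> nat) \<and> (\<forall>i\<in>{1..m}. u i \<in> H0 \<and> quasi_continuous s \<Omega> (u i) \<and>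
    (\<lambda>k. l2sq lebesgue (\<lambda>x. v i (r k) x - u i x)) \<longlonglongrightarrow> 0)"
    by (rule Suc.IH) (use Suc.prems in auto)
  then obtain r u where r: "strict_mono (r :: nat \<Rightarrow> nat)" and u: "\<And>i. i \<in> {1..m} \<Longrightarrow> u i \<in> H0 \<and> quasi_continuous s \<Omega> (u i) \<and>
    (\<lambda>k. l2sq lebesgue (\<lambda>x. v i (r k) x - u i x)) \<longlonglongrightarrow> 0"
    by blast
  have vm: "v (Suc m) k \<in> H0" "gag (v (Suc m) k) \<le> ennreal M" for k using Suc.prems by auto
  obtain q u' where q: "strict_mono (q :: nat \<Rightarrow> nat)" and u': "u' \<in> H0" "quasi_continuous s \<Omega> u'"
    "(\<lambda>k. l2sq lebesgue (\<lambda>x. v (Suc m) (r (q k)) x - u' x)) \<longlonglongrightarrow> 0"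
    by (rule Rellich[OF s vm(1) vm(2) M, of r]) blast
  define y where "y i = (if i = Suc m then u' else u i)" for i
  have "y i \<in> H0 \<and> quasi_continuous s \<Omega> (y i) \<and> (\<lambda>k. l2sq lebesgue (\<lambda>x. v i ((r \<circ> q) k) x - y i x)) \<longlonglongrightarrow> 0"
    if "i \<in> {1..Suc m}" for i
  proof (cases "i = Suc m")
    case False
    then have "i \<in> {1..m}" using that by auto
    with u[OF this] False LIMSEQ_subseq_LIMSEQ[OF _ q, of "\<lambda>k. l2sq lebesgue (\<lambda>x. v i (r k) x - u i x)" 0]
    show ?thesis by (simp add: y_def o_def)
  qed (use u' in \<open>simp add: y_def\<close>)
  then show ?case using strict_mono_o[OF r q] by blast
qed

end

section \<open>Existence of optimal partitions\<close>

lemma open_superlevel: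
  assumes "open G" "continuous_on (- G) u"
  shows "open ({x. u x > (0::real)} \<union> G)"
proof -
  have "closed ((- G) \<inter> u -` {..0})"
    by (intro continuous_closed_preimage assms) (use assms in auto)
  moreover have "- ({x. u x > 0} \<union> G) = (- G) \<inter> u -` {..0}" by auto
  ultimately show ?thesis by (simp only: open_closed)
qed

context bounded_domain
begin

lemma superlevel_quasi_open:
  assumes "u \<in> H0" "quasi_continuous s \<Omega> u"
  shows "{x. u x > 0} \<in> quasi_open_sets s \<Omega>"
proof -
  obtain G where G: "small_open_seq s \<Omega> G" "\<And>k. continuous_on (- G k) u"
    using assms(2) unfolding quasi_continuous_def by blast
  then have "open ({x. u x > 0} \<union> G k)" for k
    by (intro open_superlevel) (auto simp: small_open_seq_def)
  moreover have "{x. u x > 0} \<subseteq> \<Omega>" using H0sD(3)[OF assms(1)] by force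
  ultimately show ?thesis using G(1) unfolding quasi_open_sets_def by blast
qed

text \<open>The set lies in an open set obtained by adding small open sets \<open>G\<close> and
  \<open>H\<close> to its two factors, and almost every point of that open set is in
  \<open>G\<close> or \<open>H\<close>. As the obstacle in \<open>cap\<close> is imposed a.e., a
  competitor for the union of \<open>G\<close> and \<open>H\<close> is one for the intersection as
  well.\<close>

lemma cap_superlevel_Int_null:
  assumes u: "u \<in> H0" "quasi_continuous s \<Omega> u" and v: "v \<in> H0" "quasi_continuous s \<Omega> v"
    and ae: "AE x in lebesgue. \<not> (u x > 0 \<and> v x > 0)"
  shows "cp ({x. u x > 0} \<inter> {x. v x > 0}) = 0"
proof -
  let ?A = "{x. u x > 0}" and ?B = "{x. v x > 0}"
  have "cp (?A \<inter> ?B) \<le> 0 + ennreal e" if e: "e > 0" for e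
  proof -
    \<comment> \<open>\<open>cap_Un_small\<close> then gives e/2 for the union, leaving room for the
      strict inequality that \<open>cap_lessE\<close> asks for.\<close>
    have e12: "e / 12 > 0" using e by simp
    obtain G where G: "open G" "cp G \<le> ennreal (e / 12)" "continuous_on (- G) u"
      using quasi_continuousE[OF u(2) e12] by metis
    obtain H where H: "open H" "cp H \<le> ennreal (e / 12)" "continuous_on (- H) v"
      using quasi_continuousE[OF v(2) e12] by metis
    have "cp (G \<union> H) \<le> ennreal (e / 2)"
      by (rule cap_Un_small) (use G(2) H(2) e in simp_all)
    also have "\<dots> < ennreal e" using e by (simp add: ennreal_less_iff)
    finally obtain g V where g: "competitor (G \<union> H) g V" "gag g < ennreal e"
      by (rule cap_lessE)
    have "AE x in lebesgue. x \<in> (?A \<union> G) \<inter> (?B \<union> H) \<longrightarrow> 1 \<le> g x"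
      using ae competitorD(5)[OF g(1)] by eventually_elim (use competitorD(4)[OF g(1)] in auto)
    then have "cp (?A \<inter> ?B) \<le> gag g"
      by (rule cap_le[OF competitorD(1)[OF g(1)], rotated 2])
        (auto intro!: open_Int open_superlevel G H)
    also have "\<dots> \<le> ennreal e" using g(2) by simp
    finally show ?thesis by simp
  qed
  then have "cp (?A \<inter> ?B) \<le> 0" by - (rule ennreal_le_epsilon, simp)
  then show ?thesis by simp
qed

end

theorem theorem2p5:
  fixes \<Omega> :: "'a::euclidean_space set"
    and s :: real and m :: nat
    and F :: "(nat \<Rightarrow> 'a set) \<Rightarrow> ennreal"
  assumes "bounded \<Omega>" and "lipschitz_domain \<Omega>"
    and "0 < s" and "s < 1"
    and "decreasing_functional s \<Omega> m F"
    and "weak_gamma_lsc s \<Omega> m F"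
  shows "\<exists>A\<in>admissible_partitions s \<Omega> m. F A = (INF B\<in>admissible_partitions s \<Omega> m. F B)"
proof -
  interpret bounded_domain \<Omega> s by unfold_locales (rule assms(1))
  let ?P = "admissible_partitions s \<Omega> m"
  \<comment> \<open>The tuple of empty sets shows that the admissible class is nonempty, so that a
    minimizing sequence exists.\<close>
  have "{} \<in> quasi_open_sets s \<Omega>"
    using superlevel_quasi_open[of "\<lambda>x. 0"] by (simp add: quasi_continuous_continuous)
  then have "(\<lambda>i\<in>{1..m}. {}) \<in> ?P"
    by (auto simp: admissible_partitions_def quasi_open_tuples_def)
  then have "F ` ?P \<noteq> {}" by blast
  from ennreal_Inf_countable_INF[OF this] obtain f where f: "decseq f" "range f \<subseteq> F ` ?P" "Inf (F ` ?P) = (INF i. f i)"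
    by blast
  then have "\<forall>k. \<exists>A\<in>?P. F A = f k" by (metis (no_types, lifting) imageE rangeI subsetD)
  then obtain S where S: "\<And>k. S k \<in> ?P" "\<And>k. F (S k) = f k" by metis
  have f_lim: "f \<longlonglongrightarrow> (INF B\<in>?P. F B)" using LIMSEQ_INF[OF f(1)] f(3) by simp
  have "\<forall>i k. \<exists>v. torsion_solution s \<Omega> (S k i) v"
    using torsion_solution_exists[OF assms(3,4)] by blast
  then obtain v where v: "\<And>i k. torsion_solution s \<Omega> (S k i) (v i k)" by metis
  have vK: "v i k \<in> H0_on (S k i)" for i k using v torsion_solution_iff by blast
  have vH: "v i k \<in> H0" for i k using vK by (rule H0_onD)
  obtain M where M: "M \<ge> 0" "\<And>A u. torsion_solution s \<Omega> A u \<Longrightarrow> gag u \<le> ennreal M"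
    using torsion_energy_bound[OF assms(3,4)] by metis
  obtain r u where r: "strict_mono (r :: nat \<Rightarrow> nat)" and u: "\<And>i. i \<in> {1..m} \<Longrightarrow> u i \<in> H0"
    "\<And>i. i \<in> {1..m} \<Longrightarrow> quasi_continuous s \<Omega> (u i)"
    "\<And>i. i \<in> {1..m} \<Longrightarrow> (\<lambda>k. l2sq lebesgue (\<lambda>x. v i (r k) x - u i x)) \<longlonglongrightarrow> 0"
    using Rellich_tuple[OF assms(3) M(1), of m v] vH M(2)[OF v] by blast
  \<comment> \<open>The abstraction is restricted because tuples are extensional functions on
    {1..m}.\<close>
  define A where "A = (\<lambda>i\<in>{1..m}. {x. u i x > 0})"
  have A_tuple: "A \<in> quasi_open_tuples s \<Omega> m"
    unfolding A_def quasi_open_tuples_def using u by (auto intro!: superlevel_quasi_open)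
  have "cap s (A i \<inter> A j) \<Omega> = 0" if ij: "i \<in> {1..m}" "j \<in> {1..m}" "i \<noteq> j" for i j
  proof -
    \<comment> \<open>Disjointness up to capacity is weakened to a.e. here, since L2 limits respect
      only a.e. relations; \<open>cap_superlevel_Int_null\<close> recovers it for the limit
      sets.\<close>
    have "AE x in lebesgue. v i (r k) x = 0 \<or> v j (r k) x = 0" for k
    proof -
      have "cp (S (r k) i \<inter> S (r k) j) = 0"
        using S(1)[of "r k"] ij by (auto simp: admissible_partitions_def)
      from cap_null_AE[OF this] H0_on_AE_zero[OF vK[of i "r k"]] H0_on_AE_zero[OF vK[of j "r k"]]
      show ?thesis by eventually_elim auto
    qed
    then have "AE x in lebesgue. u i x = 0 \<or> u j x = 0"
      by (rule limits_disjoint[OF H0sD(1)[OF u(1)[OF ij(1)]] H0sD(1)[OF u(1)[OF ij(2)]] H0sD(1)[OF vH] H0sD(1)[OF vH]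
            u(3)[OF ij(1)] u(3)[OF ij(2)]])
    then have "AE x in lebesgue. \<not> (u i x > 0 \<and> u j x > 0)" by eventually_elim auto
    then show ?thesis
      using cap_superlevel_Int_null[OF u(1,2)[OF ij(1)] u(1,2)[OF ij(2)]] ij by (simp add: A_def)
  qed
  with A_tuple have A_adm: "A \<in> ?P" by (auto simp: admissible_partitions_def)
  have "weak_gamma_conv s \<Omega> (\<lambda>k. S (r k) i) (A i)" if i: "i \<in> {1..m}" for i
    unfolding weak_gamma_conv_def
  proof (intro exI conjI allI)
    show "torsion_solution s \<Omega> (S (r k) i) (v i (r k))" for k by (rule v)
    show "u i \<in> H0" "quasi_continuous s \<Omega> (u i)" using u i by auto
    have "(\<integral>\<^sup>+ x \<in> \<Omega>. ennreal ((v i (r k) x - u i x)\<^sup>2) \<partial>lebesgue) \<le> l2sq lebesgue (\<lambda>x. v i (r k) x - u i x)" for k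
      unfolding l2sq_def by (intro nn_integral_mono) (auto simp: indicator_def)
    then show "(\<lambda>k. \<integral>\<^sup>+ x \<in> \<Omega>. ennreal ((v i (r k) x - u i x)\<^sup>2) \<partial>lebesgue) \<longlonglongrightarrow> 0"
      by (intro tendsto_0_ennreal_le[OF u(3)[OF i], where c = 1]) auto
    show "cap s (({x. u i x > 0} - A i) \<union> (A i - {x. u i x > 0})) \<Omega> = 0"
      using i by (simp add: A_def)
  qed
  moreover have "S (r k) \<in> quasi_open_tuples s \<Omega> m" for k
    using S(1)[of "r k"] by (simp add: admissible_partitions_def)
  ultimately have "F A \<le> liminf (\<lambda>k. F (S (r k)))"
    using A_tuple
    by (intro assms(6)[unfolded weak_gamma_lsc_def, THEN spec[of _ "\<lambda>k. S (r k)"], THEN spec[of _ A], THEN mp]) simp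
  also have "(\<lambda>k. F (S (r k))) \<longlonglongrightarrow> (INF B\<in>?P. F B)"
    using LIMSEQ_subseq_LIMSEQ[OF f_lim r] by (simp add: S(2) o_def)
  then have "liminf (\<lambda>k. F (S (r k))) = (INF B\<in>?P. F B)"
    by (intro lim_imp_Liminf) simp_all
  finally have "F A \<le> (INF B\<in>?P. F B)" .
  moreover have "(INF B\<in>?P. F B) \<le> F A" by (rule INF_lower[OF A_adm])
  ultimately show ?thesis using A_adm by (intro bexI[of _ A]) auto
qed

end
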